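(* Assume Case II together with condition (H-II) and the Chen–Ledoux condition (C-L($\lambda_n$)). Then each of the sequences $$\left\{\frac{\sqrt{n/\kappa_n}}{\lambda_n}(\hat\theta_n-\theta_n^* ),\ n\ge1\right\},\qquad \left\{\frac{\sqrt{n/\kappa_n}}{\lambda_n}(\hat\rho_n-\rho_n^* ),\ n\ge1\right\}$$ satisfies the large deviation principle in $\mathbb{R}$ with speed $\lambda_n^2$ and the same good rate function $J(x)=-\frac{(\gamma_1+\gamma_2)^3x^2}{16\gamma_1\gamma_2}$, $x\in\mathbb{R}$.
   Context: Model: for each $n\ge1$, $X_{k,n}=\theta_nX_{k-1,n}+\varepsilon_{k,n}$, $\varepsilon_{k,n}=\rho_n\varepsilon_{k-1,n}+V_k$ for $k=1,\dots,n$, with $X_{0,n}=\varepsilon_{0,n}=0$. Here $(V_k)_{k\ge1}$ are i.i.d. real random variables with $E V_1=0$, $EV_1^2=\sigma^2\in(0,\infty)$, and $E\exp(t_0V_1^2)<\infty$ for some $t_0>0$. $(\kappa_n)$ is a sequence of positive numbers with $\kappa_n\to\infty$, and $\gamma_1<0,\gamma_2<0$ are constants. Case II: $\theta_n=1+\gamma_1/\kappa_n$, $\rho_n=-1-\gamma_2/\kappa_n$. (H-II): $(\lambda_n)$ is an increasing sequence of positive numbers with $\lambda_n\to\infty$, $\frac{n}{\lambda_n^6\kappa_n^6}\to\infty$, $\frac{n}{\lambda_n^2\kappa_n^{11}}\to\infty$, $\frac{n\lambda_n^2}{\kappa_n^7\log^2n}\to\infty$. (C-L($a_n$)): $\frac{1}{a_n^2}\log\big(nP(|V_1|^4>a_n\sqrt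 n)\big)\to-\infty$. Estimators: $\hat\theta_n=\frac{\sum_{k=1}^nX_{k,n}X_{k-1,n}}{\sum_{k=1}^nX_{k-1,n}^2}$; residuals $\hat\varepsilon_{k,n}=X_{k,n}-\hat\theta_nX_{k-1,n}$ ($1\le k\le n$), $\hat\varepsilon_{0,n}=0$; $\hat\rho_n=\frac{\sum_{k=1}^n\hat\varepsilon_{k,n}\hat\varepsilon_{k-1,n}}{\sum_{k=1}^n\hat\varepsilon_{k-1,n}^2}$. Centering constants: $\theta_n^*=\frac{\theta_n+\rho_n}{1+\theta_n\rho_n}$, $\rho_n^*=\theta_n\rho_n\theta_n^*$. *)

theory Defs
  imports "HOL-Probability.Probability"
begin

definition eln :: "real \<Rightarrow> ereal" where
  "eln p = (if p \<le> 0 then -\<infinity> else ereal (ln p))"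

fun ar_eps :: "real \<Rightarrow> (nat \<Rightarrow> real) \<Rightarrow> nat \<Rightarrow> real" where
  "ar_eps \<rho> v 0 = 0"
| "ar_eps \<rho> v (Suc k) = \<rho> * ar_eps \<rho> v k + v (Suc k)"

fun ar_X :: "real \<Rightarrow> real \<Rightarrow> (nat \<Rightarrow> real) \<Rightarrow> nat \<Rightarrow> real" where
  "ar_X \<theta> \<rho> v 0 = 0"
| "ar_X \<theta> \<rho> v (Suc k) = \<theta> * ar_X \<theta> \<rho> v k + ar_eps \<rho> v (Suc k)"

text \<open>Least squares estimator of theta based on X_0,...,X_n.\<close>
definition theta_hat :: "real \<Rightarrow> real \<Rightarrow> (nat \<Rightarrow> real) \<Rightarrow> nat \<Rightarrow> real" where
  "theta_hat \<theta> \<rho> v n =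
     (\<Sum>k=1..n. ar_X \<theta> \<rho> v k * ar_X \<theta> \<rho> v (k - 1)) /
     (\<Sum>k=1..n. (ar_X \<theta> \<rho> v (k - 1))\<^sup>2)"

definition eps_hat :: "real \<Rightarrow> real \<Rightarrow> (nat \<Rightarrow> real) \<Rightarrow> nat \<Rightarrow> nat \<Rightarrow> real" where
  "eps_hat \<theta> \<rho> v n k =
     (if k = 0 then 0
      else ar_X \<theta> \<rho> v k - theta_hat \<theta> \<rho> v n * ar_X \<theta> \<rho> v (k - 1))"

definition rho_hat :: "real \<Rightarrow> real \<Rightarrow> (nat \<Rightarrow> real) \<Rightarrow> nat \<Rightarrow> real" where
  "rho_hat \<theta> \<rho> v n =
     (\<Sum>k=1..n. eps_hat \<theta> \<rho> v n k * eps_hat \<theta> \<rho> v n (k - 1)) /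
     (\<Sum>k=1..n. (eps_hat \<theta> \<rho> v n (k - 1))\<^sup>2)"

definition theta_star :: "real \<Rightarrow> real \<Rightarrow> real" where
  "theta_star \<theta> \<rho> = (\<theta> + \<rho>) / (1 + \<theta> * \<rho>)"

definition rho_star :: "real \<Rightarrow> real \<Rightarrow> real" where
  "rho_star \<theta> \<rho> = \<theta> * \<rho> * theta_star \<theta> \<rho>"

text \<open>Good rate function on the real line: nonnegative with compact level sets
  (compactness of level sets implies lower semicontinuity).\<close>
definition good_rate_function :: "(real \<Rightarrow> real) \<Rightarrow> bool" where
  "good_rate_function I \<longleftrightarrow> (\<forall>x. 0 \<le> I x) \<and> (\<forall>c. compact {x. I x \<le> c})"

definition LDP :: "'a measure \<Rightarrow> (nat \<Rightarrow> 'a \<Rightarrow> real) \<Rightarrow> (nat \<Rightarrow> real) \<Rightarrow> (real \<Rightarrow> real) \<Rightarrow> bool" where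
  "LDP M Z a I \<longleftrightarrow> good_rate_function I \<and>
     (\<forall>F. closed F \<longrightarrow>
        limsup (\<lambda>n. eln (measure M {\<omega> \<in> space M. Z n \<omega> \<in> F}) / ereal (a n))
          \<le> - (INF x\<in>F. ereal (I x))) \<and>
     (\<forall>G. open G \<longrightarrow>
        liminf (\<lambda>n. eln (measure M {\<omega> \<in> space M. Z n \<omega> \<in> G}) / ereal (a n))
          \<ge> - (INF x\<in>G. ereal (I x)))"

end

(* The numerator of theta_hat - theta_star is, up to a boundary term, the martingale
   M_n = sum V_k X_{k-1}; its denominator is S_n = sum X_{k-1}^2. Writing X as a combination of the
   two AR(1) processes with coefficients theta and rho, the identity
   (1 - a b) sum A_{k-1} B_{k-1} = sum V_k^2 + a sum A_{k-1} V_k + b sum B_{k-1} V_k - A_n B_n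
   shows that S_n / (n kappa_n) tends to a constant s with superexponentially small error
   probabilities at speed lam_n^2. The compensator of exp (t M_n), that is the sum of
   ln phi (t X_{k-1}) with phi the moment generating function of V_1, is then essentially
   t^2 sigma^2 S_n / 2, hence essentially deterministic. Stopping M_n as soon as S exceeds
   2 s n kappa_n makes this a statement about expectations, and the limiting log-mgf is quadratic,
   so that the Gaertner-Ellis argument applies. Finally
   rho_hat - rho_star = - (theta_hat - theta_star) up to exponentially negligible terms, and the
   rate function is even. *)
theory Submission
  imports Defs "HOL-Real_Asymp.Real_Asymp"
begin

section \<open>Exponential martingales of an i.i.d. sequence\<close>

text \<open>The obstacle is that S_n is random. That S_n / (n kappa_n) is close to s off negligible
  events says nothing about E exp (t M_n), which rare paths of huge energy could dominate.
  Integrability of exp (t0 V^2) gives phi x <= exp (C x^2) for every real x. On the stopped path,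
  whose energy is bounded for every outcome, this bounds E exp (2 t M_n) by exp (C' lam_n^2), and
  that second moment pays for the exceptional event. The same inequality, as a supermartingale,
  yields all the Chernoff bounds. Replacing ln phi h by sigma^2 h^2 / 2 needs small weights h, hence
  a bound on X at all times up to n simultaneously; the growth of n against lam_n and kappa_n is
  spent there and in the union bound. Constants: kappa_n (1 + theta_n rho_n) tends to g = - (gamma1
  + gamma2), so theta_hat - theta_star behaves like kappa_n M_n / (g S_n), which gives the variance
  sigma^2 / (g^2 s). The sign change for rho_hat comes from a factor (T^2 + p) / (1 - T^2), where T
  is theta_hat and p = theta_n rho_n: since p tends to -1, this factor tends to -1.\<close>

locale iid_seq = prob_space M for M :: "'a measure" +
  fixes V :: "nat \<Rightarrow> 'a \<Rightarrow> real"
  assumes indep: "indep_vars (\<lambda>_. borel) V {1..}"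
    and ident: "\<And>k. k \<ge> 1 \<Longrightarrow> distr M borel (V k) = distr M borel (V 1)"
begin

definition hist :: "nat \<Rightarrow> 'a \<Rightarrow> nat \<Rightarrow> real" where
  "hist m \<omega> = restrict (\<lambda>i. V i \<omega>) {1..m}"

text \<open>This is the sigma-algebra generated by \<open>V 1\<close>, ..., \<open>V m\<close>.
  Pulling the product sigma-algebra back along a single map lets independence of disjoint coordinate
  blocks be applied directly.\<close>

definition Fil :: "nat \<Rightarrow> 'a measure" where
  "Fil m = vimage_algebra (space M) (hist m) (PiM {1..m} (\<lambda>_. borel))"

lemma V_Suc_measurable [measurable]: "V (Suc k) \<in> borel_measurable M"
  using indep unfolding indep_vars_def by auto

lemma V_Suc_measurable': "k \<ge> 1 \<Longrightarrow> V k \<in> borel_measurable M"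
  using V_Suc_measurable[of "k - 1"] by simp

lemma hist_measurable: "hist m \<in> measurable M (PiM {1..m} (\<lambda>_. borel))"
  unfolding hist_def by (intro measurable_restrict V_Suc_measurable') auto

lemma space_Fil [simp]: "space (Fil m) = space M"
  by (simp add: Fil_def)

lemma hist_space: "hist m \<in> space M \<rightarrow> space (PiM {1..m} (\<lambda>_. borel :: real measure))"
  using hist_measurable by (auto dest: measurable_space)

lemma sets_Fil: "sets (Fil m) = {hist m -` A \<inter> space M | A. A \<in> sets (PiM {1..m} (\<lambda>_. borel))}"
  unfolding Fil_def using hist_space by (rule sets_vimage_algebra2)

text \<open>Expresses that \<open>Fil m\<close> is a sub-sigma-algebra in a form that composes; the
  image measure of this identity map is the restriction of \<open>M\<close> to
  \<open>Fil m\<close>.\<close>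

lemma id_Fil: "(\<lambda>\<omega>. \<omega>) \<in> measurable M (Fil m)"
  by (rule measurableI) (use hist_measurable in \<open>auto simp: sets_Fil intro: measurable_sets\<close>)

lemma Fil_measurable: "f \<in> measurable (Fil m) N \<Longrightarrow> f \<in> measurable M N"
  using measurable_compose[OF id_Fil] by blast

lemma Fil_mono: assumes "f \<in> measurable (Fil m) N" "m \<le> m'" shows "f \<in> measurable (Fil m') N"
proof -
  have h: "hist m' \<in> measurable (Fil m') (PiM {1..m'} (\<lambda>_. borel))"
    unfolding Fil_def by (rule measurable_vimage_algebra1[OF hist_space])
  have "(\<lambda>\<omega>. restrict (hist m' \<omega>) {1..m}) \<in> measurable (Fil m') (PiM {1..m} (\<lambda>_. borel))"
    by (rule measurable_compose[OF h], rule measurable_restrict_subset) (use assms in auto)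
  also have "(\<lambda>\<omega>. restrict (hist m' \<omega>) {1..m}) = hist m"
    using assms by (auto simp: hist_def fun_eq_iff restrict_def)
  finally have "(\<lambda>\<omega>. \<omega>) \<in> measurable (Fil m') (Fil m)"
    unfolding Fil_def[of m] by (intro measurable_vimage_algebra2) auto
  from measurable_compose[OF this assms(1)] show ?thesis by simp
qed

lemma V_Fil: assumes "1 \<le> k" "k \<le> m" shows "V k \<in> borel_measurable (Fil m)"
proof -
  have h: "hist m \<in> measurable (Fil m) (PiM {1..m} (\<lambda>_. borel))"
    unfolding Fil_def by (rule measurable_vimage_algebra1[OF hist_space])
  have "(\<lambda>\<omega>. hist m \<omega> k) \<in> borel_measurable (Fil m)"
    by (rule measurable_compose[OF h], rule measurable_component_singleton) (use assms in auto)
  then show ?thesis using assms by (simp add: hist_def)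
qed

text \<open>The index blocks {1..m} and {Suc m} are disjoint, so the two tuples are independent, and
  an event of \<open>Fil m\<close> is a preimage under the first tuple.\<close>

lemma indep_step:
  assumes "A \<in> sets (Fil m)" "B \<in> sets borel"
  shows "prob (A \<inter> (V (Suc m) -` B \<inter> space M)) = prob A * prob (V (Suc m) -` B \<inter> space M)"
proof -
  let ?h' = "\<lambda>\<omega>. restrict (\<lambda>i. V i \<omega>) {Suc m}"
  obtain A' where A': "A' \<in> sets (PiM {1..m} (\<lambda>_. borel))" "A = hist m -` A' \<inter> space M"
    using assms(1) by (auto simp: sets_Fil)
  let ?B' = "(\<lambda>x. x (Suc m)) -` B \<inter> space (PiM {Suc m} (\<lambda>_. borel :: real measure))"
  have B': "?B' \<in> sets (PiM {Suc m} (\<lambda>_. borel :: real measure))"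
    by (rule measurable_sets[OF _ assms(2)], rule measurable_component_singleton) simp
  have "indep_var (PiM {1..m} (\<lambda>_. borel)) (hist m) (PiM {Suc m} (\<lambda>_. borel)) ?h'"
    unfolding hist_def by (rule indep_var_restrict[OF indep]) auto
  from indep_varD[OF this A'(1) B']
  have "prob ((\<lambda>x. (hist m x, ?h' x)) -` (A' \<times> ?B') \<inter> space M)
     = prob (hist m -` A' \<inter> space M) * prob (?h' -` ?B' \<inter> space M)" .
  also have "(\<lambda>x. (hist m x, ?h' x)) -` (A' \<times> ?B') \<inter> space M = A \<inter> (V (Suc m) -` B \<inter> space M)"
    by (auto simp: A' space_PiM)
  also have "?h' -` ?B' \<inter> space M = V (Suc m) -` B \<inter> space M"
    by (auto simp: space_PiM)
  finally show ?thesis by (simp add: A')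
qed

text \<open>Takes the place of conditioning on \<open>Fil m\<close>: the past and the fresh variable
  have a product law, Tonelli integrates the fresh variable out, and equality of laws turns it into
  \<open>V 1\<close>.\<close>

lemma nn_step:
  assumes [measurable]: "g \<in> borel_measurable (Fil m \<Otimes>\<^sub>M borel)"
  shows "(\<integral>\<^sup>+\<omega>. g (\<omega>, V (Suc m) \<omega>) \<partial>M) = (\<integral>\<^sup>+\<omega>. (\<integral>\<^sup>+\<omega>'. g (\<omega>, V 1 \<omega>') \<partial>M) \<partial>M)"
proof -
  note [measurable] = id_Fil
  have V1 [measurable]: "V 1 \<in> borel_measurable M" by (rule V_Suc_measurable') simp
  let ?D = "distr M borel (V 1)"
  interpret D: prob_space ?D by (rule prob_space_distr) simp
  have Dm: "distr M borel (V (Suc m)) = ?D" by (rule ident) simp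
  interpret F: prob_space "distr M (Fil m) (\<lambda>\<omega>. \<omega>)" by (rule prob_space_distr) simp
  \<comment> \<open>Sigma-finite measures that agree on rectangles coincide with the product
    measure; the agreement is \<open>indep_step\<close>.\<close>
  have e: "distr M (Fil m) (\<lambda>\<omega>. \<omega>) \<Otimes>\<^sub>M ?D = distr M (Fil m \<Otimes>\<^sub>M borel) (\<lambda>\<omega>. (\<omega>, V (Suc m) \<omega>))"
  proof (rule pair_measure_eqI)
    fix A B assume AB: "A \<in> sets (distr M (Fil m) (\<lambda>\<omega>. \<omega>))" "B \<in> sets ?D"
    then have A: "A \<in> sets (Fil m)" and B: "B \<in> sets borel" by auto
    have AM: "A \<subseteq> space M" using sets.sets_into_space[OF A] by simp
    have *: "(\<lambda>\<omega>. (\<omega>, V (Suc m) \<omega>)) -` (A \<times> B) \<inter> space M = A \<inter> (V (Suc m) -` B \<inter> space M)"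
      by auto
    have **: "(\<lambda>\<omega>. \<omega>) -` A \<inter> space M = A" using AM by auto
    show "emeasure (distr M (Fil m) (\<lambda>\<omega>. \<omega>)) A * emeasure ?D B
        = emeasure (distr M (Fil m \<Otimes>\<^sub>M borel) (\<lambda>\<omega>. (\<omega>, V (Suc m) \<omega>))) (A \<times> B)"
      unfolding Dm[symmetric] using A B AM indep_step[OF A B]
      by (simp add: Int_absorb2 emeasure_distr * ** emeasure_eq_measure ennreal_mult)
  qed (rule F.sigma_finite_measure_axioms D.sigma_finite_measure_axioms | simp cong: sets_pair_measure_cong)+
  have "(\<integral>\<^sup>+\<omega>. g (\<omega>, V (Suc m) \<omega>) \<partial>M)
      = (\<integral>\<^sup>+z. g z \<partial>distr M (Fil m \<Otimes>\<^sub>M borel) (\<lambda>\<omega>. (\<omega>, V (Suc m) \<omega>)))"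
    by (subst nn_integral_distr) auto
  also have "\<dots> = (\<integral>\<^sup>+x. (\<integral>\<^sup>+y. g (x, y) \<partial>?D) \<partial>distr M (Fil m) (\<lambda>\<omega>. \<omega>))"
    unfolding e[symmetric] by (rule D.nn_integral_fst[symmetric]) simp
  also have "\<dots> = (\<integral>\<^sup>+\<omega>. (\<integral>\<^sup>+y. g (\<omega>, y) \<partial>?D) \<partial>M)"
  proof (rule nn_integral_distr[OF id_Fil])
    have "g \<in> borel_measurable (Fil m \<Otimes>\<^sub>M ?D)"
      by (simp cong: measurable_cong_sets sets_pair_measure_cong)
    from D.borel_measurable_nn_integral_fst[OF this]
    show "(\<lambda>\<omega>. \<integral>\<^sup>+y. g (\<omega>, y) \<partial>?D) \<in> borel_measurable (distr M (Fil m) (\<lambda>\<omega>. \<omega>))" by simp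
  qed
  also have "\<dots> = (\<integral>\<^sup>+\<omega>. (\<integral>\<^sup>+\<omega>'. g (\<omega>, V 1 \<omega>') \<partial>M) \<partial>M)"
    by (intro nn_integral_cong nn_integral_distr) auto
  finally show ?thesis .
qed

text \<open>The earlier summands and the weight \<open>H n\<close> are known at time n, so only
  \<open>V (Suc n)\<close> gets integrated. The martingale and the supermartingale differ only in
  what is assumed of the remaining factor.\<close>

lemma exp_sum_step:
  fixes f :: "real \<Rightarrow> real \<Rightarrow> real" and \<psi> :: "real \<Rightarrow> real"
  assumes H: "\<And>k. H k \<in> borel_measurable (Fil k)"
    and [measurable]: "case_prod f \<in> borel_measurable (borel \<Otimes>\<^sub>M borel)" "\<psi> \<in> borel_measurable borel"
  defines "S \<equiv> \<lambda>n \<omega>. (\<Sum>k<n. f (H k \<omega>) (V (Suc k) \<omega>) - \<psi> (H k \<omega>))"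
  shows "(\<integral>\<^sup>+\<omega>. ennreal (exp (S (Suc n) \<omega>)) \<partial>M)
       = (\<integral>\<^sup>+\<omega>. ennreal (exp (S n \<omega>)) * (ennreal (exp (- \<psi> (H n \<omega>))) *
             (\<integral>\<^sup>+\<omega>'. ennreal (exp (f (H n \<omega>) (V 1 \<omega>'))) \<partial>M)) \<partial>M)"
proof -
  have [measurable]: "V (Suc k) \<in> borel_measurable (Fil n)" if "k < n" for k
    using that by (intro V_Fil) auto
  have [measurable]: "H k \<in> borel_measurable (Fil n)" if "k \<le> n" for k
    using that H Fil_mono by blast
  have fm' [measurable]: "(\<lambda>x. f (g x) (h x)) \<in> borel_measurable N"
    if "g \<in> borel_measurable N" "h \<in> borel_measurable N" for g h and N :: "('a \<times> real) measure"
    using measurable_compose[OF measurable_Pair[OF that] assms(2)] by simp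
  have fm'' [measurable]: "(\<lambda>x. f (g x) (h x)) \<in> borel_measurable N"
    if "g \<in> borel_measurable N" "h \<in> borel_measurable N" for g h and N :: "'a measure"
    using measurable_compose[OF measurable_Pair[OF that] assms(2)] by simp
  have [measurable]: "S n \<in> borel_measurable (Fil n)"
    unfolding S_def
  proof (rule borel_measurable_sum)
    fix k assume "k \<in> {..<n}"
    then show "(\<lambda>\<omega>. f (H k \<omega>) (V (Suc k) \<omega>) - \<psi> (H k \<omega>)) \<in> borel_measurable (Fil n)"
      by (auto intro!: borel_measurable_diff fm'' measurable_compose[OF _ assms(3)])
  qed
  have V1 [measurable]: "V 1 \<in> borel_measurable M" by (rule V_Suc_measurable') simp
  define g where "g = (\<lambda>(\<omega>, v). ennreal (exp (S n \<omega>)) * (ennreal (exp (- \<psi> (H n \<omega>))) * ennreal (exp (f (H n \<omega>) v))))"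
  have "g \<in> borel_measurable (Fil n \<Otimes>\<^sub>M borel)"
    unfolding g_def by measurable
  from nn_step[OF this] have "(\<integral>\<^sup>+\<omega>. g (\<omega>, V (Suc n) \<omega>) \<partial>M) = (\<integral>\<^sup>+\<omega>. (\<integral>\<^sup>+\<omega>'. g (\<omega>, V 1 \<omega>') \<partial>M) \<partial>M)" .
  also have "(\<lambda>\<omega>. g (\<omega>, V (Suc n) \<omega>)) = (\<lambda>\<omega>. ennreal (exp (S (Suc n) \<omega>)))"
    by (auto simp: g_def S_def fun_eq_iff ennreal_mult[symmetric] exp_add[symmetric] algebra_simps)
  also have "(\<lambda>\<omega>. \<integral>\<^sup>+\<omega>'. g (\<omega>, V 1 \<omega>') \<partial>M) = (\<lambda>\<omega>. ennreal (exp (S n \<omega>)) * (ennreal (exp (- \<psi> (H n \<omega>))) *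
             (\<integral>\<^sup>+\<omega>'. ennreal (exp (f (H n \<omega>) (V 1 \<omega>'))) \<partial>M)))"
    unfolding g_def by (simp add: nn_integral_cmult)
  finally show ?thesis .
qed

text \<open>Each one-step factor is at most 1, so the expectations do not increase with n.
  Nonnegative integrals are used throughout, so no integrability has to be carried through the
  induction.\<close>

lemma exp_supermartingale:
  fixes f :: "real \<Rightarrow> real \<Rightarrow> real" and \<psi> :: "real \<Rightarrow> real"
  assumes H: "\<And>k. H k \<in> borel_measurable (Fil k)"
    and m: "case_prod f \<in> borel_measurable (borel \<Otimes>\<^sub>M borel)" "\<psi> \<in> borel_measurable borel"
    and le: "\<And>h. (\<integral>\<^sup>+\<omega>. ennreal (exp (f h (V 1 \<omega>))) \<partial>M) \<le> ennreal (exp (\<psi> h))"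
  shows "(\<integral>\<^sup>+\<omega>. ennreal (exp (\<Sum>k<n. f (H k \<omega>) (V (Suc k) \<omega>) - \<psi> (H k \<omega>))) \<partial>M) \<le> 1"
proof (induction n)
  case 0
  then show ?case by (simp add: emeasure_space_1)
next
  case (Suc n)
  have "ennreal (exp (- \<psi> h)) * (\<integral>\<^sup>+\<omega>'. ennreal (exp (f h (V 1 \<omega>'))) \<partial>M) \<le> 1" for h
  proof -
    have "ennreal (exp (- \<psi> h)) * (\<integral>\<^sup>+\<omega>'. ennreal (exp (f h (V 1 \<omega>'))) \<partial>M) \<le> ennreal (exp (- \<psi> h)) * ennreal (exp (\<psi> h))"
      by (intro mult_left_mono le) auto
    then show ?thesis by (simp add: ennreal_mult[symmetric] exp_add[symmetric])
  qed
  then have "(\<integral>\<^sup>+\<omega>. ennreal (exp (\<Sum>k<Suc n. f (H k \<omega>) (V (Suc k) \<omega>) - \<psi> (H k \<omega>))) \<partial>M)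
     \<le> (\<integral>\<^sup>+\<omega>. ennreal (exp (\<Sum>k<n. f (H k \<omega>) (V (Suc k) \<omega>) - \<psi> (H k \<omega>))) * 1 \<partial>M)"
    unfolding exp_sum_step[OF H m] by (intro nn_integral_mono mult_left_mono) auto
  with Suc.IH show ?case by simp
qed

lemma exp_martingale:
  fixes f :: "real \<Rightarrow> real \<Rightarrow> real" and \<psi> :: "real \<Rightarrow> real"
  assumes H: "\<And>k. H k \<in> borel_measurable (Fil k)"
    and m: "case_prod f \<in> borel_measurable (borel \<Otimes>\<^sub>M borel)" "\<psi> \<in> borel_measurable borel"
    and eq: "\<And>h. (\<integral>\<^sup>+\<omega>. ennreal (exp (f h (V 1 \<omega>))) \<partial>M) = ennreal (exp (\<psi> h))"
  shows "(\<integral>\<^sup>+\<omega>. ennreal (exp (\<Sum>k<n. f (H k \<omega>) (V (Suc k) \<omega>) - \<psi> (H k \<omega>))) \<partial>M) = 1"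
proof (induction n)
  case 0
  then show ?case by (simp add: emeasure_space_1)
next
  case (Suc n)
  then show ?case
    unfolding exp_sum_step[OF H m] eq
    by (simp add: ennreal_mult[symmetric] exp_add[symmetric])
qed

end

context prob_space begin

lemma exp_markov:
  assumes [measurable]: "f \<in> borel_measurable M" and "(\<integral>\<^sup>+\<omega>. ennreal (exp (f \<omega>)) \<partial>M) \<le> ennreal c" "0 \<le> c"
  shows "prob {\<omega> \<in> space M. f \<omega> \<ge> b} \<le> c * exp (- b)"
proof -
  have "emeasure M {\<omega> \<in> space M. f \<omega> \<ge> b} = (\<integral>\<^sup>+\<omega>. indicator {\<omega> \<in> space M. f \<omega> \<ge> b} \<omega> \<partial>M)"
    by (subst nn_integral_indicator) auto
  also have "\<dots> \<le> (\<integral>\<^sup>+\<omega>. ennreal (exp (f \<omega>)) * ennreal (exp (- b)) \<partial>M)"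
    by (intro nn_integral_mono) (auto split: split_indicator simp: ennreal_mult[symmetric] exp_add[symmetric])
  also have "\<dots> \<le> ennreal c * ennreal (exp (- b))"
    using assms by (simp add: nn_integral_multc mult_right_mono)
  finally show ?thesis
    using assms by (simp add: emeasure_eq_measure ennreal_mult[symmetric])
qed

end

section \<open>Superexponentially small events and Gaussian large deviations\<close>

locale speed = prob_space M for M :: "'a measure" +
  fixes lam :: "nat \<Rightarrow> real"
  assumes lam_pos: "\<And>n. lam n > 0" and lam_top: "filterlim lam at_top sequentially"
begin

text \<open>A measurable cover carries the bound, so that P itself may be an arbitrary predicate;
  limits along the filter then come without measurability side conditions.\<close>

definition small :: "real \<Rightarrow> (nat \<times> 'a \<Rightarrow> bool) \<Rightarrow> bool" where
  "small K P \<longleftrightarrow> (\<forall>\<^sub>F n in sequentially. \<exists>F\<in>sets M. {\<omega>\<in>space M. P (n, \<omega>)} \<subseteq> F \<and> prob F \<le> exp (- K * (lam n)\<^sup>2))"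

text \<open>Convergence along \<open>LF K\<close> means convergence up to events of probability at most
  about \<open>exp (- K * lam\<^sup>2)\<close>, so the usual calculus of limits applies; convergence for
  every \<open>K\<close> is exponential negligibility, and \<open>Bfun\<close> along each \<open>LF K\<close> is exponential tightness.\<close>

definition LF :: "real \<Rightarrow> (nat \<times> 'a) filter" where
  "LF K = Abs_filter (\<lambda>P. \<forall>K'<K. small K' (\<lambda>z. \<not> P z))"

lemma lam2_top: "filterlim (\<lambda>n. (lam n)\<^sup>2) at_top sequentially"
  by (rule filterlim_pow_at_top) (use lam_top in auto)

lemma lam2_ge: "\<forall>\<^sub>F n in sequentially. (lam n)\<^sup>2 \<ge> c"
  using lam2_top by (auto simp: filterlim_at_top)

text \<open>A strict loss in the rate pays for any constant factor, because \<open>lam\<close> tends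
  to infinity.\<close>

lemma const_absorb:
  assumes "K' < K" "C \<ge> 0" shows "\<forall>\<^sub>F n in sequentially. C * exp (- K * (lam n)\<^sup>2) \<le> exp (- K' * (lam n)\<^sup>2)"
  using lam2_ge[of "ln (C + 1) / (K - K')"]
proof eventually_elim
  case (elim n)
  then have "ln (C + 1) \<le> (K - K') * (lam n)\<^sup>2"
    using assms by (simp add: field_simps)
  then have "C + 1 \<le> exp ((K - K') * (lam n)\<^sup>2)"
    using assms by (subst (asm) exp_le_cancel_iff[symmetric]) simp
  then have "C * exp (- K * (lam n)\<^sup>2) \<le> exp ((K - K') * (lam n)\<^sup>2) * exp (- K * (lam n)\<^sup>2)"
    by (intro mult_right_mono) auto
  then show ?case by (simp add: exp_add[symmetric] algebra_simps)
qed

lemma small_mono: "small K P \<Longrightarrow> (\<And>z. Q z \<Longrightarrow> P z) \<Longrightarrow> small K Q"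
  unfolding small_def by (erule eventually_mono) blast

text \<open>The strict inequality K' < K is what makes this a filter: a union of two bad events
  doubles the probability, and the factor 2 is absorbed by passing through the midpoint of K' and
  K.\<close>

lemma eventually_LF: "eventually P (LF K) \<longleftrightarrow> (\<forall>K'<K. small K' (\<lambda>z. \<not> P z))"
  unfolding LF_def
proof (rule eventually_Abs_filter, rule is_filter.intro)
  show "\<forall>K'<K. small K' (\<lambda>z. \<not> True)"
    by (auto simp: small_def intro!: always_eventually bexI[of _ "{}"])
next
  fix P Q assume P: "\<forall>K'<K. small K' (\<lambda>z. \<not> P z)" and Q: "\<forall>K'<K. small K' (\<lambda>z. \<not> Q z)"
  show "\<forall>K'<K. small K' (\<lambda>z. \<not> (P z \<and> Q z))"
  proof (intro allI impI)
    fix K' assume "K' < K"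
    define L where "L = (K' + K) / 2"
    have L: "K' < L" "L < K" using \<open>K' < K\<close> by (auto simp: L_def)
    have "small L (\<lambda>z. \<not> P z)" "small L (\<lambda>z. \<not> Q z)" using P Q L by auto
    then show "small K' (\<lambda>z. \<not> (P z \<and> Q z))"
      using const_absorb[OF L(1), of 2, simplified] unfolding small_def
    proof eventually_elim
      case (elim n)
      then obtain F G where F: "F \<in> sets M" "{\<omega>\<in>space M. \<not> P (n, \<omega>)} \<subseteq> F" "prob F \<le> exp (- L * (lam n)\<^sup>2)"
        and G: "G \<in> sets M" "{\<omega>\<in>space M. \<not> Q (n, \<omega>)} \<subseteq> G" "prob G \<le> exp (- L * (lam n)\<^sup>2)" by blast
      have "prob (F \<union> G) \<le> prob F + prob G" by (rule measure_Un_le) fact+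
      with F G elim(3) have "prob (F \<union> G) \<le> exp (- K' * (lam n)\<^sup>2)" by simp
      with F G show ?case by (intro bexI[of _ "F \<union> G"]) auto
    qed
  qed
next
  fix P Q assume "\<forall>z. P z \<longrightarrow> Q z" "\<forall>K'<K. small K' (\<lambda>z. \<not> P z)"
  then show "\<forall>K'<K. small K' (\<lambda>z. \<not> Q z)" by (auto elim!: small_mono)
qed

lemma eventually_LF_fst:
  assumes "\<forall>\<^sub>F n in sequentially. P n" shows "\<forall>\<^sub>F z in LF K. P (fst z)"
  unfolding eventually_LF small_def using assms
  by (auto elim!: eventually_mono intro!: bexI[of _ "{}"])

lemma filterlim_fst_LF: "filterlim fst sequentially (LF K)"
  unfolding filterlim_iff using eventually_LF_fst by blast

lemma tendsto_LF_fst: "(x \<longlongrightarrow> c) sequentially \<Longrightarrow> ((\<lambda>z. x (fst z)) \<longlongrightarrow> c) (LF K)"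
  by (rule filterlim_compose[OF _ filterlim_fst_LF])

lemma eventually_LFI:
  assumes "\<forall>\<^sub>F n in sequentially. \<exists>F\<in>sets M. {\<omega>\<in>space M. \<not> P (n, \<omega>)} \<subseteq> F \<and> prob F \<le> C * exp (- K * (lam n)\<^sup>2)"
    and "C \<ge> 0"
  shows "eventually P (LF K)"
  unfolding eventually_LF small_def
proof (intro allI impI)
  fix K' assume "K' < K"
  from assms(1) const_absorb[OF this assms(2)]
  show "\<forall>\<^sub>F n in sequentially. \<exists>F\<in>sets M. {\<omega>\<in>space M. \<not> P (n, \<omega>)} \<subseteq> F \<and> prob F \<le> exp (- K' * (lam n)\<^sup>2)"
    by eventually_elim (meson order_trans)
qed

lemma eventually_LFD:
  assumes "eventually P (LF K)" "K' < K"
    and "\<And>n \<omega>. \<omega> \<in> E n \<Longrightarrow> \<omega> \<in> space M \<and> \<not> P (n, \<omega>)"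
  shows "\<forall>\<^sub>F n in sequentially. prob (E n) \<le> exp (- K' * (lam n)\<^sup>2)"
proof -
  have "small K' (\<lambda>z. \<not> P z)" using assms unfolding eventually_LF by blast
  then show ?thesis unfolding small_def
  proof eventually_elim
    case (elim n)
    then obtain F where F: "F \<in> sets M" "{\<omega>\<in>space M. \<not> P (n, \<omega>)} \<subseteq> F" "prob F \<le> exp (- K' * (lam n)\<^sup>2)" by blast
    have "prob (E n) \<le> prob F" using F assms(3)[of _ n] by (intro finite_measure_mono) auto
    with F show ?case by simp
  qed
qed

section \<open>Chernoff bounds and exponential tilting for a quadratic limit of the log-mgf\<close>

lemma tilted_tail:
  fixes W :: "'a \<Rightarrow> real"
  assumes [measurable]: "W \<in> borel_measurable M"
    and int: "integrable M (\<lambda>\<omega>. exp (u * l * W \<omega>))" "integrable M (\<lambda>\<omega>. exp ((u + h) * l * W \<omega>))" and l: "l \<ge> 0"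
  shows "expectation (\<lambda>\<omega>. exp (u * l * W \<omega>) * indicator {\<omega>. h * W \<omega> \<ge> b} \<omega>)
        \<le> exp (- l * b) * expectation (\<lambda>\<omega>. exp ((u + h) * l * W \<omega>))"
proof -
  \<comment> \<open>On the event the factor exp (l * (h * W - b)) is at least 1. The weight exp (u *
    l * W) is an unnormalised tilted density, so this bounds escape probabilities under the tilted
    law and, for u = 0, ordinary tails.\<close>
  have "expectation (\<lambda>\<omega>. exp (u * l * W \<omega>) * indicator {\<omega>. h * W \<omega> \<ge> b} \<omega>)
      \<le> expectation (\<lambda>\<omega>. exp (- l * b) * exp ((u + h) * l * W \<omega>))"
  proof (rule integral_mono)
    have "integrable M (\<lambda>\<omega>. exp (u * l * W \<omega>) * indicator {\<omega>\<in>space M. h * W \<omega> \<ge> b} \<omega>)"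
      using int(1) by (intro integrable_real_mult_indicator) auto
    then show "integrable M (\<lambda>\<omega>. exp (u * l * W \<omega>) * indicator {\<omega>. h * W \<omega> \<ge> b} \<omega>)"
      by (rule Bochner_Integration.integrable_cong[THEN iffD1, rotated 2]) (auto split: split_indicator)
    fix \<omega>
    show "exp (u * l * W \<omega>) * indicator {\<omega>. h * W \<omega> \<ge> b} \<omega> \<le> exp (- l * b) * exp ((u + h) * l * W \<omega>)"
    proof (cases "h * W \<omega> \<ge> b")
      case True
      then have "l * b \<le> l * (h * W \<omega>)" using l by (intro mult_left_mono) auto
      then show ?thesis using True by (simp add: exp_add[symmetric] algebra_simps)
    qed simp
  qed (use int in auto)
  then show ?thesis by simp
qed

lemma tail_bound:
  fixes W :: "'a \<Rightarrow> real"
  assumes [measurable]: "W \<in> borel_measurable M"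
    and int: "integrable M (\<lambda>\<omega>. exp (h * l * W \<omega>))" and l: "l \<ge> 0"
  shows "prob {\<omega>\<in>space M. h * W \<omega> \<ge> b} \<le> exp (- l * b) * expectation (\<lambda>\<omega>. exp (h * l * W \<omega>))"
proof -
  have "prob {\<omega>\<in>space M. h * W \<omega> \<ge> b} = expectation (indicator {\<omega>\<in>space M. h * W \<omega> \<ge> b})"
    by simp
  also have "\<dots> = expectation (\<lambda>\<omega>. exp (0 * l * W \<omega>) * indicator {\<omega>. h * W \<omega> \<ge> b} \<omega>)"
    by (intro Bochner_Integration.integral_cong) (auto split: split_indicator)
  also have "\<dots> \<le> exp (- l * b) * expectation (\<lambda>\<omega>. exp ((0 + h) * l * W \<omega>))"
    by (rule tilted_tail) (use int l in auto)
  finally show ?thesis by simp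
qed

lemma mgf_bounds:
  assumes int: "\<And>u. \<forall>\<^sub>F n in sequentially. integrable M (\<lambda>\<omega>. exp (u * (lam n)\<^sup>2 * W n \<omega>))"
    and L: "\<And>u. (\<lambda>n. ln (expectation (\<lambda>\<omega>. exp (u * (lam n)\<^sup>2 * W n \<omega>))) / (lam n)\<^sup>2) \<longlonglongrightarrow> v * u\<^sup>2 / 2"
    and "\<epsilon> > 0"
  shows "\<forall>\<^sub>F n in sequentially. integrable M (\<lambda>\<omega>. exp (u * (lam n)\<^sup>2 * W n \<omega>)) \<and>
     exp ((lam n)\<^sup>2 * (v * u\<^sup>2 / 2 - \<epsilon>)) \<le> expectation (\<lambda>\<omega>. exp (u * (lam n)\<^sup>2 * W n \<omega>)) \<and>
     expectation (\<lambda>\<omega>. exp (u * (lam n)\<^sup>2 * W n \<omega>)) \<le> exp ((lam n)\<^sup>2 * (v * u\<^sup>2 / 2 + \<epsilon>))"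
  using int[of u] tendstoD[OF L[of u] \<open>\<epsilon> > 0\<close>]
proof eventually_elim
  case (elim n)
  let ?E = "expectation (\<lambda>\<omega>. exp (u * (lam n)\<^sup>2 * W n \<omega>))"
  have p: "(lam n)\<^sup>2 > 0" using lam_pos[of n] by simp
  have "?E > 0"
    using integral_less_AE_space[of "\<lambda>_. 0" "\<lambda>\<omega>. exp (u * (lam n)\<^sup>2 * W n \<omega>)"] elim(1) emeasure_space_1 by auto
  moreover have "\<bar>ln ?E / (lam n)\<^sup>2 - v * u\<^sup>2 / 2\<bar> < \<epsilon>" using elim(2) by (simp add: dist_real_def)
  then have "ln ?E / (lam n)\<^sup>2 < v * u\<^sup>2 / 2 + \<epsilon>" "ln ?E / (lam n)\<^sup>2 > v * u\<^sup>2 / 2 - \<epsilon>" by linarith+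
  then have "ln ?E < (lam n)\<^sup>2 * (v * u\<^sup>2 / 2 + \<epsilon>)" "(lam n)\<^sup>2 * (v * u\<^sup>2 / 2 - \<epsilon>) < ln ?E"
    using p by (simp_all add: field_simps)
  then have "exp (ln ?E) \<le> exp ((lam n)\<^sup>2 * (v * u\<^sup>2 / 2 + \<epsilon>))" "exp ((lam n)\<^sup>2 * (v * u\<^sup>2 / 2 - \<epsilon>)) \<le> exp (ln ?E)"
    by (simp_all only: exp_le_cancel_iff less_imp_le)
  ultimately show ?case using elim(1) by simp
qed

text \<open>Chernoff's bound on each side with the tilt h = y / v, which maximises h * y - v * h^2 /
  2 and gives the value y^2 / (2 * v).\<close>

lemma gaertner_ellis_upper:
  assumes Wm [measurable]: "\<And>n. W n \<in> borel_measurable M"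
    and int: "\<And>u. \<forall>\<^sub>F n in sequentially. integrable M (\<lambda>\<omega>. exp (u * (lam n)\<^sup>2 * W n \<omega>))"
    and L: "\<And>u. (\<lambda>n. ln (expectation (\<lambda>\<omega>. exp (u * (lam n)\<^sup>2 * W n \<omega>))) / (lam n)\<^sup>2) \<longlonglongrightarrow> v * u\<^sup>2 / 2"
    and v: "v > 0" and "\<epsilon> > 0" and y: "y \<ge> 0"
  shows "\<forall>\<^sub>F n in sequentially. prob {\<omega>\<in>space M. \<bar>W n \<omega>\<bar> \<ge> y} \<le> 2 * exp (- (y\<^sup>2 / (2 * v) - \<epsilon>) * (lam n)\<^sup>2)"
  using mgf_bounds[OF int L \<open>\<epsilon> > 0\<close>, of "y / v"] mgf_bounds[OF int L \<open>\<epsilon> > 0\<close>, of "- (y / v)"]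
proof eventually_elim
  case (elim n)
  let ?l = "(lam n)\<^sup>2"
  have e: "exp (- ?l * (y\<^sup>2 / v)) * exp (?l * (v * (y / v)\<^sup>2 / 2 + \<epsilon>)) = exp (- (y\<^sup>2 / (2 * v) - \<epsilon>) * ?l)"
    using v by (simp add: exp_add[symmetric] field_simps power2_eq_square)
  have 1: "prob {\<omega>\<in>space M. h * W n \<omega> \<ge> y\<^sup>2 / v} \<le> exp (- (y\<^sup>2 / (2 * v) - \<epsilon>) * ?l)"
    if "h = y / v \<or> h = - (y / v)" for h
  proof -
    have "prob {\<omega>\<in>space M. h * W n \<omega> \<ge> y\<^sup>2 / v} \<le> exp (- ?l * (y\<^sup>2 / v)) * expectation (\<lambda>\<omega>. exp (h * ?l * W n \<omega>))"
      using that elim by (intro tail_bound) auto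
    also have "\<dots> \<le> exp (- ?l * (y\<^sup>2 / v)) * exp (?l * (v * (y / v)\<^sup>2 / 2 + \<epsilon>))"
      using that elim by (intro mult_left_mono) auto
    finally show ?thesis by (simp only: e)
  qed
  have "prob {\<omega>\<in>space M. \<bar>W n \<omega>\<bar> \<ge> y} \<le> prob ({\<omega>\<in>space M. (y / v) * W n \<omega> \<ge> y\<^sup>2 / v} \<union> {\<omega>\<in>space M. - (y / v) * W n \<omega> \<ge> y\<^sup>2 / v})"
  proof (intro finite_measure_mono subsetI)
    fix \<omega> assume "\<omega> \<in> {\<omega>\<in>space M. \<bar>W n \<omega>\<bar> \<ge> y}"
    then have "\<omega> \<in> space M" and "y \<le> W n \<omega> \<or> y \<le> - W n \<omega>" by auto
    then have "y * y \<le> y * W n \<omega> \<or> y * y \<le> y * - W n \<omega>" using y mult_left_mono by blast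
    then show "\<omega> \<in> {\<omega>\<in>space M. (y / v) * W n \<omega> \<ge> y\<^sup>2 / v} \<union> {\<omega>\<in>space M. - (y / v) * W n \<omega> \<ge> y\<^sup>2 / v}"
      using v \<open>\<omega> \<in> space M\<close> by (auto simp: field_simps power2_eq_square)
  qed auto
  also have "\<dots> \<le> prob {\<omega>\<in>space M. (y / v) * W n \<omega> \<ge> y\<^sup>2 / v} + prob {\<omega>\<in>space M. - (y / v) * W n \<omega> \<ge> y\<^sup>2 / v}"
    by (rule measure_Un_le) auto
  also have "\<dots> \<le> exp (- (y\<^sup>2 / (2 * v) - \<epsilon>) * ?l) + exp (- (y\<^sup>2 / (2 * v) - \<epsilon>) * ?l)"
    by (intro add_mono 1) auto
  finally show ?case by simp
qed

text \<open>Cramer's change of measure: weighted with exp (u * l * W) for u = x / v, the variable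
  concentrates near x, since escaping by d costs a further d^2 / (2 * v). Undoing the weight on the
  small window around x produces the rate.\<close>

lemma gaertner_ellis_lower:
  assumes Wm [measurable]: "\<And>n. W n \<in> borel_measurable M"
    and int: "\<And>u. \<forall>\<^sub>F n in sequentially. integrable M (\<lambda>\<omega>. exp (u * (lam n)\<^sup>2 * W n \<omega>))"
    and L: "\<And>u. (\<lambda>n. ln (expectation (\<lambda>\<omega>. exp (u * (lam n)\<^sup>2 * W n \<omega>))) / (lam n)\<^sup>2) \<longlonglongrightarrow> v * u\<^sup>2 / 2"
    and v: "v > 0" and "\<epsilon> > 0" and "\<delta> > 0"
  shows "\<forall>\<^sub>F n in sequentially. exp (- (x\<^sup>2 / (2 * v) + \<epsilon>) * (lam n)\<^sup>2) \<le> 2 * prob {\<omega>\<in>space M. \<bar>W n \<omega> - x\<bar> < \<delta>}"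
proof -
  define u where "u = x / v"
  \<comment> \<open>The window is narrow enough that u * W differs from u * x by at most \<epsilon>
    / 2 on it.\<close>
  define d where "d = min \<delta> (\<epsilon> / (2 * (\<bar>u\<bar> + 1)))"
  have d: "d > 0" "d \<le> \<delta>" using assms by (auto simp: d_def add_nonneg_pos)
  have "\<bar>u\<bar> * d \<le> (\<bar>u\<bar> + 1) * (\<epsilon> / (2 * (\<bar>u\<bar> + 1)))"
    using \<open>\<epsilon> > 0\<close> d by (intro mult_mono) (auto simp: d_def)
  also have "\<dots> = \<epsilon> / 2" by (simp add: field_simps)
  finally have ud: "\<bar>u\<bar> * d \<le> \<epsilon> / 2" .
  \<comment> \<open>The extra tilt d / v is optimal for an escape by d. The error \<eta> is at most
    a quarter of the gain d^2 / (2 * v), so the gain minus \<eta> still exceeds \<eta>.\<close>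
  define h where "h = d / v"
  define \<eta> where "\<eta> = min (\<epsilon> / 2) (d\<^sup>2 / (8 * v))"
  have \<eta>: "\<eta> > 0" "\<eta> \<le> \<epsilon> / 2" "\<eta> \<le> d\<^sup>2 / (8 * v)" using assms d by (auto simp: \<eta>_def)
  have abs: "\<forall>\<^sub>F n in sequentially. 4 * exp (- (d\<^sup>2 / (2 * v) - \<eta>) * (lam n)\<^sup>2) \<le> exp (- \<eta> * (lam n)\<^sup>2)"
  proof (rule const_absorb)
    have "d\<^sup>2 / (8 * v) > 0" using d v by simp
    moreover have "d\<^sup>2 / (2 * v) = 4 * (d\<^sup>2 / (8 * v))" by (simp add: field_simps)
    ultimately show "\<eta> < d\<^sup>2 / (2 * v) - \<eta>" using \<eta>(3) by linarith
  qed simp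
  show ?thesis
    using mgf_bounds[OF int L \<eta>(1), of u] mgf_bounds[OF int L \<eta>(1), of "u + h"]
      mgf_bounds[OF int L \<eta>(1), of "u + - h"] abs
  proof eventually_elim
    case (elim n)
    let ?l = "(lam n)\<^sup>2"
    let ?E = "\<lambda>u. expectation (\<lambda>\<omega>. exp (u * ?l * W n \<omega>))"
    let ?f = "\<lambda>\<omega>. exp (u * ?l * W n \<omega>)"
    let ?A = "{\<omega>. \<bar>W n \<omega> - x\<bar> < d}"
    let ?B = "{\<omega>. h * W n \<omega> \<ge> h * (x + d)}" and ?C = "{\<omega>. - h * W n \<omega> \<ge> h * (d - x)}"
    have int: "integrable M ?f" "integrable M (\<lambda>\<omega>. exp ((u + h) * ?l * W n \<omega>))" "integrable M (\<lambda>\<omega>. exp ((u + - h) * ?l * W n \<omega>))"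
      using elim by auto
    have h: "h > 0" using d v by (simp add: h_def)
    have iA: "integrable M (\<lambda>\<omega>. ?f \<omega> * indicator S \<omega>)" if "{\<omega>\<in>space M. \<omega> \<in> S} \<in> sets M" for S
    proof -
      have "integrable M (\<lambda>\<omega>. ?f \<omega> * indicator {\<omega>\<in>space M. \<omega> \<in> S} \<omega>)"
        using int(1) that by (rule integrable_real_mult_indicator[rotated])
      then show ?thesis
        by (rule Bochner_Integration.integrable_cong[THEN iffD1, rotated 2]) (auto split: split_indicator)
    qed
    have i: "integrable M (\<lambda>\<omega>. ?f \<omega> * indicator ?A \<omega>)" "integrable M (\<lambda>\<omega>. ?f \<omega> * indicator ?B \<omega>)" "integrable M (\<lambda>\<omega>. ?f \<omega> * indicator ?C \<omega>)"
      by (rule iA, simp)+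
    have half: "exp (?l * c) * exp (- (d\<^sup>2 / (2 * v) - \<eta>) * ?l) \<le> exp (?l * (c - \<eta>)) / 4" for c
    proof -
      have "exp (?l * c) * (4 * exp (- (d\<^sup>2 / (2 * v) - \<eta>) * ?l)) \<le> exp (?l * c) * exp (- \<eta> * ?l)"
        using elim(4) by (intro mult_left_mono) auto
      then show ?thesis by (simp add: exp_add[symmetric] algebra_simps)
    qed
    have xv: "x = u * v" using v by (simp add: u_def)
    have "expectation (\<lambda>\<omega>. ?f \<omega> * indicator ?B \<omega>) \<le> exp (- ?l * (h * (x + d))) * ?E (u + h)"
      by (rule tilted_tail) (use int in auto)
    also have "\<dots> \<le> exp (- ?l * (h * (x + d))) * exp (?l * (v * (u + h)\<^sup>2 / 2 + \<eta>))"
      using elim by (intro mult_left_mono) auto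
    also have "\<dots> = exp (?l * (v * u\<^sup>2 / 2)) * exp (- (d\<^sup>2 / (2 * v) - \<eta>) * ?l)"
      using v unfolding xv h_def by (simp add: exp_add[symmetric] field_simps power2_eq_square)
    also note half
    finally have B: "expectation (\<lambda>\<omega>. ?f \<omega> * indicator ?B \<omega>) \<le> exp (?l * (v * u\<^sup>2 / 2 - \<eta>)) / 4" .
    have "expectation (\<lambda>\<omega>. ?f \<omega> * indicator ?C \<omega>) \<le> exp (- ?l * (h * (d - x))) * ?E (u + - h)"
      by (rule tilted_tail) (use int in auto)
    also have "\<dots> \<le> exp (- ?l * (h * (d - x))) * exp (?l * (v * (u + - h)\<^sup>2 / 2 + \<eta>))"
      using elim by (intro mult_left_mono) auto
    also have "\<dots> = exp (?l * (v * u\<^sup>2 / 2)) * exp (- (d\<^sup>2 / (2 * v) - \<eta>) * ?l)"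
      using v unfolding xv h_def by (simp add: exp_add[symmetric] field_simps power2_eq_square)
    also note half
    finally have C: "expectation (\<lambda>\<omega>. ?f \<omega> * indicator ?C \<omega>) \<le> exp (?l * (v * u\<^sup>2 / 2 - \<eta>)) / 4" .
    have "?E u \<le> expectation (\<lambda>\<omega>. ?f \<omega> * indicator ?A \<omega> + (?f \<omega> * indicator ?B \<omega> + ?f \<omega> * indicator ?C \<omega>))"
    proof (rule integral_mono)
      fix \<omega>
      have "\<omega> \<in> ?A \<or> x + d \<le> W n \<omega> \<or> d - x \<le> - W n \<omega>" by (simp add: abs_if; linarith)
      then have "\<omega> \<in> ?A \<or> h * (x + d) \<le> h * W n \<omega> \<or> h * (d - x) \<le> h * - W n \<omega>"
        using h mult_left_mono[of _ _ h] by fastforce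
      then have "\<omega> \<in> ?A \<or> \<omega> \<in> ?B \<or> \<omega> \<in> ?C" by simp
      then show "?f \<omega> \<le> ?f \<omega> * indicator ?A \<omega> + (?f \<omega> * indicator ?B \<omega> + ?f \<omega> * indicator ?C \<omega>)"
        by (auto split: split_indicator)
    qed (use int i in auto)
    \<comment> \<open>Each of the two escape events carries at most a quarter of the lower bound for
      the total weight, so at least half of it stays in the window.\<close>
    also have "\<dots> = expectation (\<lambda>\<omega>. ?f \<omega> * indicator ?A \<omega>) + (expectation (\<lambda>\<omega>. ?f \<omega> * indicator ?B \<omega>) + expectation (\<lambda>\<omega>. ?f \<omega> * indicator ?C \<omega>))"
      using i by simp
    finally have A: "exp (?l * (v * u\<^sup>2 / 2 - \<eta>)) \<le> 2 * expectation (\<lambda>\<omega>. ?f \<omega> * indicator ?A \<omega>)"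
      using B C elim(1) by linarith
    have "expectation (\<lambda>\<omega>. ?f \<omega> * indicator ?A \<omega>) \<le> expectation (\<lambda>\<omega>. exp (?l * (u * x + \<bar>u\<bar> * d)) * indicator {\<omega>\<in>space M. \<bar>W n \<omega> - x\<bar> < d} \<omega>)"
    proof (rule integral_mono[OF i(1)])
      show "integrable M (\<lambda>\<omega>. exp (?l * (u * x + \<bar>u\<bar> * d)) * indicator {\<omega>\<in>space M. \<bar>W n \<omega> - x\<bar> < d} \<omega>)"
        by (intro integrable_mult_right integrable_real_indicator) (auto simp: emeasure_eq_measure)
      fix \<omega> assume s: "\<omega> \<in> space M"
      show "?f \<omega> * indicator ?A \<omega> \<le> exp (?l * (u * x + \<bar>u\<bar> * d)) * indicator {\<omega>\<in>space M. \<bar>W n \<omega> - x\<bar> < d} \<omega>"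
      proof (cases "\<omega> \<in> ?A")
        case True
        have "u * (W n \<omega> - x) \<le> \<bar>u\<bar> * \<bar>W n \<omega> - x\<bar>" using abs_ge_self[of "u * (W n \<omega> - x)"] by (simp only: abs_mult)
        also have "\<dots> \<le> \<bar>u\<bar> * d" using True by (intro mult_left_mono) auto
        finally have "u * W n \<omega> \<le> u * x + \<bar>u\<bar> * d" by (simp add: algebra_simps)
        then have "?l * (u * W n \<omega>) \<le> ?l * (u * x + \<bar>u\<bar> * d)" by (intro mult_left_mono) auto
        then have "u * ?l * W n \<omega> \<le> ?l * (u * x + \<bar>u\<bar> * d)" by (simp only: mult_ac)
        then show ?thesis using True s by simp
      qed simp
    qed
    also have "\<dots> = exp (?l * (u * x + \<bar>u\<bar> * d)) * prob {\<omega>\<in>space M. \<bar>W n \<omega> - x\<bar> < d}"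
      by simp
    also have "\<dots> \<le> exp (?l * (u * x + \<epsilon> / 2)) * prob {\<omega>\<in>space M. \<bar>W n \<omega> - x\<bar> < \<delta>}"
    proof (rule mult_mono)
      show "exp (?l * (u * x + \<bar>u\<bar> * d)) \<le> exp (?l * (u * x + \<epsilon> / 2))"
        unfolding exp_le_cancel_iff by (rule mult_left_mono) (use ud in auto)
      show "prob {\<omega>\<in>space M. \<bar>W n \<omega> - x\<bar> < d} \<le> prob {\<omega>\<in>space M. \<bar>W n \<omega> - x\<bar> < \<delta>}"
        by (rule finite_measure_mono) (use d in auto)
    qed auto
    finally have "exp (?l * (v * u\<^sup>2 / 2 - \<eta>)) \<le> exp (?l * (u * x + \<epsilon> / 2)) * (2 * prob {\<omega>\<in>space M. \<bar>W n \<omega> - x\<bar> < \<delta>})"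
      using A by linarith
    then have "exp (- (?l * (u * x + \<epsilon> / 2))) * exp (?l * (v * u\<^sup>2 / 2 - \<eta>)) \<le>
       exp (- (?l * (u * x + \<epsilon> / 2))) * (exp (?l * (u * x + \<epsilon> / 2)) * (2 * prob {\<omega>\<in>space M. \<bar>W n \<omega> - x\<bar> < \<delta>}))"
      by (intro mult_left_mono) auto
    also have "\<dots> = 2 * prob {\<omega>\<in>space M. \<bar>W n \<omega> - x\<bar> < \<delta>}"
      by (simp add: exp_minus field_simps)
    finally have "exp (- (?l * (u * x + \<epsilon> / 2)) + ?l * (v * u\<^sup>2 / 2 - \<eta>)) \<le> 2 * prob {\<omega>\<in>space M. \<bar>W n \<omega> - x\<bar> < \<delta>}"
      by (simp only: exp_add)
    moreover have "- (x\<^sup>2 / (2 * v) + \<epsilon>) * ?l \<le> - (?l * (u * x + \<epsilon> / 2)) + ?l * (v * u\<^sup>2 / 2 - \<eta>)"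
    proof -
      have "x\<^sup>2 / (2 * v) + \<epsilon> \<ge> u * x + \<epsilon> / 2 - v * u\<^sup>2 / 2 + \<eta>"
      proof -
        have "x\<^sup>2 / (2 * v) = v * u\<^sup>2 / 2" "u * x = v * u\<^sup>2"
          using v by (simp_all add: u_def power2_eq_square)
        then show ?thesis using \<eta>(2) by linarith
      qed
      then have "?l * (x\<^sup>2 / (2 * v) + \<epsilon>) \<ge> ?l * (u * x + \<epsilon> / 2 - v * u\<^sup>2 / 2 + \<eta>)"
        by (intro mult_left_mono) auto
      moreover have "?l * (u * x + \<epsilon> / 2 - v * u\<^sup>2 / 2 + \<eta>) = ?l * (u * x + \<epsilon> / 2) - ?l * (v * u\<^sup>2 / 2 - \<eta>)"
        by (simp only: right_diff_distrib[symmetric]) (simp add: algebra_simps)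
      moreover have "- (x\<^sup>2 / (2 * v) + \<epsilon>) * ?l = - (?l * (x\<^sup>2 / (2 * v) + \<epsilon>))"
        by (simp only: mult_minus_left mult.commute)
      ultimately show ?thesis by linarith
    qed
    then have "exp (- (x\<^sup>2 / (2 * v) + \<epsilon>) * ?l) \<le> exp (- (?l * (u * x + \<epsilon> / 2)) + ?l * (v * u\<^sup>2 / 2 - \<eta>))"
      by (simp only: exp_le_cancel_iff)
    ultimately show ?case by (rule order_trans[rotated])
  qed
qed

end

section \<open>From exponential estimates to the large deviation principle\<close>

lemma eln_div_le: assumes "p \<le> exp (- c * l)" "l > 0" shows "eln p / ereal l \<le> ereal (- c)"
proof (cases "p \<le> 0")
  case False
  then have "ln p \<le> - c * l" using assms by (metis exp_gt_zero ln_exp ln_le_cancel_iff not_le)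
  then have "ln p / l \<le> - c" using assms by (simp add: field_simps)
  then show ?thesis using False assms by (simp add: eln_def)
qed (use assms in \<open>auto simp: eln_def divide_ereal_def\<close>)

lemma eln_div_ge: assumes "exp (- c * l) \<le> p" "l > 0" shows "eln p / ereal l \<ge> ereal (- c)"
proof -
  have "p > 0" using assms(1) exp_gt_zero[of "- c * l"] by linarith
  then have "ln p \<ge> - c * l" using assms by (simp add: ln_ge_iff)
  then have "ln p / l \<ge> - c" using assms by (simp add: field_simps)
  then show ?thesis using \<open>p > 0\<close> assms by (simp add: eln_def)
qed

lemma good_rate_quadratic: assumes "v > 0" shows "good_rate_function (\<lambda>x. x\<^sup>2 / (2 * v))"
  unfolding good_rate_function_def
proof safe
  fix c :: real
  have "closed {x. x\<^sup>2 / (2 * v) \<le> c}"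
    by (intro closed_Collect_le continuous_intros) (use assms in auto)
  moreover have "{x. x\<^sup>2 / (2 * v) \<le> c} \<subseteq> cball 0 (sqrt (2 * v * c))"
    using assms by (auto simp: field_simps intro!: real_le_rsqrt)
  then have "bounded {x. x\<^sup>2 / (2 * v) \<le> c}" using bounded_cball bounded_subset by blast
  ultimately show "compact {x. x\<^sup>2 / (2 * v) \<le> c}" by (simp add: compact_eq_bounded_closed)
qed (use assms in auto)

lemma le_uminus_swap: "a \<le> - b \<longleftrightarrow> b \<le> - a" for a b :: ereal
  by (cases a; cases b) auto

context speed begin

text \<open>Exponential equivalence: a difference \<open>Z n - W n\<close> that vanishes along every
  \<open>LF K\<close> is invisible at speed \<open>lam ^ 2\<close>, so only the log-mgf of the
  convenient variable \<open>W\<close> has to be known.\<close>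

lemma LDP_quadratic:
  assumes Wm [measurable]: "\<And>n. W n \<in> borel_measurable M"
    and int: "\<And>u. \<forall>\<^sub>F n in sequentially. integrable M (\<lambda>\<omega>. exp (u * (lam n)\<^sup>2 * W n \<omega>))"
    and L: "\<And>u. (\<lambda>n. ln (expectation (\<lambda>\<omega>. exp (u * (lam n)\<^sup>2 * W n \<omega>))) / (lam n)\<^sup>2) \<longlonglongrightarrow> v * u\<^sup>2 / 2"
    and v: "v > 0"
    and Zm [measurable]: "\<And>n. Z n \<in> borel_measurable M"
    and eq: "\<And>K. ((\<lambda>z. Z (fst z) (snd z) - W (fst z) (snd z)) \<longlongrightarrow> 0) (LF K)"
  shows "LDP M Z (\<lambda>n. (lam n)\<^sup>2) (\<lambda>x. x\<^sup>2 / (2 * v))"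
  unfolding LDP_def
proof (intro conjI allI impI)
  show "good_rate_function (\<lambda>x. x\<^sup>2 / (2 * v))" using v by (rule good_rate_quadratic)
next
  have p: "(lam n)\<^sup>2 > 0" for n using lam_pos[of n] by simp
  have close: "\<forall>\<^sub>F n in sequentially. prob {\<omega>\<in>space M. \<bar>Z n \<omega> - W n \<omega>\<bar> \<ge> \<delta>} \<le> exp (- K * (lam n)\<^sup>2)"
    if "\<delta> > 0" for \<delta> K
    by (rule eventually_LFD[OF tendstoD[OF eq[of "K + 1"] that]]) (auto simp: dist_real_def)
  fix F :: "real set" assume "closed F"
  let ?f = "\<lambda>n. eln (prob {\<omega>\<in>space M. Z n \<omega> \<in> F}) / ereal ((lam n)\<^sup>2)"
  let ?I = "INF x\<in>F. ereal (x\<^sup>2 / (2 * v))"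
  \<comment> \<open>Real levels c strictly below the infimum are tested instead of the infimum
    itself, which is infinite when F is empty.\<close>
  have key: "limsup ?f \<le> - ereal c" if c: "ereal c < ?I" for c
  proof -
    have "\<forall>\<^sub>F n in sequentially. prob {\<omega>\<in>space M. Z n \<omega> \<in> F} \<le> exp (- c * (lam n)\<^sup>2)"
    proof (cases "c < 0")
      case True
      then have "1 \<le> exp (- c * (lam n)\<^sup>2)" for n using p[of n] by (simp add: mult_nonpos_nonneg)
      then show ?thesis by (intro always_eventually allI order_trans[OF prob_le_1])
    next
      case False
      obtain c2 where c2: "c < c2" "ereal c2 < ?I"
        using ereal_dense2[OF c] by auto
      \<comment> \<open>F lies outside the open interval (-r, r), on which the rate is below
        c2.\<close>
      define r where "r = sqrt (2 * v * c2)"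
      have r: "r > 0" "r\<^sup>2 = 2 * v * c2" using False c2 v by (auto simp: r_def)
      have F: "\<bar>x\<bar> \<ge> r" if "x \<in> F" for x
      proof -
        have "ereal c2 < ereal (x\<^sup>2 / (2 * v))" using c2(2) that by (meson INF_lower less_le_trans)
        then have "2 * v * c2 \<le> x\<^sup>2" using v by (simp add: field_simps)
        then show ?thesis unfolding r_def by (metis real_sqrt_abs real_sqrt_le_iff)
      qed
      \<comment> \<open>The gap c2 - c is split into three: one part for shrinking r to r -
        \<delta>, one for the error of the upper bound, one to absorb constants.\<close>
      define \<epsilon> where "\<epsilon> = (c2 - c) / 3"
      define \<delta> where "\<delta> = min r (\<epsilon> * v / r)"
      have \<epsilon>: "\<epsilon> > 0" using c2 by (simp add: \<epsilon>_def)
      then have \<delta>: "\<delta> > 0" "\<delta> \<le> r" "r * \<delta> \<le> \<epsilon> * v"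
        using r(1) v mult_left_mono[of \<delta> "\<epsilon> * v / r" r] by (auto simp: \<delta>_def)
      have "r\<^sup>2 - 2 * (r * \<delta>) \<le> (r - \<delta>)\<^sup>2" by (simp add: power2_diff)
      then have "2 * v * c2 - 2 * (\<epsilon> * v) \<le> (r - \<delta>)\<^sup>2" using r(2) \<delta>(3) by linarith
      then have rd: "c + \<epsilon> \<le> (r - \<delta>)\<^sup>2 / (2 * v) - \<epsilon>" using v by (simp add: field_simps \<epsilon>_def)
      have "\<forall>\<^sub>F n in sequentially. 3 * exp (- (c + \<epsilon>) * (lam n)\<^sup>2) \<le> exp (- c * (lam n)\<^sup>2)"
        by (rule const_absorb) (use \<epsilon> in auto)
      moreover have "\<forall>\<^sub>F n in sequentially. prob {\<omega>\<in>space M. \<bar>W n \<omega>\<bar> \<ge> r - \<delta>} \<le> 2 * exp (- ((r - \<delta>)\<^sup>2 / (2 * v) - \<epsilon>) * (lam n)\<^sup>2)"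
        by (rule gaertner_ellis_upper[OF Wm int L v \<epsilon>]) (use \<delta> in auto)
      ultimately show ?thesis using close[OF \<delta>(1), of "c + \<epsilon>"]
      proof eventually_elim
        case (elim n)
        have "prob {\<omega>\<in>space M. Z n \<omega> \<in> F} \<le> prob ({\<omega>\<in>space M. \<bar>W n \<omega>\<bar> \<ge> r - \<delta>} \<union> {\<omega>\<in>space M. \<bar>Z n \<omega> - W n \<omega>\<bar> \<ge> \<delta>})"
          using F by (intro finite_measure_mono) fastforce+
        also have "\<dots> \<le> prob {\<omega>\<in>space M. \<bar>W n \<omega>\<bar> \<ge> r - \<delta>} + prob {\<omega>\<in>space M. \<bar>Z n \<omega> - W n \<omega>\<bar> \<ge> \<delta>}"
          by (rule measure_Un_le) auto
        also have "\<dots> \<le> 2 * exp (- ((r - \<delta>)\<^sup>2 / (2 * v) - \<epsilon>) * (lam n)\<^sup>2) + exp (- (c + \<epsilon>) * (lam n)\<^sup>2)"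
          using elim by linarith
        also have "exp (- ((r - \<delta>)\<^sup>2 / (2 * v) - \<epsilon>) * (lam n)\<^sup>2) \<le> exp (- (c + \<epsilon>) * (lam n)\<^sup>2)"
          unfolding exp_le_cancel_iff by (rule mult_right_mono) (use rd in auto)
        finally show ?case using elim(1) by linarith
      qed
    qed
    then have "\<forall>\<^sub>F n in sequentially. ?f n \<le> - ereal c"
      by (rule eventually_mono) (use eln_div_le p in auto)
    then show ?thesis by (rule Limsup_bounded)
  qed
  show "limsup ?f \<le> - ?I"
  proof -
    have "x \<le> - limsup ?f" if "x < ?I" for x
      using that key[of "real_of_ereal x"] by (cases x) (auto simp: le_uminus_swap[of _ "limsup _"])
    then have "?I \<le> - limsup ?f" by (rule dense_le)
    then show ?thesis by (simp add: le_uminus_swap[of "limsup _"])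
  qed
next
  have p: "(lam n)\<^sup>2 > 0" for n using lam_pos[of n] by simp
  have close: "\<forall>\<^sub>F n in sequentially. prob {\<omega>\<in>space M. \<bar>Z n \<omega> - W n \<omega>\<bar> \<ge> \<delta>} \<le> exp (- K * (lam n)\<^sup>2)"
    if "\<delta> > 0" for \<delta> K
    by (rule eventually_LFD[OF tendstoD[OF eq[of "K + 1"] that]]) (auto simp: dist_real_def)
  fix G :: "real set" assume G: "open G"
  let ?f = "\<lambda>n. eln (prob {\<omega>\<in>space M. Z n \<omega> \<in> G}) / ereal ((lam n)\<^sup>2)"
  let ?I = "INF x\<in>G. ereal (x\<^sup>2 / (2 * v))"
  have GM [measurable]: "{\<omega>\<in>space M. Z n \<omega> \<in> G} \<in> sets M" for n
    using measurable_sets[OF Zm[of n], of G] G by (simp add: vimage_def Int_def conj_commute)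
  \<comment> \<open>If W is within d / 2 of x and Z within d / 2 of W, then Z lies in G. The
    exceptional event is given the rate of the target bound, and the spare \<epsilon> absorbs the
    factor 4.\<close>
  have key: "ereal (- (x\<^sup>2 / (2 * v) + 2 * \<epsilon>)) \<le> liminf ?f" if "x \<in> G" "\<epsilon> > 0" for x \<epsilon>
  proof -
    let ?J = "x\<^sup>2 / (2 * v)"
    obtain d where d: "d > 0" "ball x d \<subseteq> G" using G \<open>x \<in> G\<close> open_contains_ball by blast
    have "\<forall>\<^sub>F n in sequentially. 4 * exp (- (?J + 2 * \<epsilon>) * (lam n)\<^sup>2) \<le> exp (- (?J + \<epsilon>) * (lam n)\<^sup>2)"
      by (rule const_absorb) (use \<open>\<epsilon> > 0\<close> in auto)
    moreover have "\<forall>\<^sub>F n in sequentially. exp (- (?J + \<epsilon>) * (lam n)\<^sup>2) \<le> 2 * prob {\<omega> \<in> space M. \<bar>W n \<omega> - x\<bar> < d / 2}"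
      by (rule gaertner_ellis_lower[OF Wm int L v \<open>\<epsilon> > 0\<close>]) (use d in auto)
    moreover have "\<forall>\<^sub>F n in sequentially. prob {\<omega>\<in>space M. \<bar>Z n \<omega> - W n \<omega>\<bar> \<ge> d / 2} \<le> exp (- (?J + 2 * \<epsilon>) * (lam n)\<^sup>2)"
      by (rule close) (use d in auto)
    ultimately have "\<forall>\<^sub>F n in sequentially. ereal (- (?J + 2 * \<epsilon>)) \<le> ?f n"
    proof eventually_elim
      case (elim n)
      have "prob {\<omega> \<in> space M. \<bar>W n \<omega> - x\<bar> < d / 2} \<le> prob ({\<omega>\<in>space M. Z n \<omega> \<in> G} \<union> {\<omega>\<in>space M. \<bar>Z n \<omega> - W n \<omega>\<bar> \<ge> d / 2})"
      proof (intro finite_measure_mono subsetI)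
        fix \<omega> assume w: "\<omega> \<in> {\<omega> \<in> space M. \<bar>W n \<omega> - x\<bar> < d / 2}"
        show "\<omega> \<in> {\<omega>\<in>space M. Z n \<omega> \<in> G} \<union> {\<omega>\<in>space M. \<bar>Z n \<omega> - W n \<omega>\<bar> \<ge> d / 2}"
        proof (cases "\<bar>Z n \<omega> - W n \<omega>\<bar> \<ge> d / 2")
          case False
          with w have "\<bar>Z n \<omega> - W n \<omega>\<bar> < d / 2" "\<bar>W n \<omega> - x\<bar> < d / 2" by simp_all
          then have "\<bar>x - Z n \<omega>\<bar> < d" by linarith
          then show ?thesis using d w by (auto simp: subset_eq dist_real_def)
        qed (use w in auto)
      qed auto
      also have "\<dots> \<le> prob {\<omega>\<in>space M. Z n \<omega> \<in> G} + prob {\<omega>\<in>space M. \<bar>Z n \<omega> - W n \<omega>\<bar> \<ge> d / 2}"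
        by (rule measure_Un_le) auto
      finally have "exp (- (?J + 2 * \<epsilon>) * (lam n)\<^sup>2) \<le> prob {\<omega>\<in>space M. Z n \<omega> \<in> G}"
        using elim by linarith
      then show ?case by (rule eln_div_ge) (rule p)
    qed
    then show ?thesis by (rule Liminf_bounded)
  qed
  have "- liminf ?f \<le> ?I"
  proof (rule INF_greatest)
    fix x assume "x \<in> G"
    have "- ereal (x\<^sup>2 / (2 * v)) \<le> liminf ?f"
    proof (rule ereal_le_epsilon2)
      fix e :: real assume "0 < e"
      then have "ereal (- (x\<^sup>2 / (2 * v) + 2 * (e / 2))) \<le> liminf ?f" by (intro key \<open>x \<in> G\<close>) auto
      then show "- ereal (x\<^sup>2 / (2 * v)) \<le> liminf ?f + ereal e"
        by (cases "liminf ?f") auto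
    qed
    then show "- liminf ?f \<le> ereal (x\<^sup>2 / (2 * v))" using ereal_uminus_le_reorder by blast
  qed
  then show "- ?I \<le> liminf ?f" using ereal_uminus_le_reorder by blast
qed

text \<open>Where \<Lambda> is close to q * lam^2, the weights exp Y and exp (Y - \<Lambda>) differ
  by a nearly constant factor, and the latter has expectation 1. On the exceptional set the second
  moment \<open>sq\<close> controls exp Y.\<close>

lemma mgf_limit:
  fixes Y \<Lambda> :: "nat \<Rightarrow> 'a \<Rightarrow> real"
  assumes Ym [measurable]: "\<And>n. Y n \<in> borel_measurable M" and Lm [measurable]: "\<And>n. \<Lambda> n \<in> borel_measurable M"
    and mart: "\<And>n. (\<integral>\<^sup>+\<omega>. ennreal (exp (Y n \<omega> - \<Lambda> n \<omega>)) \<partial>M) = 1"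
    and nonneg: "\<And>n \<omega>. \<omega> \<in> space M \<Longrightarrow> \<Lambda> n \<omega> \<ge> 0"
    and sq: "\<forall>\<^sub>F n in sequentially. (\<integral>\<^sup>+\<omega>. ennreal (exp (2 * Y n \<omega>)) \<partial>M) \<le> ennreal (exp (C * (lam n)\<^sup>2))"
    and lim: "\<And>K. ((\<lambda>z. \<Lambda> (fst z) (snd z) / (lam (fst z))\<^sup>2) \<longlongrightarrow> q) (LF K)"
  shows "\<forall>\<^sub>F n in sequentially. integrable M (\<lambda>\<omega>. exp (Y n \<omega>))"
    and "(\<lambda>n. ln (expectation (\<lambda>\<omega>. exp (Y n \<omega>))) / (lam n)\<^sup>2) \<longlonglongrightarrow> q"
proof -
  have p: "(lam n)\<^sup>2 > 0" for n using lam_pos[of n] by simp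
  have int2: "integrable M (\<lambda>\<omega>. exp (2 * Y n \<omega>))" "expectation (\<lambda>\<omega>. exp (2 * Y n \<omega>)) \<le> exp (C * (lam n)\<^sup>2)"
    if "(\<integral>\<^sup>+\<omega>. ennreal (exp (2 * Y n \<omega>)) \<partial>M) \<le> ennreal (exp (C * (lam n)\<^sup>2))" for n
  proof -
    show i: "integrable M (\<lambda>\<omega>. exp (2 * Y n \<omega>))"
      using that by (intro integrableI_nonneg) (auto intro: le_less_trans)
    show "expectation (\<lambda>\<omega>. exp (2 * Y n \<omega>)) \<le> exp (C * (lam n)\<^sup>2)"
      using that by (subst (asm) nn_integral_eq_integral[OF i]) auto
  qed
  have int1: "integrable M (\<lambda>\<omega>. exp (Y n \<omega>))"
    if "(\<integral>\<^sup>+\<omega>. ennreal (exp (2 * Y n \<omega>)) \<partial>M) \<le> ennreal (exp (C * (lam n)\<^sup>2))" for n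
  proof (rule Bochner_Integration.integrable_bound)
    show "integrable M (\<lambda>\<omega>. exp (2 * Y n \<omega>) + 1)" using int2[OF that] by simp
    have "exp y \<le> exp (2 * y) + 1" for y :: real
      by (cases "y \<ge> 0") (auto intro: add_increasing add_increasing2)
    then show "AE \<omega> in M. norm (exp (Y n \<omega>)) \<le> norm (exp (2 * Y n \<omega>) + 1)" by auto
  qed auto
  show "\<forall>\<^sub>F n in sequentially. integrable M (\<lambda>\<omega>. exp (Y n \<omega>))"
    using sq by (rule eventually_mono) (rule int1)
  show "(\<lambda>n. ln (expectation (\<lambda>\<omega>. exp (Y n \<omega>))) / (lam n)\<^sup>2) \<longlonglongrightarrow> q"
  proof (rule tendstoI)
    fix e :: real assume "e > 0"
    define \<epsilon> where "\<epsilon> = e / 3"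
    have \<epsilon>: "\<epsilon> > 0" using \<open>e > 0\<close> by (simp add: \<epsilon>_def)
    \<comment> \<open>Any R >= - q makes exp (- R * lam^2) at most exp (lam^2 * (q + \<epsilon>)); R
      > 0 also makes it eventually at most 1/2, as the lower bound requires.\<close>
    define R where "R = \<bar>q\<bar> + 1"
    let ?B = "\<lambda>n. {\<omega>\<in>space M. \<bar>\<Lambda> n \<omega> / (lam n)\<^sup>2 - q\<bar> \<ge> \<epsilon>}"
    have "\<forall>\<^sub>F n in sequentially. prob (?B n) \<le> exp (- (C + 2 * R) * (lam n)\<^sup>2)"
      by (rule eventually_LFD[OF tendstoD[OF lim[of "C + 2 * R + 1"] \<epsilon>]]) (auto simp: dist_real_def)
    moreover have "\<forall>\<^sub>F n in sequentially. 2 * exp (- R * (lam n)\<^sup>2) \<le> exp (- 0 * (lam n)\<^sup>2)"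
      by (rule const_absorb) (auto simp: R_def)
    ultimately show "\<forall>\<^sub>F n in sequentially. dist (ln (expectation (\<lambda>\<omega>. exp (Y n \<omega>))) / (lam n)\<^sup>2) q < e"
      using sq lam2_ge[of "ln 2 / \<epsilon>"]
    proof eventually_elim
      case (elim n)
      let ?l = "(lam n)\<^sup>2"
      let ?X = "\<lambda>\<omega>. exp (Y n \<omega> - \<Lambda> n \<omega>)"
      let ?E = "expectation (\<lambda>\<omega>. exp (Y n \<omega>))"
      note i2 = int2[OF elim(3)] and i1 = int1[OF elim(3)]
      have iX: "integrable M ?X"
        by (rule integrableI_nonneg) (use mart in auto)
      have eX: "expectation ?X = 1"
        using nn_integral_eq_integral[OF iX] mart[of n] by simp
      \<comment> \<open>A weighted AM-GM inequality in place of Cauchy-Schwarz: exp y <= exp (- t) *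
        exp (2 * y) / 2 + exp t / 2. With t = (C + R) * lam^2 and a set of probability at most exp
        (- (C + 2 * R) * lam^2), both halves equal exp (- R * lam^2) / 2.\<close>
      have "expectation (\<lambda>\<omega>. exp (Y n \<omega>) * indicator (?B n) \<omega>)
         \<le> expectation (\<lambda>\<omega>. exp (- (C + R) * ?l) * exp (2 * Y n \<omega>) / 2 + exp ((C + R) * ?l) * indicator (?B n) \<omega> / 2)"
      proof (rule integral_mono)
        fix \<omega>
        have "2 * (x * y) \<le> x\<^sup>2 + y\<^sup>2" for x y :: real
          using zero_le_power2[of "x - y"] by (simp add: power2_diff)
        then have *: "2 * (exp (y - t / 2) * exp (t / 2)) \<le> (exp (y - t / 2))\<^sup>2 + (exp (t / 2))\<^sup>2" for y t :: real .
        have "exp y \<le> exp (- t) * exp (2 * y) / 2 + exp t / 2" for y t :: real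
        proof -
          have "exp (y - t / 2) * exp (t / 2) = exp y" "(exp (y - t / 2))\<^sup>2 = exp (- t) * exp (2 * y)" "(exp (t / 2))\<^sup>2 = exp t"
            by (simp_all add: power2_eq_square flip: exp_add)
          then show ?thesis using *[of y t] by simp
        qed
        from this[of "Y n \<omega>" "(C + R) * ?l"]
        have "exp (Y n \<omega>) \<le> exp (- (C + R) * ?l) * exp (2 * Y n \<omega>) / 2 + exp ((C + R) * ?l) / 2"
          by (simp only: mult_minus_left)
        then show "exp (Y n \<omega>) * indicator (?B n) \<omega> \<le> exp (- (C + R) * ?l) * exp (2 * Y n \<omega>) / 2 + exp ((C + R) * ?l) * indicator (?B n) \<omega> / 2"
          by (auto split: split_indicator)
      next
        show "integrable M (\<lambda>\<omega>. exp (Y n \<omega>) * indicator (?B n) \<omega>)"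
          by (rule integrable_real_mult_indicator) (use i1 in auto)
        show "integrable M (\<lambda>\<omega>. exp (- (C + R) * ?l) * exp (2 * Y n \<omega>) / 2 + exp ((C + R) * ?l) * indicator (?B n) \<omega> / 2)"
          using i2(1) by (intro Bochner_Integration.integrable_add integrable_divide integrable_mult_right integrable_real_indicator)
            (auto simp: emeasure_eq_measure)
      qed
      also have "\<dots> = exp (- (C + R) * ?l) * expectation (\<lambda>\<omega>. exp (2 * Y n \<omega>)) / 2 + exp ((C + R) * ?l) * prob (?B n) / 2"
      proof -
        have "integrable M (indicat_real (?B n))" by (rule integrable_real_indicator) (auto simp: emeasure_eq_measure)
        then show ?thesis using i2(1) by simp
      qed
      also have "\<dots> \<le> exp (- (C + R) * ?l) * exp (C * ?l) / 2 + exp ((C + R) * ?l) * exp (- (C + 2 * R) * ?l) / 2"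
        using i2(2) elim(1) by (intro add_mono divide_right_mono mult_left_mono) auto
      also have "\<dots> = exp (- R * ?l)"
        by (simp add: exp_add[symmetric] algebra_simps)
      finally have EB: "expectation (\<lambda>\<omega>. exp (Y n \<omega>) * indicator (?B n) \<omega>) \<le> exp (- R * ?l)" .
      \<comment> \<open>Nonnegativity of \<Lambda> lets the martingale weight inherit the bound just
        obtained for exp Y.\<close>
      have XB: "expectation (\<lambda>\<omega>. ?X \<omega> * indicator (?B n) \<omega>) \<le> expectation (\<lambda>\<omega>. exp (Y n \<omega>) * indicator (?B n) \<omega>)"
        using nonneg[of _ n] i1 iX by (intro integral_mono integrable_real_mult_indicator) (auto split: split_indicator)
      have iB: "integrable M (\<lambda>\<omega>. exp (Y n \<omega>) * indicator (?B n) \<omega>)" "integrable M (\<lambda>\<omega>. ?X \<omega> * indicator (?B n) \<omega>)"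
        using i1 iX by (auto intro!: integrable_real_mult_indicator)
      have good: "\<Lambda> n \<omega> \<le> ?l * (q + \<epsilon>)" "?l * (q - \<epsilon>) \<le> \<Lambda> n \<omega>" if "\<omega> \<in> space M" "\<omega> \<notin> ?B n" for \<omega>
        using that p[of n] by (auto simp: abs_if field_simps split: if_splits)
      have "?E \<le> expectation (\<lambda>\<omega>. exp (?l * (q + \<epsilon>)) * ?X \<omega> + exp (Y n \<omega>) * indicator (?B n) \<omega>)"
      proof (rule integral_mono)
        fix \<omega> assume w: "\<omega> \<in> space M"
        show "exp (Y n \<omega>) \<le> exp (?l * (q + \<epsilon>)) * ?X \<omega> + exp (Y n \<omega>) * indicator (?B n) \<omega>"
        proof (cases "\<omega> \<in> ?B n")
          case False
          then have "exp (Y n \<omega>) \<le> exp (?l * (q + \<epsilon>)) * ?X \<omega>"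
            unfolding exp_add[symmetric] exp_le_cancel_iff using good(1)[OF w] by linarith
          then show ?thesis using False by simp
        qed auto
      qed (use i1 iX iB in auto)
      also have "\<dots> = exp (?l * (q + \<epsilon>)) + expectation (\<lambda>\<omega>. exp (Y n \<omega>) * indicator (?B n) \<omega>)"
        using iX iB eX by simp
      also have "\<dots> \<le> exp (?l * (q + \<epsilon>)) + exp (- R * ?l)" using EB by simp
      also have "exp (- R * ?l) \<le> exp (?l * (q + \<epsilon>))"
      proof -
        have "?l * - R \<le> ?l * (q + \<epsilon>)"
          by (rule mult_left_mono) (use \<epsilon> in \<open>auto simp: R_def\<close>)
        then show ?thesis by (simp add: mult.commute)
      qed
      finally have up: "?E \<le> 2 * exp (?l * (q + \<epsilon>))" by simp
      have "exp (?l * (q - \<epsilon>)) * (1 - exp (- R * ?l)) \<le> exp (?l * (q - \<epsilon>)) * (1 - expectation (\<lambda>\<omega>. ?X \<omega> * indicator (?B n) \<omega>))"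
        using XB EB by (intro mult_left_mono) auto
      also have "\<dots> = expectation (\<lambda>\<omega>. exp (?l * (q - \<epsilon>)) * (?X \<omega> - ?X \<omega> * indicator (?B n) \<omega>))"
        using iX iB eX by simp
      also have "\<dots> \<le> ?E"
      proof (rule integral_mono)
        fix \<omega> assume w: "\<omega> \<in> space M"
        show "exp (?l * (q - \<epsilon>)) * (?X \<omega> - ?X \<omega> * indicator (?B n) \<omega>) \<le> exp (Y n \<omega>)"
        proof (cases "\<omega> \<in> ?B n")
          case False
          then have "exp (?l * (q - \<epsilon>)) * ?X \<omega> \<le> exp (Y n \<omega>)"
            unfolding exp_add[symmetric] exp_le_cancel_iff using good(2)[OF w] by linarith
          then show ?thesis using False by simp
        qed auto
      qed (use i1 iX iB in auto)
      finally have low: "exp (?l * (q - \<epsilon>)) * (1 - exp (- R * ?l)) \<le> ?E" .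
      have "exp (?l * (q - \<epsilon>)) * (1 / 2) \<le> exp (?l * (q - \<epsilon>)) * (1 - exp (- R * ?l))"
        using elim(2) by (intro mult_left_mono) auto
      with low have low: "exp (?l * (q - \<epsilon>)) / 2 \<le> ?E" by linarith
      have Epos: "?E > 0" by (rule less_le_trans[OF _ low]) simp
      have "ln ?E \<le> ln (2 * exp (?l * (q + \<epsilon>)))" using up Epos by (subst ln_le_cancel_iff) auto
      then have 1: "ln ?E \<le> ln 2 + ?l * (q + \<epsilon>)" by (simp add: ln_mult)
      have "ln (exp (?l * (q - \<epsilon>)) / 2) \<le> ln ?E" using low Epos by (subst ln_le_cancel_iff) auto
      then have 2: "?l * (q - \<epsilon>) - ln 2 \<le> ln ?E" by (simp add: ln_div)
      have 3: "ln 2 \<le> ?l * \<epsilon>" using elim(4) \<epsilon> by (simp add: field_simps)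
      have "ln ?E \<le> ?l * (q + 2 * \<epsilon>)" "?l * (q - 2 * \<epsilon>) \<le> ln ?E"
        using 1 2 3 by (simp_all add: algebra_simps)
      then have "ln ?E / ?l \<le> q + 2 * \<epsilon>" "q - 2 * \<epsilon> \<le> ln ?E / ?l"
        using p[of n] by (simp_all add: divide_le_eq le_divide_eq mult.commute)
      moreover have "e = 3 * \<epsilon>" by (simp add: \<epsilon>_def)
      ultimately show ?case using \<epsilon> unfolding dist_real_def by linarith
    qed
  qed
qed

end

section \<open>Moment generating function bounds\<close>

lemma exp_taylor2: "\<bar>exp y - 1 - y\<bar> \<le> y\<^sup>2 * exp \<bar>y\<bar>" for y :: real
proof -
  obtain t where t: "\<bar>t\<bar> \<le> \<bar>y\<bar>" "exp y = (\<Sum>m<2. y ^ m / fact m) + exp t / fact 2 * y ^ 2"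
    using Maclaurin_exp_le[of y 2] by blast
  have "exp y - 1 - y = exp t / 2 * y\<^sup>2" using t(2) by (simp add: eval_nat_numeral)
  from arg_cong[OF this, of abs] have "\<bar>exp y - 1 - y\<bar> = exp t / 2 * y\<^sup>2" by (simp only: abs_mult) simp
  also have "\<dots> \<le> exp \<bar>y\<bar> * y\<^sup>2"
  proof (rule mult_right_mono)
    have "exp t \<le> exp \<bar>y\<bar>" using t(1) by simp
    then show "exp t / 2 \<le> exp \<bar>y\<bar>" using exp_gt_zero[of t] by linarith
  qed simp
  finally show ?thesis by (simp add: mult.commute)
qed

lemma exp_taylor3: "\<bar>exp y - 1 - y - y\<^sup>2 / 2\<bar> \<le> \<bar>y\<bar> ^ 3 * exp \<bar>y\<bar> / 6" for y :: real
proof -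
  obtain t where t: "\<bar>t\<bar> \<le> \<bar>y\<bar>" "exp y = (\<Sum>m<3. y ^ m / fact m) + exp t / fact 3 * y ^ 3"
    using Maclaurin_exp_le[of y 3] by blast
  have "exp y - 1 - y - y\<^sup>2 / 2 = exp t / 6 * y ^ 3" using t(2) by (simp add: eval_nat_numeral)
  from arg_cong[OF this, of abs] have "\<bar>exp y - 1 - y - y\<^sup>2 / 2\<bar> = exp t / 6 * \<bar>y\<bar> ^ 3"
    by (simp only: abs_mult power_abs) simp
  also have "\<dots> \<le> exp \<bar>y\<bar> / 6 * \<bar>y\<bar> ^ 3" using t(1) by (intro mult_right_mono) auto
  finally show ?thesis by (simp add: mult.commute)
qed

lemma power_le_exp: "x ^ n \<le> fact n * exp x" if "x \<ge> 0" for x :: real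
proof -
  have "x ^ n / fact n \<le> (\<Sum>k\<le>n. x ^ k / fact k)"
    using that by (intro member_le_sum) auto
  also have "\<dots> \<le> exp x"
    using that sum_le_suminf[OF summable_exp_generic[of x], of "{..n}"]
    by (simp add: exp_def divide_inverse mult.commute)
  finally show ?thesis by (simp add: field_simps)
qed

locale iid_subgaussian = iid_seq M V for M :: "'a measure" and V :: "nat \<Rightarrow> 'a \<Rightarrow> real" +
  fixes \<sigma> t0 :: real
  assumes V_int: "integrable M (V 1)" and V_mean: "expectation (V 1) = 0"
    and V2_int: "integrable M (\<lambda>\<omega>. (V 1 \<omega>)\<^sup>2)" and V_var: "expectation (\<lambda>\<omega>. (V 1 \<omega>)\<^sup>2) = \<sigma>\<^sup>2"
    and \<sigma>_pos: "\<sigma> > 0" and t0_pos: "t0 > 0" and V_exp: "integrable M (\<lambda>\<omega>. exp (t0 * (V 1 \<omega>)\<^sup>2))"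
begin

lemma V1m [measurable]: "V 1 \<in> borel_measurable M" "V (Suc 0) \<in> borel_measurable M"
  using V_Suc_measurable[of 0] by simp_all

definition \<phi> :: "real \<Rightarrow> real" where "\<phi> x = expectation (\<lambda>\<omega>. exp (x * V 1 \<omega>))"

definition K0 :: real where "K0 = expectation (\<lambda>\<omega>. exp (t0 * (V 1 \<omega>)\<^sup>2))"

lemma K0_ge: "K0 \<ge> 1"
proof -
  have "expectation (\<lambda>\<omega>. 1) \<le> K0" unfolding K0_def
    by (rule integral_mono) (use V_exp t0_pos in auto)
  then show ?thesis by (simp add: prob_space)
qed

text \<open>Completing the square; it trades a linear exponent in the noise for the integrable
  exponent t0 * V^2.\<close>

lemma linear_le_square: "x * u \<le> t0 * u\<^sup>2 + x\<^sup>2 / (4 * t0)"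
proof -
  have "0 \<le> (2 * t0 * u - x)\<^sup>2 / (4 * t0)" using t0_pos by simp
  also have "(2 * t0 * u - x)\<^sup>2 / (4 * t0) = t0 * u\<^sup>2 - x * u + x\<^sup>2 / (4 * t0)"
    using t0_pos by (simp add: power2_eq_square field_simps)
  finally show ?thesis by simp
qed

lemma mgf_int: "integrable M (\<lambda>\<omega>. exp (x * V 1 \<omega>))" and mgf_crude: "\<phi> x \<le> exp (x\<^sup>2 / (4 * t0)) * K0"
proof -
  have le: "exp (x * V 1 \<omega>) \<le> exp (x\<^sup>2 / (4 * t0)) * exp (t0 * (V 1 \<omega>)\<^sup>2)" for \<omega>
    using linear_le_square[of x "V 1 \<omega>"] by (simp add: exp_add[symmetric] add.commute)
  have i: "integrable M (\<lambda>\<omega>. exp (x\<^sup>2 / (4 * t0)) * exp (t0 * (V 1 \<omega>)\<^sup>2))"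
    using V_exp by simp
  show 1: "integrable M (\<lambda>\<omega>. exp (x * V 1 \<omega>))"
    by (rule Bochner_Integration.integrable_bound[OF i]) (use le in auto)
  have "\<phi> x \<le> expectation (\<lambda>\<omega>. exp (x\<^sup>2 / (4 * t0)) * exp (t0 * (V 1 \<omega>)\<^sup>2))"
    unfolding \<phi>_def by (rule integral_mono[OF 1 i le])
  then show "\<phi> x \<le> exp (x\<^sup>2 / (4 * t0)) * K0" by (simp add: K0_def)
qed

text \<open>Integrate 1 + y <= exp y, the mean being zero. Hence ln \<phi> >= 0, which makes the
  compensators nonnegative.\<close>

lemma mgf_ge_1: "\<phi> x \<ge> 1"
proof -
  have "expectation (\<lambda>\<omega>. 1 + x * V 1 \<omega>) \<le> \<phi> x" unfolding \<phi>_def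
    by (rule integral_mono) (use mgf_int V_int in \<open>auto\<close>)
  then show ?thesis using V_int V_mean by (simp add: prob_space)
qed

lemma mgf_measurable [measurable]: "\<phi> \<in> borel_measurable borel"
  unfolding \<phi>_def by measurable

text \<open>The cubic remainder is dominated by exp (2 * |V|) once |x| <= 1, and
  \<open>linear_le_square\<close> with coefficient 2 turns this into exp (1 / t0) * exp (t0 *
  V^2).\<close>

lemma mgf_taylor:
  assumes "\<bar>x\<bar> \<le> 1" shows "\<bar>\<phi> x - 1 - \<sigma>\<^sup>2 * x\<^sup>2 / 2\<bar> \<le> (exp (1 / t0) * K0) * \<bar>x\<bar> ^ 3"
proof -
  let ?r = "\<lambda>\<omega>. exp (x * V 1 \<omega>) - 1 - x * V 1 \<omega> - (x * V 1 \<omega>)\<^sup>2 / 2"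
  let ?b = "\<lambda>\<omega>. (exp (1 / t0) * exp (t0 * (V 1 \<omega>)\<^sup>2)) * \<bar>x\<bar> ^ 3"
  have ir: "integrable M ?r"
    using mgf_int V_int V2_int by (simp add: power_mult_distrib)
  have "expectation ?r = \<phi> x - 1 - \<sigma>\<^sup>2 * x\<^sup>2 / 2"
    using mgf_int V_int V2_int V_mean V_var by (simp add: power_mult_distrib \<phi>_def prob_space)
  moreover have "\<bar>expectation ?r\<bar> \<le> expectation (\<lambda>\<omega>. \<bar>?r \<omega>\<bar>)" by (rule integral_abs_bound)
  moreover have "expectation (\<lambda>\<omega>. \<bar>?r \<omega>\<bar>) \<le> expectation ?b"
  proof (rule integral_mono)
    fix \<omega>
    let ?u = "\<bar>V 1 \<omega>\<bar>"
    have "\<bar>?r \<omega>\<bar> \<le> \<bar>x * V 1 \<omega>\<bar> ^ 3 * exp \<bar>x * V 1 \<omega>\<bar> / 6" by (rule exp_taylor3)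
    also have "\<dots> = (?u ^ 3 / 6) * exp (\<bar>x\<bar> * ?u) * \<bar>x\<bar> ^ 3" by (simp add: abs_mult power_mult_distrib)
    also have "\<dots> \<le> exp ?u * exp ?u * \<bar>x\<bar> ^ 3"
    proof (intro mult_right_mono mult_mono)
      show "?u ^ 3 / 6 \<le> exp ?u" using power_le_exp[of ?u 3] by (simp add: eval_nat_numeral)
      show "exp (\<bar>x\<bar> * ?u) \<le> exp ?u" using assms mult_right_mono[of "\<bar>x\<bar>" 1 ?u] by simp
    qed auto
    also have "exp ?u * exp ?u \<le> exp (1 / t0) * exp (t0 * (V 1 \<omega>)\<^sup>2)"
      using linear_le_square[of 2 ?u] by (simp add: exp_add[symmetric] add.commute)
    finally show "\<bar>?r \<omega>\<bar> \<le> ?b \<omega>" by (simp add: mult_right_mono)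
  qed (use ir V_exp in auto)
  moreover have "expectation ?b = (exp (1 / t0) * K0) * \<bar>x\<bar> ^ 3" by (simp add: K0_def)
  ultimately show ?thesis by linarith
qed

text \<open>For small x the vanishing mean removes the linear term of the expansion. For |x| > 1 the
  constant K0 of the crude bound is absorbed, since ln K0 <= ln K0 * x^2.\<close>

lemma mgf_subgaussian: "\<exists>C>0. \<forall>x. \<phi> x \<le> exp (C * x\<^sup>2)"
proof -
  define D where "D = exp (1 / t0) * K0"
  define C where "C = \<sigma>\<^sup>2 + D + ln K0 + 1 / (4 * t0)"
  have D: "D > 0" using K0_ge by (simp add: D_def)
  have lnK: "ln K0 \<ge> 0" using K0_ge by simp
  have C0: "C > 0" "\<sigma>\<^sup>2 / 2 + D \<le> C" "ln K0 + 1 / (4 * t0) \<le> C"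
    using D lnK \<sigma>_pos t0_pos by (auto simp: C_def add_pos_pos add_pos_nonneg)
  have "\<phi> x \<le> exp (C * x\<^sup>2)" for x
  proof (cases "\<bar>x\<bar> \<le> 1")
    case True
    have "\<bar>x\<bar> ^ 3 \<le> \<bar>x\<bar> ^ 2" using True by (intro power_decreasing) auto
    then have "D * \<bar>x\<bar> ^ 3 \<le> D * x\<^sup>2" using D by simp
    then have "\<phi> x \<le> 1 + (\<sigma>\<^sup>2 / 2 + D) * x\<^sup>2"
      using mgf_taylor[OF True] unfolding D_def[symmetric] by (simp add: algebra_simps)
    also have "\<dots> \<le> 1 + C * x\<^sup>2" using C0 by (intro add_left_mono mult_right_mono) auto
    also have "\<dots> \<le> exp (C * x\<^sup>2)" by simp
    finally show ?thesis .
  next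
    case False
    then have x: "x\<^sup>2 \<ge> 1" by (metis abs_1 linear one_power2 power2_le_iff_abs_le abs_le_square_iff power_one)
    have "\<phi> x \<le> exp (x\<^sup>2 / (4 * t0)) * exp (ln K0)" using mgf_crude[of x] K0_ge by simp
    also have "\<dots> = exp (x\<^sup>2 / (4 * t0) + ln K0 * 1)" by (simp add: exp_add)
    also have "\<dots> \<le> exp (x\<^sup>2 / (4 * t0) + ln K0 * x\<^sup>2)"
      using mult_left_mono[OF x lnK] by simp
    also have "\<dots> = exp ((ln K0 + 1 / (4 * t0)) * x\<^sup>2)" by (simp add: algebra_simps)
    also have "\<dots> \<le> exp (C * x\<^sup>2)" unfolding exp_le_cancel_iff using C0 by (intro mult_right_mono) auto
    finally show ?thesis .
  qed
  with C0 show ?thesis by blast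
qed

text \<open>One fixed sub-Gaussian constant of the noise, so that all later tail bounds can name
  it.\<close>

definition CG :: real where "CG = (SOME C. C > 0 \<and> (\<forall>x. \<phi> x \<le> exp (C * x\<^sup>2)))"

lemma CG: "CG > 0" "\<phi> x \<le> exp (CG * x\<^sup>2)"
  using someI_ex[of "\<lambda>C. C > 0 \<and> (\<forall>x. \<phi> x \<le> exp (C * x\<^sup>2))"] mgf_subgaussian unfolding CG_def by blast+

lemma log_mgf_local:
  assumes "\<epsilon> > 0" shows "\<exists>\<delta>>0. \<forall>x. \<bar>x\<bar> \<le> \<delta> \<longrightarrow> \<bar>ln (\<phi> x) - \<sigma>\<^sup>2 * x\<^sup>2 / 2\<bar> \<le> \<epsilon> * x\<^sup>2"
proof -
  define D where "D = exp (1 / t0) * K0"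
  define B where "B = \<sigma>\<^sup>2 / 2 + D"
  have D: "D > 0" using K0_ge by (simp add: D_def)
  have B: "B > 0" using D \<sigma>_pos by (simp add: B_def add_pos_pos)
  \<comment> \<open>The bound 1 allows the Taylor estimate, 1 / (2 * B) keeps \<phi> x - 1 below 1/2
    so that the logarithm can be expanded, and the last term makes the combined cubic error at most
    \<epsilon> * x^2.\<close>
  define \<delta> where "\<delta> = min 1 (min (1 / (2 * B)) (\<epsilon> / (D + 2 * B\<^sup>2)))"
  have DB: "D + 2 * B\<^sup>2 > 0" using D by (simp add: add_pos_nonneg)
  have \<delta>: "\<delta> > 0" "\<delta> \<le> 1" "\<delta> \<le> 1 / (2 * B)" "\<delta> \<le> \<epsilon> / (D + 2 * B\<^sup>2)"
    using assms B DB by (auto simp: \<delta>_def)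
  have "\<bar>ln (\<phi> x) - \<sigma>\<^sup>2 * x\<^sup>2 / 2\<bar> \<le> \<epsilon> * x\<^sup>2" if x: "\<bar>x\<bar> \<le> \<delta>" for x
  proof -
    define z where "z = \<phi> x - 1"
    have x1: "\<bar>x\<bar> \<le> 1" using x \<delta> by linarith
    have sq: "x\<^sup>2 \<le> \<bar>x\<bar>" using power_decreasing[of 1 2 "\<bar>x\<bar>"] x1 by simp
    have cu: "\<bar>x\<bar> ^ 3 = \<bar>x\<bar> * x\<^sup>2" by (simp add: eval_nat_numeral)
    have T: "\<bar>z - \<sigma>\<^sup>2 * x\<^sup>2 / 2\<bar> \<le> D * (\<bar>x\<bar> * x\<^sup>2)"
      using mgf_taylor[OF x1] by (simp add: z_def D_def cu)
    have "D * (\<bar>x\<bar> * x\<^sup>2) \<le> D * (1 * x\<^sup>2)" using D x1 by (intro mult_left_mono mult_right_mono) auto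
    moreover have "z \<ge> 0" using mgf_ge_1 by (simp add: z_def)
    ultimately have z: "0 \<le> z" "z \<le> B * x\<^sup>2" using T by (auto simp: B_def algebra_simps)
    have "B * x\<^sup>2 \<le> B * \<bar>x\<bar>" using sq B by simp
    also have "\<dots> \<le> B * (1 / (2 * B))" using x \<delta>(3) B by (intro mult_left_mono) auto
    finally have "z \<le> 1 / 2" using z B by simp
    then have l: "\<bar>ln (1 + z) - z\<bar> \<le> 2 * z\<^sup>2" using z(1) by (intro abs_ln_one_plus_x_minus_x_bound) auto
    have "z\<^sup>2 \<le> (B * x\<^sup>2)\<^sup>2" using z by (intro power_mono) auto
    also have "\<dots> = B\<^sup>2 * (x\<^sup>2 * x\<^sup>2)" by (simp add: power2_eq_square)
    also have "\<dots> \<le> B\<^sup>2 * (\<bar>x\<bar> * x\<^sup>2)" using sq by (intro mult_left_mono mult_right_mono) auto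
    finally have z2: "z\<^sup>2 \<le> B\<^sup>2 * (\<bar>x\<bar> * x\<^sup>2)" .
    have "\<bar>ln (\<phi> x) - \<sigma>\<^sup>2 * x\<^sup>2 / 2\<bar> \<le> \<bar>ln (1 + z) - z\<bar> + \<bar>z - \<sigma>\<^sup>2 * x\<^sup>2 / 2\<bar>"
      by (simp add: z_def)
    also have "\<dots> \<le> 2 * (B\<^sup>2 * (\<bar>x\<bar> * x\<^sup>2)) + D * (\<bar>x\<bar> * x\<^sup>2)" using l z2 T by linarith
    also have "\<dots> = (D + 2 * B\<^sup>2) * \<bar>x\<bar> * x\<^sup>2" by (simp add: algebra_simps)
    also have "\<dots> \<le> (D + 2 * B\<^sup>2) * (\<epsilon> / (D + 2 * B\<^sup>2)) * x\<^sup>2"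
      using x \<delta>(4) DB by (intro mult_right_mono mult_left_mono) auto
    also have "\<dots> = \<epsilon> * x\<^sup>2" using DB by simp
    finally show ?thesis .
  qed
  with \<delta>(1) show ?thesis by blast
qed

text \<open>The centred square is sub-exponential. The budget t0 is halved: one half dominates the
  exponent h, the other absorbs the quadratic Taylor factor, whence 8 / t0^2.\<close>

lemma square_mgf:
  "\<exists>C>0. \<forall>h. \<bar>h\<bar> \<le> t0 / 2 \<longrightarrow> (\<integral>\<^sup>+\<omega>. ennreal (exp (h * ((V 1 \<omega>)\<^sup>2 - \<sigma>\<^sup>2))) \<partial>M) \<le> ennreal (exp (C * h\<^sup>2))"
proof -
  define C where "C = (8 / t0\<^sup>2) * exp (t0 * \<sigma>\<^sup>2) * K0"
  have C: "C > 0" using t0_pos K0_ge by (simp add: C_def)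
  have "(\<integral>\<^sup>+\<omega>. ennreal (exp (h * ((V 1 \<omega>)\<^sup>2 - \<sigma>\<^sup>2))) \<partial>M) \<le> ennreal (exp (C * h\<^sup>2))" if h: "\<bar>h\<bar> \<le> t0 / 2" for h
  proof -
    let ?w = "\<lambda>\<omega>. (V 1 \<omega>)\<^sup>2 - \<sigma>\<^sup>2"
    let ?b = "\<lambda>\<omega>. 1 + h * ?w \<omega> + ((8 / t0\<^sup>2) * exp (t0 * \<sigma>\<^sup>2) * exp (t0 * (V 1 \<omega>)\<^sup>2)) * h\<^sup>2"
    have le: "exp (h * ?w \<omega>) \<le> ?b \<omega>" for \<omega>
    proof -
      let ?x = "t0 / 2 * \<bar>?w \<omega>\<bar>"
      have "exp (h * ?w \<omega>) \<le> 1 + h * ?w \<omega> + (h * ?w \<omega>)\<^sup>2 * exp \<bar>h * ?w \<omega>\<bar>"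
        using exp_taylor2[of "h * ?w \<omega>"] by linarith
      also have "(h * ?w \<omega>)\<^sup>2 * exp \<bar>h * ?w \<omega>\<bar> = ((?w \<omega>)\<^sup>2 * exp (\<bar>h\<bar> * \<bar>?w \<omega>\<bar>)) * h\<^sup>2"
        by (simp add: power_mult_distrib abs_mult)
      also have "\<dots> \<le> ((8 / t0\<^sup>2) * exp ?x * exp ?x) * h\<^sup>2"
      proof (intro mult_right_mono mult_mono)
        have "?x ^ 2 \<le> fact 2 * exp ?x" using t0_pos by (intro power_le_exp) auto
        then have "(t0 / 2)\<^sup>2 * (?w \<omega>)\<^sup>2 \<le> 2 * exp ?x"
          unfolding power_mult_distrib power2_abs by simp
        then show "(?w \<omega>)\<^sup>2 \<le> (8 / t0\<^sup>2) * exp ?x" using t0_pos by (simp add: field_simps power2_eq_square)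
        show "exp (\<bar>h\<bar> * \<bar>?w \<omega>\<bar>) \<le> exp ?x" unfolding exp_le_cancel_iff using h by (intro mult_right_mono) auto
      qed auto
      also have "(8 / t0\<^sup>2) * exp ?x * exp ?x = (8 / t0\<^sup>2) * exp (t0 * \<bar>?w \<omega>\<bar>)"
        by (simp flip: exp_add)
      also have "(8 / t0\<^sup>2) * exp (t0 * \<bar>?w \<omega>\<bar>) * h\<^sup>2 \<le> (8 / t0\<^sup>2) * (exp (t0 * \<sigma>\<^sup>2) * exp (t0 * (V 1 \<omega>)\<^sup>2)) * h\<^sup>2"
      proof (intro mult_right_mono mult_left_mono)
        have "\<bar>?w \<omega>\<bar> \<le> \<sigma>\<^sup>2 + (V 1 \<omega>)\<^sup>2" by (simp add: abs_le_iff)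
        then have "t0 * \<bar>?w \<omega>\<bar> \<le> t0 * (\<sigma>\<^sup>2 + (V 1 \<omega>)\<^sup>2)" using t0_pos by (intro mult_left_mono) auto
        then show "exp (t0 * \<bar>?w \<omega>\<bar>) \<le> exp (t0 * \<sigma>\<^sup>2) * exp (t0 * (V 1 \<omega>)\<^sup>2)"
          by (simp add: exp_add[symmetric] distrib_left)
      qed auto
      finally show ?thesis by (simp add: mult.assoc)
    qed
    have ib: "integrable M ?b" using V2_int V_exp by simp
    have i: "integrable M (\<lambda>\<omega>. exp (h * ?w \<omega>))"
      by (rule Bochner_Integration.integrable_bound[OF ib]) (use le in \<open>auto intro: order_trans[OF _ abs_ge_self]\<close>)
    have "expectation (\<lambda>\<omega>. exp (h * ?w \<omega>)) \<le> expectation ?b" by (rule integral_mono[OF i ib le])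
    also have "\<dots> = 1 + C * h\<^sup>2" using V2_int V_exp V_var by (simp add: C_def K0_def prob_space)
    also have "\<dots> \<le> exp (C * h\<^sup>2)" by simp
    finally show ?thesis by (subst nn_integral_eq_integral[OF i]) auto
  qed
  with C show ?thesis by blast
qed

lemma mgf_nn: "(\<integral>\<^sup>+\<omega>. ennreal (exp (h * V 1 \<omega>)) \<partial>M) = ennreal (exp (ln (\<phi> h)))"
proof -
  have "\<phi> h > 0" using mgf_ge_1[of h] by linarith
  then show ?thesis by (subst nn_integral_eq_integral[OF mgf_int]) (auto simp: \<phi>_def)
qed

lemma exp_martingale_eq:
  assumes "\<And>k. H k \<in> borel_measurable (Fil k)"
  shows "(\<integral>\<^sup>+\<omega>. ennreal (exp (\<Sum>k<n. H k \<omega> * V (Suc k) \<omega> - ln (\<phi> (H k \<omega>)))) \<partial>M) = 1"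
  by (rule exp_martingale[OF assms _ _ mgf_nn]) auto

lemma exp_martingale_le:
  assumes "\<And>k. H k \<in> borel_measurable (Fil k)"
  shows "(\<integral>\<^sup>+\<omega>. ennreal (exp (\<Sum>k<n. H k \<omega> * V (Suc k) \<omega> - CG * (H k \<omega>)\<^sup>2)) \<partial>M) \<le> 1"
proof (rule exp_supermartingale[OF assms])
  fix h
  have "ln (\<phi> h) \<le> ln (exp (CG * h\<^sup>2))"
    using CG(2)[of h] mgf_ge_1[of h] by (subst ln_le_cancel_iff) auto
  then show "(\<integral>\<^sup>+\<omega>. ennreal (exp (h * V 1 \<omega>)) \<partial>M) \<le> ennreal (exp (CG * h\<^sup>2))"
    unfolding mgf_nn by (intro ennreal_leI) simp
qed auto

end

section \<open>Tail bounds for autoregressive sums\<close>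

text \<open>Expand (a * A + V) * (b * B + V), the product at the next time, and telescope. The two
  coefficients stay independent so that one identity serves both squares and mixed products.\<close>

lemma ar_sq_identity:
  "(1 - a * b) * (\<Sum>k<n. ar_eps a v k * ar_eps b v k)
    = (\<Sum>k<n. (v (Suc k))\<^sup>2) + a * (\<Sum>k<n. ar_eps a v k * v (Suc k))
      + b * (\<Sum>k<n. ar_eps b v k * v (Suc k)) - ar_eps a v n * ar_eps b v n"
proof (induction n)
  case (Suc n)
  show ?case unfolding sum.lessThan_Suc distrib_left Suc
    by (simp add: algebra_simps power2_eq_square)
qed simp

text \<open>X is an AR(2) process with characteristic roots \<theta> and \<rho>; this is the partial
  fraction decomposition of its transfer function, with the denominator \<theta> - \<rho>
  cleared.\<close>

lemma ar_X_partial_fractions: "(\<theta> - \<rho>) * ar_X \<theta> \<rho> v k = \<theta> * ar_eps \<theta> v k - \<rho> * ar_eps \<rho> v k"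
proof (induction k)
  case (Suc k)
  have "(\<theta> - \<rho>) * ar_X \<theta> \<rho> v (Suc k) = \<theta> * ((\<theta> - \<rho>) * ar_X \<theta> \<rho> v k) + (\<theta> - \<rho>) * ar_eps \<rho> v (Suc k)"
    by (simp add: algebra_simps)
  then show ?case unfolding Suc.IH by (simp add: algebra_simps)
qed simp

text \<open>At a fixed time the process is a sum with deterministic weights, so the energy of the
  weights is a geometric sum and not a random quantity.\<close>

lemma ar_eps_closed: "ar_eps a v m = (\<Sum>k<m. a ^ (m - Suc k) * v (Suc k))"
proof (induction m)
  case (Suc m)
  have "(\<Sum>k<m. a ^ (Suc m - Suc k) * v (Suc k)) = a * (\<Sum>k<m. a ^ (m - Suc k) * v (Suc k))"
    unfolding sum_distrib_left by (intro sum.cong) (auto simp: Suc_diff_Suc simp flip: power_Suc mult.assoc)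
  then show ?case using Suc by simp
qed simp

lemma sum_sq_powers:
  fixes a :: real
  assumes "\<bar>a\<bar> < 1" shows "(\<Sum>k<m. (a ^ (m - Suc k))\<^sup>2) \<le> 1 / (1 - a\<^sup>2)"
proof -
  have a: "a\<^sup>2 < 1" using assms by (simp add: abs_square_less_1)
  have "(\<Sum>k<m. (a ^ (m - Suc k))\<^sup>2) = (\<Sum>k<m. (a\<^sup>2) ^ k)"
    by (subst sum.nat_diff_reindex[symmetric]) (simp add: power_mult[symmetric] mult.commute)
  also have "\<dots> \<le> (\<Sum>k. (a\<^sup>2) ^ k)"
    using a by (intro sum_le_suminf summable_geometric) auto
  also have "\<dots> = 1 / (1 - a\<^sup>2)" using a by (intro suminf_geometric) auto
  finally show ?thesis .
qed

section \<open>Adaptedness and Chernoff bounds for autoregressive sums\<close>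

context iid_subgaussian begin

abbreviation AR :: "real \<Rightarrow> 'a \<Rightarrow> nat \<Rightarrow> real" where
  "AR a \<omega> m \<equiv> ar_eps a (\<lambda>k. V k \<omega>) m"
abbreviation XX :: "real \<Rightarrow> real \<Rightarrow> 'a \<Rightarrow> nat \<Rightarrow> real" where
  "XX \<theta> \<rho> \<omega> m \<equiv> ar_X \<theta> \<rho> (\<lambda>k. V k \<omega>) m"

lemma AR_Fil: "(\<lambda>\<omega>. AR a \<omega> m) \<in> borel_measurable (Fil m)"
proof (induction m)
  case (Suc m)
  have "(\<lambda>\<omega>. AR a \<omega> m) \<in> borel_measurable (Fil (Suc m))" by (rule Fil_mono[OF Suc]) simp
  moreover have "V (Suc m) \<in> borel_measurable (Fil (Suc m))" by (rule V_Fil) auto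
  ultimately show ?case by simp
qed simp

lemma XX_Fil: "(\<lambda>\<omega>. XX \<theta> \<rho> \<omega> m) \<in> borel_measurable (Fil m)"
proof (induction m)
  case (Suc m)
  have "(\<lambda>\<omega>. XX \<theta> \<rho> \<omega> m) \<in> borel_measurable (Fil (Suc m))" by (rule Fil_mono[OF Suc]) simp
  moreover note AR_Fil[of \<rho> "Suc m"]
  ultimately show ?case by (simp del: ar_eps.simps)
qed simp

lemma AR_measurable [measurable]: "(\<lambda>\<omega>. AR a \<omega> m) \<in> borel_measurable M"
  by (rule Fil_measurable[OF AR_Fil])

lemma XX_measurable [measurable]: "(\<lambda>\<omega>. XX a b \<omega> m) \<in> borel_measurable M"
  by (rule Fil_measurable[OF XX_Fil])

lemma pred_measurable:
  assumes "\<And>k. H k \<in> borel_measurable (Fil k)"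
  shows "(H :: nat \<Rightarrow> 'a \<Rightarrow> real) k \<in> borel_measurable M"
  using Fil_measurable assms by blast

text \<open>The sub-Gaussian compensator of t * H is CG * t^2 times the energy, which is at most CG
  * t^2 * B on the event in question. The parameter t is left free, to be optimised by each
  application.\<close>

lemma martingale_tail1:
  assumes H: "\<And>k. H k \<in> borel_measurable (Fil k)" and t: "t \<ge> 0"
  shows "prob {\<omega>\<in>space M. (\<Sum>k<n. H k \<omega> * V (Suc k) \<omega>) \<ge> y \<and> (\<Sum>k<n. (H k \<omega>)\<^sup>2) \<le> B} \<le> exp (- t * y + CG * t\<^sup>2 * B)"
proof -
  note [measurable] = pred_measurable[OF H]
  let ?f = "\<lambda>\<omega>. \<Sum>k<n. (t * H k \<omega>) * V (Suc k) \<omega> - CG * (t * H k \<omega>)\<^sup>2"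
  have Ht: "(\<lambda>\<omega>. t * H k \<omega>) \<in> borel_measurable (Fil k)" for k using H by simp
  have f: "?f \<omega> = t * (\<Sum>k<n. H k \<omega> * V (Suc k) \<omega>) - CG * t\<^sup>2 * (\<Sum>k<n. (H k \<omega>)\<^sup>2)" for \<omega>
    by (simp add: sum_subtractf sum_distrib_left power_mult_distrib mult_ac)
  have "prob {\<omega>\<in>space M. (\<Sum>k<n. H k \<omega> * V (Suc k) \<omega>) \<ge> y \<and> (\<Sum>k<n. (H k \<omega>)\<^sup>2) \<le> B}
     \<le> prob {\<omega>\<in>space M. ?f \<omega> \<ge> t * y - CG * t\<^sup>2 * B}"
  proof (intro finite_measure_mono subsetI)
    fix \<omega> assume w: "\<omega> \<in> {\<omega>\<in>space M. (\<Sum>k<n. H k \<omega> * V (Suc k) \<omega>) \<ge> y \<and> (\<Sum>k<n. (H k \<omega>)\<^sup>2) \<le> B}"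
    then have "t * y \<le> t * (\<Sum>k<n. H k \<omega> * V (Suc k) \<omega>)" "CG * t\<^sup>2 * (\<Sum>k<n. (H k \<omega>)\<^sup>2) \<le> CG * t\<^sup>2 * B"
      using t CG(1) by (auto intro!: mult_left_mono)
    then show "\<omega> \<in> {\<omega>\<in>space M. ?f \<omega> \<ge> t * y - CG * t\<^sup>2 * B}" using w unfolding f by simp
  qed measurable
  also have "\<dots> \<le> 1 * exp (- (t * y - CG * t\<^sup>2 * B))"
    by (rule exp_markov) (use exp_martingale_le[OF Ht, of n] in auto)
  finally show ?thesis by (simp add: algebra_simps)
qed

lemma martingale_tail:
  assumes H: "\<And>k. H k \<in> borel_measurable (Fil k)" and t: "t \<ge> 0"
  shows "prob {\<omega>\<in>space M. \<bar>\<Sum>k<n. H k \<omega> * V (Suc k) \<omega>\<bar> \<ge> y \<and> (\<Sum>k<n. (H k \<omega>)\<^sup>2) \<le> B} \<le> 2 * exp (- t * y + CG * t\<^sup>2 * B)"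
proof -
  note [measurable] = pred_measurable[OF H]
  have H': "(\<lambda>\<omega>. - H k \<omega>) \<in> borel_measurable (Fil k)" for k using H by simp
  let ?S = "\<lambda>s. {\<omega>\<in>space M. s * (\<Sum>k<n. H k \<omega> * V (Suc k) \<omega>) \<ge> y \<and> (\<Sum>k<n. (H k \<omega>)\<^sup>2) \<le> B}"
  have "prob {\<omega>\<in>space M. \<bar>\<Sum>k<n. H k \<omega> * V (Suc k) \<omega>\<bar> \<ge> y \<and> (\<Sum>k<n. (H k \<omega>)\<^sup>2) \<le> B}
     \<le> prob (?S 1 \<union> ?S (- 1))"
    by (intro finite_measure_mono) (auto simp: abs_if split: if_splits)
  also have "\<dots> \<le> prob (?S 1) + prob (?S (- 1))" by (rule measure_Un_le) measurable
  finally show ?thesis using martingale_tail1[OF H t, where n = n and y = y and B = B]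
      martingale_tail1[OF H' t, where n = n and y = y and B = B]
    by (simp add: sum_negf)
qed

lemma AR_tail:
  assumes a: "\<bar>a\<bar> < 1" and y: "y \<ge> 0"
  shows "prob {\<omega>\<in>space M. \<bar>AR a \<omega> m\<bar> \<ge> y} \<le> 2 * exp (- (y\<^sup>2 * (1 - a\<^sup>2) / (4 * CG)))"
proof -
  define q where "q = 1 - a\<^sup>2"
  have q: "q > 0" using a by (simp add: q_def abs_square_less_1)
  \<comment> \<open>This t minimises - t * y + CG * t^2 / q.\<close>
  define t where "t = y * q / (2 * CG)"
  have t: "t \<ge> 0" using y q CG(1) by (simp add: t_def)
  have "prob {\<omega>\<in>space M. \<bar>\<Sum>k<m. a ^ (m - Suc k) * V (Suc k) \<omega>\<bar> \<ge> y \<and> (\<Sum>k<m. (a ^ (m - Suc k))\<^sup>2) \<le> 1 / q}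
    \<le> 2 * exp (- t * y + CG * t\<^sup>2 * (1 / q))"
    by (rule martingale_tail[OF _ t]) simp
  moreover have "- t * y + CG * t\<^sup>2 * (1 / q) = - (y\<^sup>2 * q / (4 * CG))"
    using q CG(1) by (simp add: t_def field_simps power2_eq_square)
  ultimately show ?thesis using sum_sq_powers[OF a, of m]
    by (simp add: ar_eps_closed q_def)
qed

lemma sumV2_tail:
  assumes "\<delta> > 0"
  shows "\<exists>c>0. \<forall>n. prob {\<omega>\<in>space M. \<bar>(\<Sum>k<n. (V (Suc k) \<omega>)\<^sup>2) - real n * \<sigma>\<^sup>2\<bar> \<ge> \<delta> * real n} \<le> 2 * exp (- (c * real n))"
proof -
  obtain C where C: "C > 0" "\<And>h. \<bar>h\<bar> \<le> t0 / 2 \<Longrightarrow> (\<integral>\<^sup>+\<omega>. ennreal (exp (h * ((V 1 \<omega>)\<^sup>2 - \<sigma>\<^sup>2))) \<partial>M) \<le> ennreal (exp (C * h\<^sup>2))"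
    using square_mgf by blast
  \<comment> \<open>The first bound keeps s in the range of \<open>square_mgf\<close>; the second
    keeps the quadratic cost C * s^2 below half of the linear gain s * \<delta>.\<close>
  define s where "s = min (t0 / 2) (\<delta> / (2 * C))"
  have s: "s > 0" "s \<le> t0 / 2" "s \<le> \<delta> / (2 * C)" using t0_pos assms C by (auto simp: s_def)
  have "C * s \<le> C * (\<delta> / (2 * C))" using s C by (intro mult_left_mono) auto
  then have Cs: "C * s \<le> \<delta> / 2" using C by simp
  let ?S = "\<lambda>n \<omega>. (\<Sum>k<n. (V (Suc k) \<omega>)\<^sup>2) - real n * \<sigma>\<^sup>2"
  have one: "prob {\<omega>\<in>space M. u * ?S n \<omega> \<ge> \<delta> * real n} \<le> exp (- (s * \<delta> / 2 * real n))" if "u = 1 \<or> u = - 1" for u n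
  proof -
    let ?f = "\<lambda>\<omega>. \<Sum>k<n. (s * u) * ((V (Suc k) \<omega>)\<^sup>2 - \<sigma>\<^sup>2) - C * (s * u)\<^sup>2"
    \<comment> \<open>A sum of i.i.d. terms is the case of a predictable process that is identically
      zero.\<close>
    have "(\<integral>\<^sup>+\<omega>. ennreal (exp (?f \<omega>)) \<partial>M) \<le> 1"
      by (rule exp_supermartingale[where H = "\<lambda>_ _. 0" and f = "\<lambda>_ v. (s * u) * (v\<^sup>2 - \<sigma>\<^sup>2)" and \<psi> = "\<lambda>_. C * (s * u)\<^sup>2"])
        (use that s C(2)[of "s * u"] in auto)
    then have "prob {\<omega>\<in>space M. ?f \<omega> \<ge> (s * \<delta> - C * s\<^sup>2) * real n} \<le> 1 * exp (- ((s * \<delta> - C * s\<^sup>2) * real n))"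
      by (intro exp_markov) auto
    moreover have iff: "(\<delta> * real n \<le> u * ?S n \<omega>) = (?f \<omega> \<ge> (s * \<delta> - C * s\<^sup>2) * real n)" for \<omega>
    proof -
      have "?f \<omega> = s * (u * ?S n \<omega>) - C * s\<^sup>2 * real n"
        using that by (auto simp: sum_subtractf sum_distrib_left[symmetric] right_diff_distrib power_mult_distrib)
      moreover have "(s * T - C * s\<^sup>2 * real n \<ge> (s * \<delta> - C * s\<^sup>2) * real n) = (s * T \<ge> s * (\<delta> * real n))" for T
        by (simp add: algebra_simps)
      ultimately have "(?f \<omega> \<ge> (s * \<delta> - C * s\<^sup>2) * real n) = (s * (u * ?S n \<omega>) \<ge> s * (\<delta> * real n))"
        by (simp only:)
      then show ?thesis using s(1) by simp
    qed
    moreover have "- ((s * \<delta> - C * s\<^sup>2) * real n) \<le> - (s * \<delta> / 2 * real n)"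
    proof -
      have "C * s\<^sup>2 \<le> s * \<delta> / 2" using mult_left_mono[OF Cs, of s] s(1) by (simp add: power2_eq_square mult_ac)
      then have "s * \<delta> / 2 \<le> s * \<delta> - C * s\<^sup>2" by linarith
      then have "s * \<delta> / 2 * real n \<le> (s * \<delta> - C * s\<^sup>2) * real n" by (rule mult_right_mono) simp
      then show ?thesis by simp
    qed
    then have "exp (- ((s * \<delta> - C * s\<^sup>2) * real n)) \<le> exp (- (s * \<delta> / 2 * real n))" by simp
    ultimately show ?thesis unfolding iff by linarith
  qed
  show ?thesis
  proof (intro exI[of _ "s * \<delta> / 2"] conjI allI)
    fix n
    have "prob {\<omega>\<in>space M. \<bar>?S n \<omega>\<bar> \<ge> \<delta> * real n} \<le> prob ({\<omega>\<in>space M. 1 * ?S n \<omega> \<ge> \<delta> * real n} \<union> {\<omega>\<in>space M. - 1 * ?S n \<omega> \<ge> \<delta> * real n})"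
      by (intro finite_measure_mono) (auto simp: abs_if split: if_splits)
    also have "\<dots> \<le> prob {\<omega>\<in>space M. 1 * ?S n \<omega> \<ge> \<delta> * real n} + prob {\<omega>\<in>space M. - 1 * ?S n \<omega> \<ge> \<delta> * real n}"
      by (rule measure_Un_le) measurable
    finally show "prob {\<omega>\<in>space M. \<bar>?S n \<omega>\<bar> \<ge> \<delta> * real n} \<le> 2 * exp (- (s * \<delta> / 2 * real n))"
      using one[of 1 n] one[of "-1" n] by linarith
  qed (use s assms in auto)
qed

text \<open>The energy \<open>\<Sum>A\<^sup>2\<close> in the compensator is bounded through the martingale itself
  (by \<open>ar_sq_identity\<close>), so choosing \<open>t = \<eta> * (1 - a\<^sup>2)\<close> lets the compensator be absorbed.\<close>

lemma AR_cross_tail: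
  assumes a: "\<bar>a\<bar> < 1" and \<delta>: "\<delta> > 0"
  defines "\<eta> \<equiv> min (1 / (4 * CG)) (\<delta> / (8 * CG * \<sigma>\<^sup>2))"
  shows "prob {\<omega>\<in>space M. \<bar>\<Sum>k<n. AR a \<omega> k * V (Suc k) \<omega>\<bar> \<ge> \<delta> * real n \<and> (\<Sum>k<n. (V (Suc k) \<omega>)\<^sup>2) \<le> 2 * \<sigma>\<^sup>2 * real n}
     \<le> 2 * exp (- (\<eta> * \<delta> / 4 * ((1 - a\<^sup>2) * real n)))"
proof -
  define q where "q = 1 - a\<^sup>2"
  have q: "q > 0" using a by (simp add: q_def abs_square_less_1)
  \<comment> \<open>The compensator costs CG * \<eta> * (2 * \<sigma>^2 * n + 2 * y). The first
    bound on \<eta> makes the y part at most y / 2, the second makes the rest at most \<delta> * n /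
    4; since y >= \<delta> * n, at least \<delta> * n / 4 remains.\<close>
  have \<eta>: "\<eta> > 0" "\<eta> \<le> 1 / (4 * CG)" "\<eta> \<le> \<delta> / (8 * CG * \<sigma>\<^sup>2)"
    using \<delta> CG(1) \<sigma>_pos by (auto simp: \<eta>_def)
  have \<eta>1: "CG * \<eta> \<le> 1 / 4" using mult_left_mono[OF \<eta>(2), of CG] CG(1) by simp
  have "CG * \<sigma>\<^sup>2 * \<eta> \<le> CG * \<sigma>\<^sup>2 * (\<delta> / (8 * CG * \<sigma>\<^sup>2))" using \<eta>(3) CG(1) by (intro mult_left_mono) auto
  then have \<eta>2: "CG * \<sigma>\<^sup>2 * \<eta> \<le> \<delta> / 8" using CG(1) \<sigma>_pos by simp
  let ?N = "\<lambda>\<omega>. \<Sum>k<n. AR a \<omega> k * V (Suc k) \<omega>" and ?W = "\<lambda>\<omega>. \<Sum>k<n. (V (Suc k) \<omega>)\<^sup>2"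
  have one: "prob {\<omega>\<in>space M. u * ?N \<omega> \<ge> \<delta> * real n \<and> ?W \<omega> \<le> 2 * \<sigma>\<^sup>2 * real n} \<le> exp (- (\<eta> * \<delta> / 4 * (q * real n)))"
    if u: "u = 1 \<or> u = - 1" for u
  proof -
    have H: "(\<lambda>\<omega>. (u * \<eta> * q) * AR a \<omega> k) \<in> borel_measurable (Fil k)" for k using AR_Fil by simp
    let ?f = "\<lambda>\<omega>. \<Sum>k<n. ((u * \<eta> * q) * AR a \<omega> k) * V (Suc k) \<omega> - CG * ((u * \<eta> * q) * AR a \<omega> k)\<^sup>2"
    have "prob {\<omega>\<in>space M. u * ?N \<omega> \<ge> \<delta> * real n \<and> ?W \<omega> \<le> 2 * \<sigma>\<^sup>2 * real n} \<le> prob {\<omega>\<in>space M. ?f \<omega> \<ge> \<eta> * \<delta> / 4 * (q * real n)}"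
    proof (intro finite_measure_mono subsetI)
      fix \<omega> assume w: "\<omega> \<in> {\<omega>\<in>space M. u * ?N \<omega> \<ge> \<delta> * real n \<and> ?W \<omega> \<le> 2 * \<sigma>\<^sup>2 * real n}"
      define y where "y = u * ?N \<omega>"
      define Q where "Q = (\<Sum>k<n. (AR a \<omega> k)\<^sup>2)"
      have y: "y \<ge> \<delta> * real n" and W: "?W \<omega> \<le> 2 * \<sigma>\<^sup>2 * real n" using w by (auto simp: y_def)
      have y0: "y \<ge> 0" using y \<delta> by (meson mult_nonneg_nonneg of_nat_0_le_iff less_imp_le order_trans)
      \<comment> \<open>Only |a| < 1 enters, so the energy is bounded through y whichever sign a and
        u have; this covers roots near 1 and near -1 together.\<close>
      have Ny: "a * ?N \<omega> \<le> y"
      proof -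
        have "a * ?N \<omega> \<le> \<bar>a\<bar> * \<bar>?N \<omega>\<bar>" by (metis abs_ge_self abs_mult)
        also have "\<dots> \<le> 1 * \<bar>?N \<omega>\<bar>" using a by (intro mult_right_mono) auto
        also have "\<bar>?N \<omega>\<bar> = \<bar>y\<bar>" using u by (auto simp: y_def)
        finally show ?thesis using y0 by simp
      qed
      have "q * Q = ?W \<omega> + 2 * (a * ?N \<omega>) - (AR a \<omega> n)\<^sup>2"
        using ar_sq_identity[of a a "\<lambda>k. V k \<omega>" n] by (simp add: q_def Q_def power2_eq_square)
      also have "\<dots> \<le> ?W \<omega> + 2 * (a * ?N \<omega>)" by simp
      finally have qQ: "q * Q \<le> 2 * \<sigma>\<^sup>2 * real n + 2 * y" using W Ny by linarith
      have f: "?f \<omega> = \<eta> * q * (y - CG * \<eta> * (q * Q))"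
      proof -
        have "?f \<omega> = (u * \<eta> * q) * ?N \<omega> - CG * (u * \<eta> * q)\<^sup>2 * Q"
          unfolding Q_def by (simp add: sum_subtractf sum_distrib_left power_mult_distrib mult_ac)
        also have "(u * \<eta> * q)\<^sup>2 = (\<eta> * q)\<^sup>2" using u by (auto simp: power_mult_distrib)
        finally show ?thesis by (simp add: y_def algebra_simps power2_eq_square)
      qed
      have "CG * \<eta> * (q * Q) \<le> CG * \<eta> * (2 * \<sigma>\<^sup>2 * real n + 2 * y)"
        using qQ CG(1) \<eta>(1) by (intro mult_left_mono) auto
      also have "\<dots> = 2 * (CG * \<sigma>\<^sup>2 * \<eta>) * real n + 2 * (CG * \<eta>) * y" by (simp add: algebra_simps)
      also have "\<dots> \<le> 2 * (\<delta> / 8) * real n + 2 * (1 / 4) * y"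
        using \<eta>1 \<eta>2 y0 by (intro add_mono mult_right_mono mult_left_mono) auto
      finally have "\<delta> / 4 * real n \<le> y - CG * \<eta> * (q * Q)" using y by linarith
      then have "\<eta> * q * (\<delta> / 4 * real n) \<le> ?f \<omega>" unfolding f
        using \<eta>(1) q by (intro mult_left_mono) auto
      then show "\<omega> \<in> {\<omega>\<in>space M. ?f \<omega> \<ge> \<eta> * \<delta> / 4 * (q * real n)}"
        using w by (simp add: mult_ac)
    qed measurable
    also have "\<dots> \<le> 1 * exp (- (\<eta> * \<delta> / 4 * (q * real n)))"
      by (rule exp_markov) (use exp_martingale_le[OF H, of n] in auto)
    finally show ?thesis by simp
  qed
  let ?S = "\<lambda>u. {\<omega>\<in>space M. u * ?N \<omega> \<ge> \<delta> * real n \<and> ?W \<omega> \<le> 2 * \<sigma>\<^sup>2 * real n}"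
  have "prob {\<omega>\<in>space M. \<bar>?N \<omega>\<bar> \<ge> \<delta> * real n \<and> ?W \<omega> \<le> 2 * \<sigma>\<^sup>2 * real n} \<le> prob (?S 1 \<union> ?S (-1))"
    by (intro finite_measure_mono) (auto simp: abs_if split: if_splits)
  also have "\<dots> \<le> prob (?S 1) + prob (?S (-1))" by (rule measure_Un_le) measurable
  finally show ?thesis using one[of 1] one[of "-1"] unfolding q_def by linarith
qed

end

section \<open>Asymptotics near the unit root\<close>

locale ar_mdp = iid_subgaussian M V \<sigma> t0 + speed M lam
  for M :: "'a measure" and V :: "nat \<Rightarrow> 'a \<Rightarrow> real" and \<sigma> t0 :: real and lam :: "nat \<Rightarrow> real" +
  fixes \<kappa> :: "nat \<Rightarrow> real"
  assumes \<kappa>_pos: "\<And>n. \<kappa> n > 0" and \<kappa>_top: "filterlim \<kappa> at_top sequentially"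
    and n_dominates: "filterlim (\<lambda>n. real n / ((lam n)^6 * (\<kappa> n)^6)) at_top sequentially"
begin

text \<open>The energy of X is of order n * kappa, so this is the size of the martingale deviations
  whose exponential cost is of order lam^2.\<close>

definition scale :: "nat \<Rightarrow> real" where "scale n = lam n * sqrt (real n * \<kappa> n)"

lemma eventually_parameters_large: "\<forall>\<^sub>F n in sequentially. \<kappa> n \<ge> 1 \<and> lam n \<ge> 1 \<and> (lam n)^6 * (\<kappa> n)^6 \<le> real n \<and> n > 0"
proof -
  have "\<forall>\<^sub>F n in sequentially. \<kappa> n \<ge> 1" "\<forall>\<^sub>F n in sequentially. lam n \<ge> 1"
    "\<forall>\<^sub>F n in sequentially. real n / ((lam n)^6 * (\<kappa> n)^6) \<ge> 1"
    using \<kappa>_top lam_top n_dominates by (auto simp: filterlim_at_top)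
  then show ?thesis using eventually_gt_at_top[of 0]
    by eventually_elim (simp add: le_divide_eq split: if_splits)
qed

lemma n_over_speed: "filterlim (\<lambda>n. real n / (\<kappa> n * (lam n)\<^sup>2)) at_top sequentially"
proof (rule filterlim_at_top_mono[OF n_dominates])
  show "\<forall>\<^sub>F n in sequentially. real n / ((lam n)^6 * (\<kappa> n)^6) \<le> real n / (\<kappa> n * (lam n)\<^sup>2)"
    using eventually_parameters_large
  proof eventually_elim
    case (elim n)
    have "\<kappa> n ^ 1 \<le> \<kappa> n ^ 6" "lam n ^ 2 \<le> lam n ^ 6" using elim by (intro power_increasing; simp)+
    then have "\<kappa> n * (lam n)\<^sup>2 \<le> \<kappa> n ^ 6 * lam n ^ 6" using \<kappa>_pos[of n] by (intro mult_mono) auto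
    then show ?case using \<kappa>_pos[of n] lam_pos[of n] by (intro divide_left_mono) (auto simp: mult.commute)
  qed
qed

lemma n_over_speed': "\<forall>\<^sub>F n in sequentially. C * (\<kappa> n * (lam n)\<^sup>2) \<le> real n"
proof -
  have "\<forall>\<^sub>F n in sequentially. C \<le> real n / (\<kappa> n * (lam n)\<^sup>2)" using n_over_speed by (auto simp: filterlim_at_top)
  then show ?thesis
  proof eventually_elim
    case (elim n)
    have "\<kappa> n * (lam n)\<^sup>2 > 0" using \<kappa>_pos[of n] lam_pos[of n] by simp
    then show ?case using elim by (simp add: le_divide_eq)
  qed
qed

lemma scale_le_n: "\<forall>\<^sub>F n in sequentially. scale n \<le> real n"
  using n_over_speed'[of 1]
proof eventually_elim
  case (elim n)
  have "scale n = sqrt ((lam n)\<^sup>2 * (real n * \<kappa> n))" using lam_pos[of n] by (simp add: scale_def real_sqrt_mult)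
  also have "\<dots> = sqrt ((\<kappa> n * (lam n)\<^sup>2) * real n)" by (simp add: mult_ac)
  also have "\<dots> \<le> sqrt (real n * real n)" using elim by (intro real_sqrt_le_mono mult_right_mono) auto
  finally show ?case by simp
qed

lemma scale_pos: "n > 0 \<Longrightarrow> scale n > 0"
  using lam_pos[of n] \<kappa>_pos[of n] by (simp add: scale_def)

text \<open>Equivalent to lam^3 <= sqrt (n * kappa). It converts a maximal bound X^2 <= d * scale
  into smallness of the weights in the exponential martingale.\<close>

lemma scale_le_max: "\<forall>\<^sub>F n in sequentially. scale n * (lam n)\<^sup>2 \<le> real n * \<kappa> n"
  using eventually_parameters_large
proof eventually_elim
  case (elim n)
  have "lam n ^ 6 * 1 \<le> lam n ^ 6 * \<kappa> n ^ 6" using elim by (intro mult_left_mono one_le_power) auto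
  then have "lam n ^ 6 \<le> real n * \<kappa> n" using elim mult_left_mono[of 1 "\<kappa> n" "real n"] by linarith
  then have "(lam n ^ 3)\<^sup>2 \<le> real n * \<kappa> n" by (simp flip: power_mult)
  then have "lam n ^ 3 \<le> sqrt (real n * \<kappa> n)" by (rule real_le_rsqrt)
  then have "lam n ^ 3 * sqrt (real n * \<kappa> n) \<le> sqrt (real n * \<kappa> n) * sqrt (real n * \<kappa> n)"
    using \<kappa>_pos[of n] by (intro mult_right_mono) auto
  also have "sqrt (real n * \<kappa> n) * sqrt (real n * \<kappa> n) = real n * \<kappa> n" using \<kappa>_pos[of n] by simp
  finally show ?case by (simp add: scale_def eval_nat_numeral mult_ac)
qed

text \<open>Half of the exponent pays for the n + 1 time points, half for the required rate K *
  lam^2.\<close>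

lemma union_bound_negligible:
  assumes c: "c > 0"
  shows "\<forall>\<^sub>F n in sequentially. real (n + 1) * exp (- (c * (scale n / \<kappa> n))) \<le> exp (- K * (lam n)\<^sup>2)"
proof -
  have "\<forall>\<^sub>F n in sequentially. ln (real n + 1) \<le> c / 2 * sqrt (sqrt (real n))"
    using c by real_asymp
  then show ?thesis using eventually_parameters_large n_over_speed'[of "(2 * K / c)\<^sup>2"]
  proof eventually_elim
    case (elim n)
    have k: "\<kappa> n > 0" "lam n > 0" "real n > 0" using \<kappa>_pos lam_pos elim by auto
    have sc: "scale n / \<kappa> n = lam n * sqrt (real n / \<kappa> n)"
      using k by (simp add: scale_def real_sqrt_mult real_sqrt_divide field_simps)
    have "(\<bar>2 * K / c\<bar> * lam n)\<^sup>2 \<le> real n / \<kappa> n"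
      unfolding power_mult_distrib power2_abs
      using elim(3) k by (simp add: le_divide_eq mult_ac del: power_mult_distrib)
    then have "\<bar>2 * K / c\<bar> * lam n \<le> sqrt (real n / \<kappa> n)" by (rule real_le_rsqrt)
    moreover have "(2 * K / c) * lam n \<le> \<bar>2 * K / c\<bar> * lam n" using k by (intro mult_right_mono abs_ge_self) auto
    ultimately have "(2 * K / c) * lam n \<le> sqrt (real n / \<kappa> n)" by linarith
    then have "(c / 2 * lam n) * ((2 * K / c) * lam n) \<le> (c / 2 * lam n) * sqrt (real n / \<kappa> n)"
      using c k by (intro mult_left_mono) auto
    moreover have "(c / 2 * lam n) * ((2 * K / c) * lam n) = K * (lam n)\<^sup>2"
      using c by (simp add: power2_eq_square)
    ultimately have 1: "K * (lam n)\<^sup>2 \<le> c / 2 * (scale n / \<kappa> n)" by (simp add: sc mult_ac)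
    \<comment> \<open>Here kappa^2 <= kappa^6 <= lam^6 * kappa^6 <= n, so n / kappa >= sqrt n and
      scale / kappa is at least the fourth root of n, which beats ln (n + 1).\<close>
    have "1 * \<kappa> n ^ 6 \<le> lam n ^ 6 * \<kappa> n ^ 6" using elim by (intro mult_right_mono one_le_power) auto
    moreover have "\<kappa> n ^ 2 \<le> \<kappa> n ^ 6" using elim by (intro power_increasing) auto
    ultimately have "(\<kappa> n)\<^sup>2 \<le> real n" using elim by linarith
    then have "\<kappa> n \<le> sqrt (real n)" by (rule real_le_rsqrt)
    then have "real n / sqrt (real n) \<le> real n / \<kappa> n" using k by (intro divide_left_mono) auto
    then have "sqrt (real n) \<le> real n / \<kappa> n" using k by (simp add: real_div_sqrt)
    then have "sqrt (sqrt (real n)) \<le> sqrt (real n / \<kappa> n)" by simp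
    also have "\<dots> \<le> lam n * sqrt (real n / \<kappa> n)" using elim k mult_right_mono[of 1 "lam n" "sqrt (real n / \<kappa> n)"] by simp
    finally have "c / 2 * sqrt (sqrt (real n)) \<le> c / 2 * (scale n / \<kappa> n)" unfolding sc using c by (intro mult_left_mono) auto
    then have "ln (real n + 1) + K * (lam n)\<^sup>2 \<le> c * (scale n / \<kappa> n)" using 1 elim(1) by linarith
    then have "ln (real n + 1) + - (c * (scale n / \<kappa> n)) \<le> - K * (lam n)\<^sup>2" by simp
    then have "exp (ln (real n + 1) + - (c * (scale n / \<kappa> n))) \<le> exp (- K * (lam n)\<^sup>2)" by (simp only: exp_le_cancel_iff)
    then show ?case unfolding exp_add by (simp add: add.commute)
  qed
qed

section \<open>Limits of autoregressive sums up to negligible events\<close>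

lemma tendsto_LFI:
  fixes f :: "nat \<times> 'a \<Rightarrow> real"
  assumes "\<And>\<delta>. \<delta> > 0 \<Longrightarrow> \<forall>\<^sub>F z in LF K. \<bar>f z - q\<bar> \<le> \<delta>"
  shows "(f \<longlongrightarrow> q) (LF K)"
proof (rule tendstoI)
  fix e :: real assume "e > 0"
  then have "\<forall>\<^sub>F z in LF K. \<bar>f z - q\<bar> \<le> e / 2" by (intro assms) auto
  then show "\<forall>\<^sub>F z in LF K. dist (f z) q < e"
    by (rule eventually_mono) (use \<open>e > 0\<close> in \<open>auto simp: dist_real_def\<close>)
qed

lemma eventually_index_pos: "\<forall>\<^sub>F z in LF K. fst z > 0"
  by (rule eventually_LF_fst) (rule eventually_gt_at_top)

lemma Vsq_lim: "((\<lambda>z. (\<Sum>k<fst z. (V (Suc k) (snd z))\<^sup>2) / real (fst z)) \<longlongrightarrow> \<sigma>\<^sup>2) (LF K)"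
proof (rule tendsto_LFI)
  fix \<delta> :: real assume "\<delta> > 0"
  from sumV2_tail[OF this] obtain c where c: "c > 0"
    "\<And>n. prob {\<omega>\<in>space M. \<bar>(\<Sum>k<n. (V (Suc k) \<omega>)\<^sup>2) - real n * \<sigma>\<^sup>2\<bar> \<ge> \<delta> * real n} \<le> 2 * exp (- (c * real n))" by blast
  have "\<forall>\<^sub>F z in LF K. \<not> (\<bar>(\<Sum>k<fst z. (V (Suc k) (snd z))\<^sup>2) - real (fst z) * \<sigma>\<^sup>2\<bar> \<ge> \<delta> * real (fst z))"
  proof (rule eventually_LFI[where C = 2])
    show "\<forall>\<^sub>F n in sequentially. \<exists>F\<in>sets M. {\<omega>\<in>space M. \<not> \<not> \<bar>(\<Sum>k<fst (n, \<omega>). (V (Suc k) (snd (n, \<omega>)))\<^sup>2) - real (fst (n, \<omega>)) * \<sigma>\<^sup>2\<bar> \<ge> \<delta> * real (fst (n, \<omega>))} \<subseteq> F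
        \<and> prob F \<le> 2 * exp (- K * (lam n)\<^sup>2)"
      using n_over_speed'[of "\<bar>K\<bar> / c"] eventually_parameters_large
    proof eventually_elim
      case (elim n)
      have "1 * (lam n)\<^sup>2 \<le> \<kappa> n * (lam n)\<^sup>2" using elim by (intro mult_right_mono) auto
      then have "\<bar>K\<bar> / c * (lam n)\<^sup>2 \<le> \<bar>K\<bar> / c * (\<kappa> n * (lam n)\<^sup>2)" using c(1) by (intro mult_left_mono) auto
      then have "\<bar>K\<bar> / c * (lam n)\<^sup>2 \<le> real n" using elim(1) by linarith
      then have "\<bar>K\<bar> * (lam n)\<^sup>2 \<le> c * real n" using c(1) by (simp add: field_simps)
      moreover have "K * (lam n)\<^sup>2 \<le> \<bar>K\<bar> * (lam n)\<^sup>2" by (intro mult_right_mono) auto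
      ultimately have "exp (- (c * real n)) \<le> exp (- K * (lam n)\<^sup>2)" by simp
      then have "prob {\<omega>\<in>space M. \<bar>(\<Sum>k<n. (V (Suc k) \<omega>)\<^sup>2) - real n * \<sigma>\<^sup>2\<bar> \<ge> \<delta> * real n} \<le> 2 * exp (- K * (lam n)\<^sup>2)"
        using c(2)[of n] by linarith
      then show ?case by (intro bexI[of _ "{\<omega>\<in>space M. \<bar>(\<Sum>k<n. (V (Suc k) \<omega>)\<^sup>2) - real n * \<sigma>\<^sup>2\<bar> \<ge> \<delta> * real n}"]) auto
    qed
  qed simp
  then show "\<forall>\<^sub>F z in LF K. \<bar>(\<Sum>k<fst z. (V (Suc k) (snd z))\<^sup>2) / real (fst z) - \<sigma>\<^sup>2\<bar> \<le> \<delta>"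
    using eventually_index_pos
  proof eventually_elim
    case (elim z)
    have n: "real (fst z) > 0" using elim by simp
    have "(\<Sum>k<fst z. (V (Suc k) (snd z))\<^sup>2) / real (fst z) - \<sigma>\<^sup>2 = ((\<Sum>k<fst z. (V (Suc k) (snd z))\<^sup>2) - real (fst z) * \<sigma>\<^sup>2) / real (fst z)"
      using n by (simp add: field_simps)
    then show ?case using elim(1) n by (simp add: abs_divide divide_le_eq)
  qed
qed

lemma Vsq_le: "\<forall>\<^sub>F z in LF K. (\<Sum>k<fst z. (V (Suc k) (snd z))\<^sup>2) \<le> 2 * \<sigma>\<^sup>2 * real (fst z)"
proof -
  have "\<sigma>\<^sup>2 < 2 * \<sigma>\<^sup>2" using \<sigma>_pos by simp
  from order_tendstoD(2)[OF Vsq_lim this] show ?thesis using eventually_index_pos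
    by eventually_elim (simp add: field_simps)
qed

text \<open>Formulated with the square, so that it applies to roots approaching 1 and to roots
  approaching -1.\<close>

definition near_unit :: "(nat \<Rightarrow> real) \<Rightarrow> real \<Rightarrow> bool" where
  "near_unit a c \<longleftrightarrow> c > 0 \<and> (\<lambda>n. \<kappa> n * (1 - (a n)\<^sup>2)) \<longlonglongrightarrow> c"

lemma near_unit_ev:
  assumes "near_unit a c" shows "\<forall>\<^sub>F n in sequentially. \<bar>a n\<bar> < 1 \<and> c / 2 \<le> \<kappa> n * (1 - (a n)\<^sup>2)"
proof -
  have c: "c > 0" "c / 2 < c" and l: "(\<lambda>n. \<kappa> n * (1 - (a n)\<^sup>2)) \<longlonglongrightarrow> c" using assms by (auto simp: near_unit_def)
  from order_tendstoD(1)[OF l c(2)] show ?thesis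
  proof eventually_elim
    case (elim n)
    then have "0 < \<kappa> n * (1 - (a n)\<^sup>2)" using c by linarith
    then have "(a n)\<^sup>2 < 1" using \<kappa>_pos[of n] by (simp add: zero_less_mult_iff)
    then show ?case using elim by (simp add: abs_square_less_1)
  qed
qed

text \<open>At each time the variance proxy is of order kappa, so reaching \<delta> * scale in
  square costs a multiple of scale / kappa; this survives a union bound over all times up to
  n.\<close>

lemma AR_small:
  assumes a: "near_unit a c" and \<delta>: "\<delta> > 0"
  shows "\<forall>\<^sub>F z in LF K. \<forall>m\<le>fst z. (AR (a (fst z)) (snd z) m)\<^sup>2 \<le> \<delta> * scale (fst z)"
proof (rule eventually_LFI[where C = 2])
  have c: "c > 0" using a by (simp add: near_unit_def)
  have "\<delta> * (c / 2) / (4 * CG) > 0" using c \<delta> CG(1) by simp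
  from near_unit_ev[OF a] union_bound_negligible[OF this, of K] eventually_parameters_large
  show "\<forall>\<^sub>F n in sequentially. \<exists>F\<in>sets M. {\<omega>\<in>space M. \<not> (\<forall>m\<le>fst (n, \<omega>). (AR (a (fst (n, \<omega>))) (snd (n, \<omega>)) m)\<^sup>2 \<le> \<delta> * scale (fst (n, \<omega>)))} \<subseteq> F
      \<and> prob F \<le> 2 * exp (- K * (lam n)\<^sup>2)"
  proof eventually_elim
    case (elim n)
    define y where "y = sqrt (\<delta> * scale n)"
    have sc: "scale n > 0" using elim scale_pos by auto
    have y: "y \<ge> 0" "y\<^sup>2 = \<delta> * scale n" using sc \<delta> by (auto simp: y_def)
    have "c / 2 / \<kappa> n \<le> 1 - (a n)\<^sup>2" using elim \<kappa>_pos[of n] by (simp add: divide_le_eq mult.commute)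
    then have *: "\<delta> * scale n * (c / 2 / \<kappa> n) / (4 * CG) \<le> \<delta> * scale n * (1 - (a n)\<^sup>2) / (4 * CG)"
      using sc \<delta> CG(1) by (intro divide_right_mono mult_left_mono) auto
    then have ex: "exp (- (y\<^sup>2 * (1 - (a n)\<^sup>2) / (4 * CG))) \<le> exp (- (\<delta> * (c / 2) / (4 * CG) * (scale n / \<kappa> n)))"
    proof -
      have "\<delta> * scale n * (c / 2 / \<kappa> n) / (4 * CG) = \<delta> * (c / 2) / (4 * CG) * (scale n / \<kappa> n)"
        by (simp add: mult_ac)
      then show ?thesis unfolding y exp_le_cancel_iff neg_le_iff_le using * by linarith
    qed
    let ?F = "\<Union>m\<in>{..n}. {\<omega>\<in>space M. \<bar>AR (a n) \<omega> m\<bar> \<ge> y}"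
    have "prob ?F \<le> (\<Sum>m\<in>{..n}. prob {\<omega>\<in>space M. \<bar>AR (a n) \<omega> m\<bar> \<ge> y})"
      by (rule measure_UNION_le) auto
    also have "\<dots> \<le> (\<Sum>m\<in>{..n}. 2 * exp (- (\<delta> * (c / 2) / (4 * CG) * (scale n / \<kappa> n))))"
    proof (rule sum_mono)
      fix m
      have "prob {\<omega>\<in>space M. \<bar>AR (a n) \<omega> m\<bar> \<ge> y} \<le> 2 * exp (- (y\<^sup>2 * (1 - (a n)\<^sup>2) / (4 * CG)))"
        using elim y by (intro AR_tail) auto
      then show "prob {\<omega>\<in>space M. \<bar>AR (a n) \<omega> m\<bar> \<ge> y} \<le> 2 * exp (- (\<delta> * (c / 2) / (4 * CG) * (scale n / \<kappa> n)))"
        using ex by linarith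
    qed
    also have "\<dots> = 2 * (real (n + 1) * exp (- (\<delta> * (c / 2) / (4 * CG) * (scale n / \<kappa> n))))" by simp
    also have "\<dots> \<le> 2 * exp (- K * (lam n)\<^sup>2)" using elim(2) by (intro mult_left_mono) auto
    finally have P: "prob ?F \<le> 2 * exp (- K * (lam n)\<^sup>2)" .
    have "y \<le> \<bar>x\<bar>" if "\<not> x\<^sup>2 \<le> \<delta> * scale n" for x
      using that y real_sqrt_le_mono[of "\<delta> * scale n" "x\<^sup>2"] unfolding y_def by simp
    with P show ?case by (intro bexI[of _ ?F]) auto
  qed
qed simp

lemma AR_end:
  assumes a: "near_unit a c"
  shows "((\<lambda>z. (AR (a (fst z)) (snd z) (fst z))\<^sup>2 / real (fst z)) \<longlongrightarrow> 0) (LF K)"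
proof (rule tendsto_LFI)
  fix \<delta> :: real assume \<delta>: "\<delta> > 0"
  show "\<forall>\<^sub>F z in LF K. \<bar>(AR (a (fst z)) (snd z) (fst z))\<^sup>2 / real (fst z) - 0\<bar> \<le> \<delta>"
    using AR_small[OF a \<delta>, of K] eventually_index_pos eventually_LF_fst[OF scale_le_n]
  proof eventually_elim
    case (elim z)
    have "\<delta> * scale (fst z) \<le> \<delta> * real (fst z)" using elim \<delta> by (intro mult_left_mono) auto
    then have "(AR (a (fst z)) (snd z) (fst z))\<^sup>2 \<le> \<delta> * real (fst z)" using elim(1) by (meson order_refl order_trans)
    then show ?case using elim by (simp add: divide_le_eq)
  qed
qed

text \<open>The tail bound holds jointly with a bound on the sum of the V^2, which
  \<open>Vsq_le\<close> supplies off a negligible event. Its exponent is of order n / kappa, far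
  larger than lam^2.\<close>

lemma AR_cross:
  assumes a: "near_unit a c"
  shows "((\<lambda>z. (\<Sum>k<fst z. AR (a (fst z)) (snd z) k * V (Suc k) (snd z)) / real (fst z)) \<longlongrightarrow> 0) (LF K)"
proof (rule tendsto_LFI)
  fix \<delta> :: real assume \<delta>: "\<delta> > 0"
  have c: "c > 0" using a by (simp add: near_unit_def)
  define \<eta> where "\<eta> = min (1 / (4 * CG)) (\<delta> / (8 * CG * \<sigma>\<^sup>2))"
  have \<eta>: "\<eta> > 0" using \<delta> CG(1) \<sigma>_pos by (simp add: \<eta>_def)
  define b where "b = \<eta> * \<delta> / 4 * (c / 2)"
  have b: "b > 0" using \<eta> \<delta> c by (simp add: b_def)
  let ?N = "\<lambda>n \<omega>. \<Sum>k<n. AR (a n) \<omega> k * V (Suc k) \<omega>"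
  let ?W = "\<lambda>n \<omega>. \<Sum>k<n. (V (Suc k) \<omega>)\<^sup>2"
  have "\<forall>\<^sub>F z in LF K. \<not> (\<bar>?N (fst z) (snd z)\<bar> \<ge> \<delta> * real (fst z) \<and> ?W (fst z) (snd z) \<le> 2 * \<sigma>\<^sup>2 * real (fst z))"
  proof (rule eventually_LFI[where C = 2])
    show "\<forall>\<^sub>F n in sequentially. \<exists>F\<in>sets M. {\<omega>\<in>space M. \<not> \<not> (\<bar>?N (fst (n, \<omega>)) (snd (n, \<omega>))\<bar> \<ge> \<delta> * real (fst (n, \<omega>)) \<and> ?W (fst (n, \<omega>)) (snd (n, \<omega>)) \<le> 2 * \<sigma>\<^sup>2 * real (fst (n, \<omega>)))} \<subseteq> F
        \<and> prob F \<le> 2 * exp (- K * (lam n)\<^sup>2)"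
      using near_unit_ev[OF a] n_over_speed'[of "\<bar>K\<bar> / b"] eventually_parameters_large
    proof eventually_elim
      case (elim n)
      have k: "\<kappa> n > 0" by (rule \<kappa>_pos)
      have "K * (lam n)\<^sup>2 \<le> \<bar>K\<bar> * (lam n)\<^sup>2" by (intro mult_right_mono) auto
      also have "\<dots> = b / \<kappa> n * (\<bar>K\<bar> / b * (\<kappa> n * (lam n)\<^sup>2))" using b k by simp
      also have "\<dots> \<le> b / \<kappa> n * real n" using elim(2) b k by (intro mult_left_mono) auto
      also have "\<dots> = \<eta> * \<delta> / 4 * (c / 2 / \<kappa> n * real n)" by (simp add: b_def)
      also have "\<dots> \<le> \<eta> * \<delta> / 4 * ((1 - (a n)\<^sup>2) * real n)"
        using \<eta> \<delta> elim k by (intro mult_left_mono mult_right_mono) (auto simp: divide_le_eq mult.commute)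
      finally have "exp (- (\<eta> * \<delta> / 4 * ((1 - (a n)\<^sup>2) * real n))) \<le> exp (- K * (lam n)\<^sup>2)" by simp
      moreover have "prob {\<omega>\<in>space M. \<bar>?N n \<omega>\<bar> \<ge> \<delta> * real n \<and> ?W n \<omega> \<le> 2 * \<sigma>\<^sup>2 * real n} \<le> 2 * exp (- (\<eta> * \<delta> / 4 * ((1 - (a n)\<^sup>2) * real n)))"
        unfolding \<eta>_def using elim \<delta> by (intro AR_cross_tail) auto
      ultimately have P: "prob {\<omega>\<in>space M. \<bar>?N n \<omega>\<bar> \<ge> \<delta> * real n \<and> ?W n \<omega> \<le> 2 * \<sigma>\<^sup>2 * real n} \<le> 2 * exp (- K * (lam n)\<^sup>2)"
        by linarith
      then show ?case
        by (intro bexI[of _ "{\<omega>\<in>space M. \<bar>?N n \<omega>\<bar> \<ge> \<delta> * real n \<and> ?W n \<omega> \<le> 2 * \<sigma>\<^sup>2 * real n}"]) auto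
    qed
  qed simp
  then show "\<forall>\<^sub>F z in LF K. \<bar>?N (fst z) (snd z) / real (fst z) - 0\<bar> \<le> \<delta>"
    using Vsq_le eventually_index_pos
    by eventually_elim (auto simp: abs_divide divide_le_eq)
qed

text \<open>Covers both the resonant case \<open>a = b\<close> and the case of opposite unit roots, in which the
  product sum is of smaller order.\<close>

lemma AR_product_sum:
  assumes a: "near_unit a c" and b: "near_unit b d"
    and l: "(\<lambda>n. \<kappa> n * (1 - a n * b n)) \<longlonglongrightarrow> e \<and> e > 0 \<and> L = \<sigma>\<^sup>2 / e
         \<or> (\<lambda>n. 1 - a n * b n) \<longlonglongrightarrow> 2 \<and> L = 0"
  shows "((\<lambda>z. (\<Sum>k<fst z. AR (a (fst z)) (snd z) k * AR (b (fst z)) (snd z) k) / (real (fst z) * \<kappa> (fst z))) \<longlongrightarrow> L) (LF K)"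
proof -
  let ?n = "\<lambda>z :: nat \<times> 'a. real (fst z)"
  let ?W = "\<lambda>z. (\<Sum>k<fst z. (V (Suc k) (snd z))\<^sup>2) / ?n z"
  let ?N = "\<lambda>a z. (\<Sum>k<fst z. AR (a (fst z)) (snd z) k * V (Suc k) (snd z)) / ?n z"
  let ?A = "\<lambda>a z. AR (a (fst z)) (snd z) (fst z)"
  let ?P = "\<lambda>z. \<Sum>k<fst z. AR (a (fst z)) (snd z) k * AR (b (fst z)) (snd z) k"
  have aN: "((\<lambda>z. a (fst z) * ?N a z) \<longlongrightarrow> 0) (LF K)" if "near_unit a c" for a c
  proof (rule Lim_null_comparison)
    show "\<forall>\<^sub>F z in LF K. norm (a (fst z) * ?N a z) \<le> \<bar>?N a z\<bar>"
      using eventually_LF_fst[OF near_unit_ev[OF that]]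
    proof eventually_elim
      case (elim z)
      have "\<bar>a (fst z)\<bar> * \<bar>?N a z\<bar> \<le> 1 * \<bar>?N a z\<bar>" using elim by (intro mult_right_mono) auto
      then show ?case by (simp add: abs_mult)
    qed
    show "((\<lambda>z. \<bar>?N a z\<bar>) \<longlongrightarrow> 0) (LF K)" by (rule tendsto_rabs_zero[OF AR_cross[OF that]])
  qed
  have AB: "((\<lambda>z. ?A a z * ?A b z / ?n z) \<longlongrightarrow> 0) (LF K)"
  proof (rule Lim_null_comparison)
    show "((\<lambda>z. (?A a z)\<^sup>2 / ?n z + (?A b z)\<^sup>2 / ?n z) \<longlongrightarrow> 0) (LF K)"
      using tendsto_add[OF AR_end[OF a] AR_end[OF b]] by simp
    have "\<bar>x * y\<bar> \<le> x\<^sup>2 + y\<^sup>2" for x y :: real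
    proof -
      have "2 * (\<bar>x\<bar> * \<bar>y\<bar>) \<le> x\<^sup>2 + y\<^sup>2" using zero_le_power2[of "\<bar>x\<bar> - \<bar>y\<bar>"] by (simp add: power2_diff)
      moreover have "0 \<le> \<bar>x\<bar> * \<bar>y\<bar>" by simp
      ultimately show ?thesis unfolding abs_mult by linarith
    qed
    then show "\<forall>\<^sub>F z in LF K. norm (?A a z * ?A b z / ?n z) \<le> (?A a z)\<^sup>2 / ?n z + (?A b z)\<^sup>2 / ?n z"
      by (intro always_eventually) (simp add: abs_mult abs_divide divide_right_mono flip: add_divide_distrib)
  qed
  have num: "((\<lambda>z. ?W z + a (fst z) * ?N a z + b (fst z) * ?N b z - ?A a z * ?A b z / ?n z) \<longlongrightarrow> \<sigma>\<^sup>2 + 0 + 0 - 0) (LF K)"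
    by (intro tendsto_intros Vsq_lim aN[OF a] aN[OF b] AB)
  \<comment> \<open>After division by n the right-hand side tends to \<sigma>^2. What remains is to
    divide by 1 - a * b, which is of order 1 / kappa for equal roots and tends to 2 for opposite
    ones.\<close>
  have id: "?P z / ?n z * (1 - a (fst z) * b (fst z)) = ?W z + a (fst z) * ?N a z + b (fst z) * ?N b z - ?A a z * ?A b z / ?n z" for z
    using ar_sq_identity[of "a (fst z)" "b (fst z)" "\<lambda>k. V k (snd z)" "fst z"]
    by (simp add: add_divide_distrib diff_divide_distrib mult.commute)
  show ?thesis using l
  proof (elim disjE conjE)
    assume e: "(\<lambda>n. \<kappa> n * (1 - a n * b n)) \<longlonglongrightarrow> e" "e > 0" "L = \<sigma>\<^sup>2 / e"
    have "((\<lambda>z. (?P z / ?n z * (1 - a (fst z) * b (fst z))) / (\<kappa> (fst z) * (1 - a (fst z) * b (fst z)))) \<longlongrightarrow> (\<sigma>\<^sup>2 + 0 + 0 - 0) / e) (LF K)"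
      unfolding id by (intro tendsto_divide num tendsto_LF_fst[OF e(1)]) (use e in auto)
    moreover have "\<forall>\<^sub>F z in LF K. (?P z / ?n z * (1 - a (fst z) * b (fst z))) / (\<kappa> (fst z) * (1 - a (fst z) * b (fst z))) = ?P z / (?n z * \<kappa> (fst z))"
      using order_tendstoD(1)[OF tendsto_LF_fst[OF e(1)] e(2)]
    proof eventually_elim
      case (elim z)
      then have "1 - a (fst z) * b (fst z) \<noteq> 0" by auto
      then show ?case by simp
    qed
    ultimately show ?thesis unfolding e(3) by (simp add: tendsto_cong)
  next
    assume e: "(\<lambda>n. 1 - a n * b n) \<longlonglongrightarrow> 2" "L = 0"
    have ik: "((\<lambda>z. inverse (\<kappa> (fst z))) \<longlongrightarrow> 0) (LF K)"
      by (rule tendsto_LF_fst) (rule tendsto_inverse_0_at_top[OF \<kappa>_top])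
    have "((\<lambda>z. (?P z / ?n z * (1 - a (fst z) * b (fst z))) / (1 - a (fst z) * b (fst z)) * inverse (\<kappa> (fst z))) \<longlongrightarrow> (\<sigma>\<^sup>2 + 0 + 0 - 0) / 2 * 0) (LF K)"
      unfolding id by (intro tendsto_mult tendsto_divide num tendsto_LF_fst[OF e(1)] ik) auto
    moreover have "\<forall>\<^sub>F z in LF K. (?P z / ?n z * (1 - a (fst z) * b (fst z))) / (1 - a (fst z) * b (fst z)) * inverse (\<kappa> (fst z)) = ?P z / (?n z * \<kappa> (fst z))"
      using order_tendstoD(1)[OF tendsto_LF_fst[OF e(1)], of 0, OF zero_less_numeral]
    proof eventually_elim
      case (elim z)
      then have "1 - a (fst z) * b (fst z) \<noteq> 0" by auto
      from nonzero_mult_div_cancel_right[OF this, of "?P z / ?n z"] show ?case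
        by (simp only:) (simp add: divide_inverse)
    qed
    ultimately show ?thesis unfolding e(2) by (simp add: tendsto_cong)
  qed
qed

end

section \<open>The second-order process in Case II\<close>

lemma tendsto_Bfun_mult_zero:
  fixes f g :: "'b \<Rightarrow> real"
  assumes "Bfun f F" "(g \<longlongrightarrow> 0) F" shows "((\<lambda>x. f x * g x) \<longlongrightarrow> 0) F"
  using bounded_bilinear.Bfun_prod_Zfun[OF bounded_bilinear_mult assms(1)] assms(2)
  by (simp add: tendsto_Zfun_iff)

text \<open>The partial energies are nondecreasing. If the last term is kept, even the full sum is
  at most B; otherwise that term contributes 0 and induction applies.\<close>

lemma stopped_sum_le:
  fixes x :: "nat \<Rightarrow> real"
  assumes "B \<ge> 0"
  shows "(\<Sum>k<n. (if (\<Sum>j\<le>k. (x j)\<^sup>2) \<le> B then x k else 0)\<^sup>2) \<le> B"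
proof -
  let ?t = "\<lambda>k. if (\<Sum>j\<le>k. (x j)\<^sup>2) \<le> B then x k else 0"
  have le: "(\<Sum>k<n. (?t k)\<^sup>2) \<le> (\<Sum>k<n. (x k)\<^sup>2)" for n
    by (intro sum_mono) auto
  show ?thesis
  proof (induction n)
    case (Suc n)
    show ?case
    proof (cases "(\<Sum>j\<le>n. (x j)\<^sup>2) \<le> B")
      case True
      have "(\<Sum>k<Suc n. (?t k)\<^sup>2) \<le> (\<Sum>k<Suc n. (x k)\<^sup>2)" by (rule le)
      then show ?thesis using True by (simp only: lessThan_Suc_atMost)
    qed (use Suc in simp)
  qed (use assms in simp)
qed

locale ar_caseII = ar_mdp +
  fixes \<gamma>1 \<gamma>2 :: real
  assumes \<gamma>1: "\<gamma>1 < 0" and \<gamma>2: "\<gamma>2 < 0"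
begin

definition \<theta> :: "nat \<Rightarrow> real" where "\<theta> n = 1 + \<gamma>1 / \<kappa> n"
definition \<rho> :: "nat \<Rightarrow> real" where "\<rho> n = -1 - \<gamma>2 / \<kappa> n"
definition g :: real where "g = - (\<gamma>1 + \<gamma>2)"
text \<open>A quarter of \<sigma>^2 / (- 2 * \<gamma>1) + \<sigma>^2 / (- 2 * \<gamma>2): the
  limiting energies of the two AR(1) components, divided by the limit of (\<theta> - \<rho>)^2,
  which is 4.\<close>

definition s :: real where "s = \<sigma>\<^sup>2 * g / (8 * \<gamma>1 * \<gamma>2)"

lemma g_pos: "g > 0" and s_pos: "s > 0"
proof -
  show "g > 0" using \<gamma>1 \<gamma>2 by (simp add: g_def)
  then show "s > 0" using \<gamma>1 \<gamma>2 \<sigma>_pos by (simp add: s_def mult_neg_neg)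
qed

lemma inv_\<kappa>: "(\<lambda>n. c / \<kappa> n) \<longlonglongrightarrow> 0"
  using tendsto_mult_right_zero[OF tendsto_inverse_0_at_top[OF \<kappa>_top], of c] by (simp add: divide_inverse)

lemma \<theta>_lim: "\<theta> \<longlonglongrightarrow> 1" and \<rho>_lim: "\<rho> \<longlonglongrightarrow> -1"
proof -
  have "(\<lambda>n. 1 + \<gamma>1 / \<kappa> n) \<longlonglongrightarrow> 1 + 0" "(\<lambda>n. -1 - \<gamma>2 / \<kappa> n) \<longlonglongrightarrow> -1 - 0"
    by (intro tendsto_intros inv_\<kappa>)+
  then show "\<theta> \<longlonglongrightarrow> 1" "\<rho> \<longlonglongrightarrow> -1" by (simp_all add: \<theta>_def[abs_def] \<rho>_def[abs_def])
qed

lemma near_\<theta>: "near_unit \<theta> (- 2 * \<gamma>1)" and near_\<rho>: "near_unit \<rho> (- 2 * \<gamma>2)"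
proof -
  have e: "\<kappa> n * (1 - (\<theta> n)\<^sup>2) = - 2 * \<gamma>1 - \<gamma>1\<^sup>2 / \<kappa> n" "\<kappa> n * (1 - (\<rho> n)\<^sup>2) = - 2 * \<gamma>2 - \<gamma>2\<^sup>2 / \<kappa> n" for n
    using \<kappa>_pos[of n] by (simp_all add: \<theta>_def \<rho>_def field_simps power2_eq_square)
  have "(\<lambda>n. - 2 * \<gamma>1 - \<gamma>1\<^sup>2 / \<kappa> n) \<longlonglongrightarrow> - 2 * \<gamma>1 - 0" "(\<lambda>n. - 2 * \<gamma>2 - \<gamma>2\<^sup>2 / \<kappa> n) \<longlonglongrightarrow> - 2 * \<gamma>2 - 0"
    by (intro tendsto_intros inv_\<kappa>)+
  then show "near_unit \<theta> (- 2 * \<gamma>1)" "near_unit \<rho> (- 2 * \<gamma>2)"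
    unfolding near_unit_def e using \<gamma>1 \<gamma>2 by auto
qed

text \<open>The leading terms of 1 + \<theta> * \<rho> cancel, so this factor is of order 1 / kappa;
  dividing by it amplifies the estimation error.\<close>

lemma \<kappa>p_lim: "(\<lambda>n. \<kappa> n * (1 + \<theta> n * \<rho> n)) \<longlonglongrightarrow> g"
proof -
  have e: "\<kappa> n * (1 + \<theta> n * \<rho> n) = g - \<gamma>1 * \<gamma>2 / \<kappa> n" for n
    using \<kappa>_pos[of n] by (simp add: \<theta>_def \<rho>_def g_def field_simps)
  have "(\<lambda>n. g - \<gamma>1 * \<gamma>2 / \<kappa> n) \<longlonglongrightarrow> g - 0" by (intro tendsto_intros inv_\<kappa>)
  then show ?thesis unfolding e by simp
qed

lemma p_lim: "(\<lambda>n. \<theta> n * \<rho> n) \<longlonglongrightarrow> - 1"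
  using tendsto_mult[OF \<theta>_lim \<rho>_lim] by simp

section \<open>Energy, maxima and martingale transforms of the process X\<close>

abbreviation X :: "nat \<times> 'a \<Rightarrow> nat \<Rightarrow> real" where
  "X z k \<equiv> XX (\<theta> (fst z)) (\<rho> (fst z)) (snd z) k"

abbreviation SX :: "nat \<times> 'a \<Rightarrow> real" where
  "SX z \<equiv> \<Sum>k<fst z. (X z k)\<^sup>2"

lemma \<theta>\<rho>_gap: "\<forall>\<^sub>F n in sequentially. \<theta> n - \<rho> n \<ge> 1"
proof -
  have "(\<lambda>n. \<theta> n - \<rho> n) \<longlonglongrightarrow> 1 - (- 1)" by (intro tendsto_diff \<theta>_lim \<rho>_lim)
  from order_tendstoD(1)[OF this, of 1] show ?thesis by (auto elim: eventually_mono)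
qed

text \<open>Squaring the partial fraction formula leaves the two component energies and a mixed sum;
  the latter vanishes in the limit because the roots have opposite signs.\<close>

lemma SX_lim: "((\<lambda>z. SX z / (real (fst z) * \<kappa> (fst z))) \<longlongrightarrow> s) (LF K)"
proof -
  let ?A = "\<lambda>a b z. (\<Sum>k<fst z. AR (a (fst z)) (snd z) k * AR (b (fst z)) (snd z) k) / (real (fst z) * \<kappa> (fst z))"
  have A: "(?A \<theta> \<theta> \<longlongrightarrow> \<sigma>\<^sup>2 / (- 2 * \<gamma>1)) (LF K)"
    by (rule AR_product_sum[OF near_\<theta> near_\<theta>])
      (use near_\<theta> in \<open>auto simp: near_unit_def power2_eq_square\<close>)
  have B: "(?A \<rho> \<rho> \<longlongrightarrow> \<sigma>\<^sup>2 / (- 2 * \<gamma>2)) (LF K)"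
    by (rule AR_product_sum[OF near_\<rho> near_\<rho>])
      (use near_\<rho> in \<open>auto simp: near_unit_def power2_eq_square\<close>)
  have C: "(?A \<theta> \<rho> \<longlongrightarrow> 0) (LF K)"
  proof (rule AR_product_sum[OF near_\<theta> near_\<rho>])
    have "(\<lambda>n. 1 - \<theta> n * \<rho> n) \<longlonglongrightarrow> 1 - (- 1)" by (intro tendsto_diff tendsto_const p_lim)
    \<comment> \<open>The second alternative is the one that holds; the value 1 in the first merely
      instantiates its free limit.\<close>
    then show "(\<lambda>n. \<kappa> n * (1 - \<theta> n * \<rho> n)) \<longlonglongrightarrow> 1 \<and> (1::real) > 0 \<and> 0 = \<sigma>\<^sup>2 / 1
         \<or> (\<lambda>n. 1 - \<theta> n * \<rho> n) \<longlonglongrightarrow> 2 \<and> 0 = (0::real)" by simp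
  qed
  note t = tendsto_LF_fst[OF \<theta>_lim, of K] and r = tendsto_LF_fst[OF \<rho>_lim, of K]
  have "((\<lambda>z. ((\<theta> (fst z))\<^sup>2 * ?A \<theta> \<theta> z - 2 * (\<theta> (fst z) * \<rho> (fst z)) * ?A \<theta> \<rho> z + (\<rho> (fst z))\<^sup>2 * ?A \<rho> \<rho> z) / (\<theta> (fst z) - \<rho> (fst z))\<^sup>2)
    \<longlongrightarrow> (1\<^sup>2 * (\<sigma>\<^sup>2 / (- 2 * \<gamma>1)) - 2 * (1 * (- 1)) * 0 + (- 1)\<^sup>2 * (\<sigma>\<^sup>2 / (- 2 * \<gamma>2))) / (1 - (- 1))\<^sup>2) (LF K)"
    by (intro tendsto_intros A B C t r) simp
  also have "(1\<^sup>2 * (\<sigma>\<^sup>2 / (- 2 * \<gamma>1)) - 2 * (1 * (- 1)) * 0 + (- 1)\<^sup>2 * (\<sigma>\<^sup>2 / (- 2 * \<gamma>2))) / (1 - (- 1))\<^sup>2 = s"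
    using \<gamma>1 \<gamma>2 by (simp add: s_def g_def field_simps)
  finally show ?thesis
  proof (rule Lim_transform_eventually)
    show "\<forall>\<^sub>F z in LF K. ((\<theta> (fst z))\<^sup>2 * ?A \<theta> \<theta> z - 2 * (\<theta> (fst z) * \<rho> (fst z)) * ?A \<theta> \<rho> z + (\<rho> (fst z))\<^sup>2 * ?A \<rho> \<rho> z) / (\<theta> (fst z) - \<rho> (fst z))\<^sup>2
       = SX z / (real (fst z) * \<kappa> (fst z))"
      using eventually_LF_fst[OF \<theta>\<rho>_gap]
    proof eventually_elim
      case (elim z)
      let ?t = "\<theta> (fst z)" and ?r = "\<rho> (fst z)"
      let ?S = "\<lambda>a b. \<Sum>k<fst z. AR a (snd z) k * AR b (snd z) k"
      have "(?t - ?r)\<^sup>2 * SX z = (\<Sum>k<fst z. ((?t - ?r) * X z k)\<^sup>2)"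
        by (simp add: sum_distrib_left power_mult_distrib)
      also have "\<dots> = (\<Sum>k<fst z. ?t\<^sup>2 * (AR ?t (snd z) k * AR ?t (snd z) k) - 2 * (?t * ?r) * (AR ?t (snd z) k * AR ?r (snd z) k) + ?r\<^sup>2 * (AR ?r (snd z) k * AR ?r (snd z) k))"
        unfolding ar_X_partial_fractions by (intro sum.cong) (auto simp: power2_eq_square algebra_simps)
      also have "\<dots> = ?t\<^sup>2 * ?S ?t ?t - 2 * (?t * ?r) * ?S ?t ?r + ?r\<^sup>2 * ?S ?r ?r"
        by (simp only: sum.distrib sum_subtractf sum_distrib_left)
      finally have e: "(?t - ?r)\<^sup>2 * SX z = ?t\<^sup>2 * ?S ?t ?t - 2 * (?t * ?r) * ?S ?t ?r + ?r\<^sup>2 * ?S ?r ?r" .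
      have "SX z / (real (fst z) * \<kappa> (fst z)) = ((?t - ?r)\<^sup>2 * SX z) / (real (fst z) * \<kappa> (fst z)) / (?t - ?r)\<^sup>2"
        using elim by simp
      then show ?case unfolding e by (simp only: add_divide_distrib diff_divide_distrib times_divide_eq_right)
    qed
  qed
qed

lemma X_small:
  assumes "\<delta> > 0" shows "\<forall>\<^sub>F z in LF K. \<forall>m\<le>fst z. (X z m)\<^sup>2 \<le> \<delta> * scale (fst z)"
proof -
  \<comment> \<open>Once \<theta> - \<rho> >= 1 and both roots are below 1 in modulus, X^2 <= 2 *
    A^2 + 2 * B^2, and four quarters of \<delta> result.\<close>
  have d: "\<delta> / 4 > 0" using assms by simp
  show ?thesis
    using AR_small[OF near_\<theta> d, of K] AR_small[OF near_\<rho> d, of K] eventually_LF_fst[OF \<theta>\<rho>_gap]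
      eventually_LF_fst[OF near_unit_ev[OF near_\<theta>]] eventually_LF_fst[OF near_unit_ev[OF near_\<rho>]]
  proof eventually_elim
    case (elim z)
    let ?t = "\<theta> (fst z)" and ?r = "\<rho> (fst z)"
    show ?case
    proof (intro allI impI)
      fix m assume m: "m \<le> fst z"
      let ?a = "AR ?t (snd z) m" and ?b = "AR ?r (snd z) m"
      have "1 * \<bar>X z m\<bar> \<le> \<bar>?t - ?r\<bar> * \<bar>X z m\<bar>" using elim by (intro mult_right_mono) auto
      also have "\<dots> = \<bar>?t * ?a - ?r * ?b\<bar>" unfolding abs_mult[symmetric] ar_X_partial_fractions ..
      also have "\<dots> \<le> \<bar>?t\<bar> * \<bar>?a\<bar> + \<bar>?r\<bar> * \<bar>?b\<bar>" unfolding abs_mult[symmetric] by (rule abs_triangle_ineq4)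
      also have "\<dots> \<le> 1 * \<bar>?a\<bar> + 1 * \<bar>?b\<bar>" using elim by (intro add_mono mult_right_mono) auto
      finally have "\<bar>X z m\<bar>\<^sup>2 \<le> (\<bar>?a\<bar> + \<bar>?b\<bar>)\<^sup>2" by (intro power_mono) auto
      also have "\<dots> \<le> 2 * ?a\<^sup>2 + 2 * ?b\<^sup>2"
        using zero_le_power2[of "\<bar>?a\<bar> - \<bar>?b\<bar>"] by (simp add: power2_diff power2_sum)
      also have "\<dots> \<le> 2 * (\<delta> / 4 * scale (fst z)) + 2 * (\<delta> / 4 * scale (fst z))"
        using elim m by (intro add_mono mult_left_mono) auto
      finally show "(X z m)\<^sup>2 \<le> \<delta> * scale (fst z)" by simp
    qed
  qed
qed

lemma X_end: assumes "\<And>n. i n \<le> n" "\<And>n. j n \<le> n"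
  shows "((\<lambda>z. X z (i (fst z)) * X z (j (fst z)) / scale (fst z)) \<longlongrightarrow> 0) (LF K)"
proof (rule tendsto_LFI)
  fix \<delta> :: real assume "\<delta> > 0"
  from X_small[OF this, of K] eventually_index_pos
  show "\<forall>\<^sub>F z in LF K. \<bar>X z (i (fst z)) * X z (j (fst z)) / scale (fst z) - 0\<bar> \<le> \<delta>"
  proof eventually_elim
    case (elim z)
    let ?x = "X z (i (fst z))" and ?y = "X z (j (fst z))"
    have s: "scale (fst z) > 0" using elim scale_pos by auto
    have "2 * (\<bar>?x\<bar> * \<bar>?y\<bar>) \<le> ?x\<^sup>2 + ?y\<^sup>2" using zero_le_power2[of "\<bar>?x\<bar> - \<bar>?y\<bar>"] by (simp add: power2_diff)
    moreover have "?x\<^sup>2 \<le> \<delta> * scale (fst z)" "?y\<^sup>2 \<le> \<delta> * scale (fst z)" using elim assms by auto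
    ultimately have "\<bar>?x * ?y\<bar> \<le> \<delta> * scale (fst z)" unfolding abs_mult by linarith
    then show ?case using s by (simp add: abs_divide divide_le_eq del: abs_mult)
  qed
qed

text \<open>Twice the limit is the stopping level, so that stopping is inactive off a negligible
  event.\<close>

lemma SX_le: "\<forall>\<^sub>F z in LF K. SX z \<le> 2 * s * (real (fst z) * \<kappa> (fst z))"
proof -
  have "s < 2 * s" using s_pos by simp
  from order_tendstoD(2)[OF SX_lim this] show ?thesis using eventually_index_pos
  proof eventually_elim
    case (elim z)
    have "real (fst z) * \<kappa> (fst z) > 0" using elim \<kappa>_pos by simp
    then show ?case using elim by (simp add: divide_less_eq)
  qed
qed

lemma martingale_Bfun:
  assumes H: "\<And>n k. H n k \<in> borel_measurable (Fil k)"
    and le: "\<And>n \<omega>. (\<Sum>k<n. (H n k \<omega>)\<^sup>2) \<le> SX (n, \<omega>)"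
  shows "Bfun (\<lambda>z. (\<Sum>k<fst z. H (fst z) k (snd z) * V (Suc k) (snd z)) / scale (fst z)) (LF K)"
proof -
  note [measurable] = pred_measurable[OF H]
  \<comment> \<open>With t = lam / sqrt (n * kappa) the exponent of the tail bound is (2 * s * CG -
    R) * lam^2, which this choice makes - |K| * lam^2.\<close>
  define R where "R = \<bar>K\<bar> + 2 * s * CG"
  let ?N = "\<lambda>n \<omega>. \<Sum>k<n. H n k \<omega> * V (Suc k) \<omega>"
  let ?Q = "\<lambda>n \<omega>. \<Sum>k<n. (H n k \<omega>)\<^sup>2"
  have "\<forall>\<^sub>F z in LF K. \<not> (\<bar>?N (fst z) (snd z)\<bar> \<ge> R * scale (fst z) \<and> ?Q (fst z) (snd z) \<le> 2 * s * (real (fst z) * \<kappa> (fst z)))"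
  proof (rule eventually_LFI[where C = 2])
    show "\<forall>\<^sub>F n in sequentially. \<exists>F\<in>sets M. {\<omega>\<in>space M. \<not> \<not> (\<bar>?N (fst (n, \<omega>)) (snd (n, \<omega>))\<bar> \<ge> R * scale (fst (n, \<omega>)) \<and> ?Q (fst (n, \<omega>)) (snd (n, \<omega>)) \<le> 2 * s * (real (fst (n, \<omega>)) * \<kappa> (fst (n, \<omega>))))} \<subseteq> F
        \<and> prob F \<le> 2 * exp (- K * (lam n)\<^sup>2)"
      using eventually_parameters_large
    proof eventually_elim
      case (elim n)
      have nk: "real n * \<kappa> n > 0" using elim \<kappa>_pos by simp
      define t where "t = lam n / sqrt (real n * \<kappa> n)"
      have t: "t \<ge> 0" using lam_pos[of n] nk by (simp add: t_def)
      have "prob {\<omega>\<in>space M. \<bar>?N n \<omega>\<bar> \<ge> R * scale n \<and> ?Q n \<omega> \<le> 2 * s * (real n * \<kappa> n)}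
         \<le> 2 * exp (- t * (R * scale n) + CG * t\<^sup>2 * (2 * s * (real n * \<kappa> n)))"
        by (rule martingale_tail[OF H t])
      also have "- t * (R * scale n) + CG * t\<^sup>2 * (2 * s * (real n * \<kappa> n)) = - \<bar>K\<bar> * (lam n)\<^sup>2"
      proof -
        define r where "r = sqrt (real n * \<kappa> n)"
        have r: "r > 0" "r\<^sup>2 = real n * \<kappa> n" using nk unfolding r_def by (auto simp del: real_sqrt_mult)
        have 1: "t * scale n = (lam n)\<^sup>2" using r(1) unfolding t_def scale_def r_def[symmetric]
          by (simp add: power2_eq_square)
        have 2: "t\<^sup>2 * (real n * \<kappa> n) = (lam n)\<^sup>2" using r(1) unfolding t_def r(2)[symmetric] r_def[symmetric]
          by (simp add: power_divide)
        have "- t * (R * scale n) + CG * t\<^sup>2 * (2 * s * (real n * \<kappa> n)) = - R * (t * scale n) + 2 * s * CG * (t\<^sup>2 * (real n * \<kappa> n))"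
          by (simp add: mult_ac)
        then show ?thesis unfolding 1 2 R_def by (simp add: algebra_simps)
      qed
      also have "exp (- \<bar>K\<bar> * (lam n)\<^sup>2) \<le> exp (- K * (lam n)\<^sup>2)"
        unfolding exp_le_cancel_iff by (intro mult_right_mono) auto
      finally show ?case
        by (intro bexI[of _ "{\<omega>\<in>space M. \<bar>?N n \<omega>\<bar> \<ge> R * scale n \<and> ?Q n \<omega> \<le> 2 * s * (real n * \<kappa> n)}"]) auto
    qed
  qed simp
  then have "\<forall>\<^sub>F z in LF K. norm (?N (fst z) (snd z) / scale (fst z)) \<le> R"
    using SX_le eventually_index_pos
  proof eventually_elim
    case (elim z)
    have "?Q (fst z) (snd z) \<le> 2 * s * (real (fst z) * \<kappa> (fst z))"
      using le[of "fst z" "snd z"] elim(2) by simp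
    with elim(1) have "\<bar>?N (fst z) (snd z)\<bar> \<le> R * scale (fst z)" by linarith
    then show ?case using scale_pos[OF elim(3)] by (simp add: abs_divide divide_le_eq)
  qed
  then show ?thesis by (rule BfunI)
qed

text \<open>The test at k looks at X up to time k inclusive, so the stopped weight is still known
  before \<open>V (Suc k)\<close> is drawn, and its energy is bounded for every outcome.\<close>

definition trunc :: "nat \<Rightarrow> nat \<Rightarrow> 'a \<Rightarrow> real" where
  "trunc n k \<omega> = (if (\<Sum>j\<le>k. (X (n, \<omega>) j)\<^sup>2) \<le> 2 * s * (real n * \<kappa> n) then X (n, \<omega>) k else 0)"

lemma trunc_Fil: "trunc n k \<in> borel_measurable (Fil k)"
proof -
  have x: "(\<lambda>\<omega>. X (n, \<omega>) j) \<in> borel_measurable (Fil k)" if "j \<le> k" for j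
    using Fil_mono[OF XX_Fil that] by simp
  then have [measurable]: "(\<lambda>\<omega>. \<Sum>j\<le>k. (X (n, \<omega>) j)\<^sup>2) \<in> borel_measurable (Fil k)"
    by (intro borel_measurable_sum borel_measurable_power) auto
  have "{\<omega>\<in>space (Fil k). (\<Sum>j\<le>k. (X (n, \<omega>) j)\<^sup>2) \<le> 2 * s * (real n * \<kappa> n)} \<in> sets (Fil k)"
    by measurable
  then show ?thesis unfolding trunc_def[abs_def] using x[of k]
    by (intro measurable_If) auto
qed

lemma trunc_sum: "(\<Sum>k<n. (trunc n k \<omega>)\<^sup>2) \<le> 2 * s * (real n * \<kappa> n)"
  unfolding trunc_def using s_pos \<kappa>_pos[of n] by (intro stopped_sum_le) auto

lemma trunc_eq: "SX (n, \<omega>) \<le> 2 * s * (real n * \<kappa> n) \<Longrightarrow> k < n \<Longrightarrow> trunc n k \<omega> = X (n, \<omega>) k"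
proof -
  assume a: "SX (n, \<omega>) \<le> 2 * s * (real n * \<kappa> n)" "k < n"
  have "(\<Sum>j\<le>k. (X (n, \<omega>) j)\<^sup>2) \<le> SX (n, \<omega>)" using a(2) by (intro sum_mono2) auto
  then show ?thesis using a by (simp add: trunc_def)
qed

text \<open>The proxy for the rescaled estimation error: the martingale is stopped and the random
  denominator replaced by its limit g * s.\<close>

definition W :: "nat \<Rightarrow> 'a \<Rightarrow> real" where
  "W n \<omega> = (\<Sum>k<n. trunc n k \<omega> * V (Suc k) \<omega>) / (scale n * (g * s))"

text \<open>From the limiting compensator \<sigma>^2 / 2 * u^2 * s / (g * s)^2, read as v * u^2 /
  2.\<close>

definition v where "v = \<sigma>\<^sup>2 / (g\<^sup>2 * s)"

text \<open>\<open>mgf_limit\<close> is applied with the exact compensator, the sum of ln \<phi>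
  over the stopped weights, and with q = v * u^2 / 2.\<close>

lemma W_mgf:
  shows W_measurable [measurable]: "W n \<in> borel_measurable M"
    and W_int: "\<forall>\<^sub>F n in sequentially. integrable M (\<lambda>\<omega>. exp (u * (lam n)\<^sup>2 * W n \<omega>))"
    and W_lim: "(\<lambda>n. ln (expectation (\<lambda>\<omega>. exp (u * (lam n)\<^sup>2 * W n \<omega>))) / (lam n)\<^sup>2) \<longlonglongrightarrow> v * u\<^sup>2 / 2"
proof -
  note [measurable] = pred_measurable[OF trunc_Fil]
  show [measurable]: "W n \<in> borel_measurable M" for n unfolding W_def[abs_def] by measurable
  define \<tau> where "\<tau> n = u * (lam n)\<^sup>2 / (scale n * (g * s))" for n
  define H where "H n k \<omega> = \<tau> n * trunc n k \<omega>" for n k \<omega>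
  define U where "U = u\<^sup>2 / (g * s)\<^sup>2"
  have gs: "g * s > 0" using g_pos s_pos by simp
  have U: "U \<ge> 0" by (simp add: U_def)
  have HF: "H n k \<in> borel_measurable (Fil k)" for n k
    unfolding H_def[abs_def] using trunc_Fil by simp
  note [measurable] = pred_measurable[OF HF]
  \<comment> \<open>The normalisation is such that an energy of order n * kappa contributes a
    compensator of order lam^2, the speed.\<close>
  have \<tau>2: "(\<tau> n)\<^sup>2 * (real n * \<kappa> n) = U * (lam n)\<^sup>2" if "n > 0" for n
  proof -
    have "(scale n)\<^sup>2 = (lam n)\<^sup>2 * (real n * \<kappa> n)" using \<kappa>_pos[of n] by (simp add: scale_def power_mult_distrib)
    then have "(\<tau> n)\<^sup>2 = u\<^sup>2 * ((lam n)\<^sup>2)\<^sup>2 / ((lam n)\<^sup>2 * (real n * \<kappa> n) * (g * s)\<^sup>2)"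
      by (simp add: \<tau>_def power_divide power_mult_distrib)
    moreover have e: "u\<^sup>2 * l\<^sup>2 / (l * N * G) * N = u\<^sup>2 / G * l" if "l > 0" "N > 0" for l N G :: real
      using that by (simp add: power2_eq_square)
    moreover have "(lam n)\<^sup>2 > 0" "real n * \<kappa> n > 0" using that \<kappa>_pos[of n] lam_pos[of n] by auto
    ultimately show ?thesis unfolding U_def by (simp only: e)
  qed
  have Y: "u * (lam n)\<^sup>2 * W n \<omega> = (\<Sum>k<n. H n k \<omega> * V (Suc k) \<omega>)" for n \<omega>
    by (simp add: W_def H_def \<tau>_def sum_distrib_left sum_divide_distrib mult.assoc)
  let ?\<Lambda> = "\<lambda>n \<omega>. \<Sum>k<n. ln (\<phi> (H n k \<omega>))"
  have HQ: "(\<Sum>k<n. (H n k \<omega>)\<^sup>2) \<le> 2 * s * U * (lam n)\<^sup>2" if "n > 0" for n \<omega>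
  proof -
    have "(\<Sum>k<n. (H n k \<omega>)\<^sup>2) = (\<tau> n)\<^sup>2 * (\<Sum>k<n. (trunc n k \<omega>)\<^sup>2)"
      by (simp add: H_def power_mult_distrib sum_distrib_left)
    also have "\<dots> \<le> (\<tau> n)\<^sup>2 * (2 * s * (real n * \<kappa> n))" by (intro mult_left_mono trunc_sum) auto
    also have "\<dots> = 2 * s * ((\<tau> n)\<^sup>2 * (real n * \<kappa> n))" by (simp add: mult_ac)
    finally show ?thesis unfolding \<tau>2[OF that] by (simp add: mult_ac)
  qed
  have m1: "(\<lambda>\<omega>. u * (lam n)\<^sup>2 * W n \<omega>) \<in> borel_measurable M" for n by measurable
  have m2: "?\<Lambda> n \<in> borel_measurable M" for n
    by (intro borel_measurable_sum borel_measurable_ln measurable_compose[OF pred_measurable[OF HF] mgf_measurable])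
  have mart: "(\<integral>\<^sup>+\<omega>. ennreal (exp (u * (lam n)\<^sup>2 * W n \<omega> - ?\<Lambda> n \<omega>)) \<partial>M) = 1" for n
    unfolding Y sum_subtractf[symmetric] by (rule exp_martingale_eq[OF HF])
  have nn: "?\<Lambda> n \<omega> \<ge> 0" for n \<omega>
    by (intro sum_nonneg) (use mgf_ge_1 in simp)
  \<comment> \<open>Doubling the weights multiplies the energy by 4, and the stopped energy is at
    most 2 * s * U * lam^2 for every outcome; together with CG this gives the constant 8 * CG * s *
    U.\<close>
  have sq: "\<forall>\<^sub>F n in sequentially. (\<integral>\<^sup>+\<omega>. ennreal (exp (2 * (u * (lam n)\<^sup>2 * W n \<omega>))) \<partial>M) \<le> ennreal (exp ((8 * CG * s * U) * (lam n)\<^sup>2))"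
    using eventually_gt_at_top[of 0]
  proof eventually_elim
    case (elim n)
    have H2F: "(\<lambda>\<omega>. 2 * H n k \<omega>) \<in> borel_measurable (Fil k)" for k using HF by simp
    let ?f = "\<lambda>\<omega>. \<Sum>k<n. (2 * H n k \<omega>) * V (Suc k) \<omega> - CG * (2 * H n k \<omega>)\<^sup>2"
    let ?c = "(8 * CG * s * U) * (lam n)\<^sup>2"
    have le: "2 * (u * (lam n)\<^sup>2 * W n \<omega>) \<le> ?f \<omega> + ?c" for \<omega>
    proof -
      have "?f \<omega> = 2 * (u * (lam n)\<^sup>2 * W n \<omega>) - 4 * CG * (\<Sum>k<n. (H n k \<omega>)\<^sup>2)"
        unfolding Y by (simp add: sum_subtractf sum_distrib_left power_mult_distrib mult_ac)
      moreover have "4 * CG * (\<Sum>k<n. (H n k \<omega>)\<^sup>2) \<le> 4 * CG * (2 * s * U * (lam n)\<^sup>2)"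
        using HQ[OF elim] CG(1) by (intro mult_left_mono) auto
      ultimately show ?thesis by simp
    qed
    have "(\<integral>\<^sup>+\<omega>. ennreal (exp (2 * (u * (lam n)\<^sup>2 * W n \<omega>))) \<partial>M) \<le> (\<integral>\<^sup>+\<omega>. ennreal (exp ?c) * ennreal (exp (?f \<omega>)) \<partial>M)"
    proof (rule nn_integral_mono)
      fix \<omega>
      have "exp (2 * (u * (lam n)\<^sup>2 * W n \<omega>)) \<le> exp (?c + ?f \<omega>)" using le[of \<omega>] by simp
      then show "ennreal (exp (2 * (u * (lam n)\<^sup>2 * W n \<omega>))) \<le> ennreal (exp ?c) * ennreal (exp (?f \<omega>))"
        unfolding exp_add by (simp add: ennreal_mult[symmetric] ennreal_leI)
    qed
    also have "\<dots> = ennreal (exp ?c) * (\<integral>\<^sup>+\<omega>. ennreal (exp (?f \<omega>)) \<partial>M)"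
      by (rule nn_integral_cmult) measurable
    also have "\<dots> \<le> ennreal (exp ?c) * 1" by (intro mult_left_mono exp_martingale_le[OF H2F]) auto
    finally show ?case by simp
  qed
  have lim: "((\<lambda>z. ?\<Lambda> (fst z) (snd z) / (lam (fst z))\<^sup>2) \<longlongrightarrow> v * u\<^sup>2 / 2) (LF K)" for K
  proof -
    let ?q = "\<lambda>z. U * (SX z / (real (fst z) * \<kappa> (fst z)))"
    have A: "((\<lambda>z. \<sigma>\<^sup>2 / 2 * ?q z) \<longlongrightarrow> \<sigma>\<^sup>2 / 2 * (U * s)) (LF K)"
      by (intro tendsto_intros SX_lim)
    have B: "\<sigma>\<^sup>2 / 2 * (U * s) = v * u\<^sup>2 / 2" using g_pos s_pos by (simp add: U_def v_def power2_eq_square)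
    have C: "((\<lambda>z. ?\<Lambda> (fst z) (snd z) / (lam (fst z))\<^sup>2 - \<sigma>\<^sup>2 / 2 * ?q z) \<longlongrightarrow> 0) (LF K)"
    proof (rule tendsto_LFI)
      fix \<delta> :: real assume \<delta>: "\<delta> > 0"
      \<comment> \<open>The summand 1 here, and in d below, covers u = 0, where U vanishes.\<close>
      define \<epsilon> where "\<epsilon> = \<delta> / (2 * s * U + 1)"
      have su: "2 * s * U + 1 > 0" using s_pos U by (simp add: add_nonneg_pos)
      have \<epsilon>: "\<epsilon> > 0" "\<epsilon> * (2 * s * U) \<le> \<delta>"
        using \<delta> su by (auto simp: \<epsilon>_def divide_le_eq field_simps)
      obtain \<eta> where \<eta>: "\<eta> > 0" "\<And>x. \<bar>x\<bar> \<le> \<eta> \<Longrightarrow> \<bar>ln (\<phi> x) - \<sigma>\<^sup>2 * x\<^sup>2 / 2\<bar> \<le> \<epsilon> * x\<^sup>2"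
        using log_mgf_local[OF \<epsilon>(1)] by blast
      define d where "d = \<eta>\<^sup>2 / (U + 1)"
      have d: "d > 0" "U * d \<le> \<eta>\<^sup>2" using \<eta>(1) U by (auto simp: d_def divide_le_eq field_simps)
      show "\<forall>\<^sub>F z in LF K. \<bar>?\<Lambda> (fst z) (snd z) / (lam (fst z))\<^sup>2 - \<sigma>\<^sup>2 / 2 * ?q z - 0\<bar> \<le> \<delta>"
        using X_small[OF d(1), of K] SX_le eventually_index_pos eventually_LF_fst[OF scale_le_max]
      proof eventually_elim
        case (elim z)
        obtain n \<omega> where z: "z = (n, \<omega>)" by force
        have n: "n > 0" using elim z by simp
        have nk: "real n * \<kappa> n > 0" using n \<kappa>_pos by simp
        have l: "(lam n)\<^sup>2 > 0" using lam_pos[of n] by simp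
        have tr: "trunc n k \<omega> = X z k" if "k < n" for k
          using elim(2) trunc_eq[of n \<omega> k] that unfolding z by simp
        \<comment> \<open>The maximal bound on X, multiplied by \<tau>^2, is at most U * d * scale *
          lam^2 / (n * kappa), and \<open>scale_le_max\<close> bounds this by \<eta>^2: every weight
          lies in the range of the local expansion of ln \<phi>.\<close>
        have small: "\<bar>H n k \<omega>\<bar> \<le> \<eta>" if "k < n" for k
        proof -
          have "(H n k \<omega>)\<^sup>2 * (real n * \<kappa> n) = (X z k)\<^sup>2 * ((\<tau> n)\<^sup>2 * (real n * \<kappa> n))"
            by (simp add: H_def tr[OF that] power_mult_distrib mult_ac)
          also have "\<dots> = (X z k)\<^sup>2 * (U * (lam n)\<^sup>2)" unfolding \<tau>2[OF n] ..
          also have "\<dots> \<le> (d * scale n) * (U * (lam n)\<^sup>2)"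
            using elim(1) that z U by (intro mult_right_mono) auto
          also have "\<dots> = (U * d) * (scale n * (lam n)\<^sup>2)" by (simp add: mult_ac)
          also have "\<dots> \<le> \<eta>\<^sup>2 * (real n * \<kappa> n)"
            by (rule mult_mono) (use d elim(4) z U scale_pos[OF n] in auto)
          finally have "(H n k \<omega>)\<^sup>2 \<le> \<eta>\<^sup>2" using nk by (rule mult_right_le_imp_le)
          then have "\<bar>H n k \<omega>\<bar> \<le> \<bar>\<eta>\<bar>" by (simp only: abs_le_square_iff)
          then show ?thesis using \<eta>(1) by simp
        qed
        have Q: "(\<Sum>k<n. (H n k \<omega>)\<^sup>2) = ?q z * (lam n)\<^sup>2"
        proof -
          have "(\<Sum>k<n. (H n k \<omega>)\<^sup>2) = (\<tau> n)\<^sup>2 * SX z"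
            unfolding sum_distrib_left z by (auto simp: H_def tr power_mult_distrib z intro!: sum.cong)
          also have "\<dots> = ((\<tau> n)\<^sup>2 * (real n * \<kappa> n)) * (SX z / (real n * \<kappa> n))" using n \<kappa>_pos[of n] by simp
          finally show ?thesis unfolding \<tau>2[OF n] by (simp add: z mult_ac)
        qed
        have "\<bar>?\<Lambda> n \<omega> - \<sigma>\<^sup>2 / 2 * (?q z * (lam n)\<^sup>2)\<bar> = \<bar>\<Sum>k<n. ln (\<phi> (H n k \<omega>)) - \<sigma>\<^sup>2 * (H n k \<omega>)\<^sup>2 / 2\<bar>"
          unfolding Q[symmetric] by (simp add: sum_subtractf sum_distrib_left)
        also have "\<dots> \<le> (\<Sum>k<n. \<bar>ln (\<phi> (H n k \<omega>)) - \<sigma>\<^sup>2 * (H n k \<omega>)\<^sup>2 / 2\<bar>)" by (rule sum_abs)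
        also have "\<dots> \<le> (\<Sum>k<n. \<epsilon> * (H n k \<omega>)\<^sup>2)" using \<eta>(2) small by (intro sum_mono) auto
        also have "\<dots> \<le> \<epsilon> * (2 * s * U * (lam n)\<^sup>2)"
          unfolding sum_distrib_left[symmetric] using \<epsilon>(1) HQ[OF n] by (intro mult_left_mono) auto
        also have "\<dots> \<le> \<delta> * (lam n)\<^sup>2" unfolding mult.assoc[symmetric] using \<epsilon>(2)
          by (intro mult_right_mono) (auto simp: mult.assoc)
        finally have b: "\<bar>?\<Lambda> n \<omega> - \<sigma>\<^sup>2 / 2 * (?q z * (lam n)\<^sup>2)\<bar> \<le> \<delta> * (lam n)\<^sup>2" .
        have "?\<Lambda> n \<omega> / (lam n)\<^sup>2 - \<sigma>\<^sup>2 / 2 * ?q z = (?\<Lambda> n \<omega> - \<sigma>\<^sup>2 / 2 * (?q z * (lam n)\<^sup>2)) / (lam n)\<^sup>2"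
          using l by (simp add: diff_divide_distrib)
        then have "\<bar>?\<Lambda> n \<omega> / (lam n)\<^sup>2 - \<sigma>\<^sup>2 / 2 * ?q z\<bar> \<le> \<delta>"
          using b l by (simp only: abs_divide) (simp add: divide_le_eq)
        then show ?case by (simp add: z)
      qed
    qed
    show ?thesis using tendsto_add[OF C A] by (simp only: diff_add_cancel add_0 B)
  qed
  from mgf_limit[OF m1 m2 mart nn sq lim]
  show "\<forall>\<^sub>F n in sequentially. integrable M (\<lambda>\<omega>. exp (u * (lam n)\<^sup>2 * W n \<omega>))"
    "(\<lambda>n. ln (expectation (\<lambda>\<omega>. exp (u * (lam n)\<^sup>2 * W n \<omega>))) / (lam n)\<^sup>2) \<longlonglongrightarrow> v * u\<^sup>2 / 2"
    by auto
qed

end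

section \<open>The two estimators\<close>

text \<open>At n = 0 truncated subtraction reads the missing value of index -1 as X_0 = 0, which is
  the correct convention.\<close>

lemma ar_X_recursion:
  "ar_X \<theta> \<rho> v (Suc n) = (\<theta> + \<rho>) * ar_X \<theta> \<rho> v n - \<theta> * \<rho> * ar_X \<theta> \<rho> v (n - 1) + v (Suc n)"
  by (cases n) (simp_all add: algebra_simps)

lemma sum_atLeast1: "(\<Sum>k=1..n. f k) = (\<Sum>k<n. f (Suc k))" for f :: "nat \<Rightarrow> real"
  by (simp add: sum.atLeast1_atMost_eq lessThan_atLeast0)

text \<open>Multiply the recursion by x n and sum. The two lag-one sums agree up to one boundary
  product, so they combine with coefficient 1 + p; this is where the centring a / (1 + p) comes
  from.\<close>

lemma theta_numerator:
  fixes x :: "nat \<Rightarrow> real"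
  assumes r: "\<And>n. x (Suc n) = a * x n - p * x (n - 1) + e n" and "x 0 = 0"
  shows "(1 + p) * (\<Sum>k<n. x (Suc k) * x k) = a * (\<Sum>k<n. (x k)\<^sup>2) + (\<Sum>k<n. x k * e k) + p * (x n * x (n - 1))"
proof (induction n)
  case (Suc n)
  have "x (Suc n) * x n = (a * x n - p * x (n - 1) + e n) * x n" using r by simp
  then show ?case unfolding sum.lessThan_Suc distrib_left Suc
    by (simp add: algebra_simps power2_eq_square)
qed (use assms in simp)

text \<open>The term k = 0 contains x (0 - 1) = x 0 = 0, so shifting the index only loses a term at
  the upper end.\<close>

lemma sum_shift_prod:
  fixes x :: "nat \<Rightarrow> real"
  assumes "x 0 = 0"
  shows "(\<Sum>k<n. x k * x (k - 1)) = (\<Sum>k<n. x (Suc k) * x k) - x n * x (n - 1)"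
    and "(\<Sum>k<n. (x (k - 1))\<^sup>2) = (\<Sum>k<n. (x k)\<^sup>2) - (x (n - 1))\<^sup>2"
  by (induction n) (use assms in auto)

text \<open>The residual products involve sums of lag 0, 1 and 2. T * S is the lag-one sum by
  definition of least squares, and the recursion eliminates the lag-two sum at the price of the
  martingale N.\<close>

lemma rho_sums:
  fixes x :: "nat \<Rightarrow> real"
  assumes r: "\<And>n. x (Suc n) = a * x n - p * x (n - 1) + e n" and x0: "x 0 = 0"
    and T: "T * S = (\<Sum>k<n. x (Suc k) * x k)" and S: "S = (\<Sum>k<n. (x k)\<^sup>2)"
  defines "b \<equiv> x n * x (n - 1)" and "c \<equiv> (x (n - 1))\<^sup>2" and "N \<equiv> \<Sum>k<n. x (k - 1) * e k"
  shows "(\<Sum>k<n. (x (Suc k) - T * x k) * (x k - T * x (k - 1)))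
      = T * ((T\<^sup>2 - a * T + p) * S - (T - a) * b - p * c - N)"
    and "(\<Sum>k<n. (x k - T * x (k - 1))\<^sup>2) = (1 - T\<^sup>2) * S + 2 * T * b - T\<^sup>2 * c"
proof -
  have P': "(\<Sum>k<n. x k * x (k - 1)) = T * S - b" unfolding T b_def by (rule sum_shift_prod(1)[of x, OF x0])
  have S': "(\<Sum>k<n. (x (k - 1))\<^sup>2) = S - c" unfolding S c_def by (rule sum_shift_prod(2)[of x, OF x0])
  have R: "(\<Sum>k<n. x (Suc k) * x (k - 1)) = a * (T * S - b) - p * (S - c) + N"
    unfolding P'[symmetric] S'[symmetric] N_def r
    by (simp add: sum_distrib_left sum.distrib[symmetric] sum_subtractf[symmetric] algebra_simps power2_eq_square)
  have "(\<Sum>k<n. (x (Suc k) - T * x k) * (x k - T * x (k - 1)))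
     = (\<Sum>k<n. x (Suc k) * x k) - T * (\<Sum>k<n. x (Suc k) * x (k - 1)) - T * (\<Sum>k<n. (x k)\<^sup>2) + T\<^sup>2 * (\<Sum>k<n. x k * x (k - 1))"
    by (simp add: sum_distrib_left sum.distrib[symmetric] sum_subtractf[symmetric] algebra_simps power2_eq_square)
  then show "(\<Sum>k<n. (x (Suc k) - T * x k) * (x k - T * x (k - 1)))
      = T * ((T\<^sup>2 - a * T + p) * S - (T - a) * b - p * c - N)"
    unfolding R P' T[symmetric] S[symmetric] by (simp add: algebra_simps power2_eq_square)
  have "(\<Sum>k<n. (x k - T * x (k - 1))\<^sup>2)
     = (\<Sum>k<n. (x k)\<^sup>2) - 2 * T * (\<Sum>k<n. x k * x (k - 1)) + T\<^sup>2 * (\<Sum>k<n. (x (k - 1))\<^sup>2)"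
    by (simp add: sum_distrib_left sum.distrib[symmetric] sum_subtractf[symmetric] algebra_simps power2_eq_square)
  then show "(\<Sum>k<n. (x k - T * x (k - 1))\<^sup>2) = (1 - T\<^sup>2) * S + 2 * T * b - T\<^sup>2 * c"
    unfolding S' P' S[symmetric] by (simp add: algebra_simps power2_eq_square)
qed

text \<open>Without boundary and martingale terms the numerator is T * (T^2 - a * T + p) - p * Ts *
  (1 - T^2), which equals (T - Ts) * (T^2 + p) when a = Ts * (1 + p). The error of T is thus an
  exact factor.\<close>

lemma rho_error_algebra:
  fixes T Ts p S b c N :: real
  assumes S: "S \<noteq> 0" and D: "(1 - T\<^sup>2) + 2 * T * (b / S) - T\<^sup>2 * (c / S) \<noteq> 0" and a: "a = Ts * (1 + p)"
  shows "T * ((T\<^sup>2 - a * T + p) * S - (T - a) * b - p * c - N) / ((1 - T\<^sup>2) * S + 2 * T * b - T\<^sup>2 * c) - p * Ts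
    = ((T - Ts) * (T\<^sup>2 + p) - T * (T - a) * (b / S) - T * p * (c / S) - T * (N / S)
       - p * Ts * (2 * T * (b / S) - T\<^sup>2 * (c / S))) / ((1 - T\<^sup>2) + 2 * T * (b / S) - T\<^sup>2 * (c / S))"
proof -
  define b' c' N' where "b' = b / S" and "c' = c / S" and "N' = N / S"
  have e: "b = b' * S" "c = c' * S" "N = N' * S" using S by (simp_all add: b'_def c'_def N'_def)
  have D': "(1 - T\<^sup>2) + 2 * T * b' - T\<^sup>2 * c' \<noteq> 0" using D by (simp add: b'_def c'_def)
  have "T * ((T\<^sup>2 - a * T + p) * S - (T - a) * b - p * c - N) = (T * ((T\<^sup>2 - a * T + p) - (T - a) * b' - p * c' - N')) * S"
    unfolding e by (simp add: algebra_simps)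
  note n1 = this
  have n2: "(1 - T\<^sup>2) * S + 2 * T * b - T\<^sup>2 * c = ((1 - T\<^sup>2) + 2 * T * b' - T\<^sup>2 * c') * S"
    unfolding e by (simp add: algebra_simps)
  have "T * ((T\<^sup>2 - a * T + p) * S - (T - a) * b - p * c - N) / ((1 - T\<^sup>2) * S + 2 * T * b - T\<^sup>2 * c)
    = (T * ((T\<^sup>2 - a * T + p) - (T - a) * b' - p * c' - N')) / ((1 - T\<^sup>2) + 2 * T * b' - T\<^sup>2 * c')"
    unfolding n1 n2 by (rule nonzero_mult_divide_mult_cancel_right[OF S])
  then have "T * ((T\<^sup>2 - a * T + p) * S - (T - a) * b - p * c - N) / ((1 - T\<^sup>2) * S + 2 * T * b - T\<^sup>2 * c) - p * Ts
    = (T * ((T\<^sup>2 - a * T + p) - (T - a) * b' - p * c' - N') - p * Ts * ((1 - T\<^sup>2) + 2 * T * b' - T\<^sup>2 * c')) / ((1 - T\<^sup>2) + 2 * T * b' - T\<^sup>2 * c')"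
    using D' by (simp add: diff_divide_distrib)
  also have "T * ((T\<^sup>2 - a * T + p) - (T - a) * b' - p * c' - N') - p * Ts * ((1 - T\<^sup>2) + 2 * T * b' - T\<^sup>2 * c')
    = (T - Ts) * (T\<^sup>2 + p) - T * (T - a) * b' - T * p * c' - T * N' - p * Ts * (2 * T * b' - T\<^sup>2 * c')"
    unfolding a by (simp add: algebra_simps power2_eq_square)
  finally show ?thesis unfolding b'_def c'_def N'_def .
qed

section \<open>Normalised estimation errors in terms of martingales and boundary terms\<close>

context ar_caseII begin

definition L :: "nat \<Rightarrow> real" where "L n = sqrt (real n / \<kappa> n) / lam n"
definition p :: "nat \<Rightarrow> real" where "p n = \<theta> n * \<rho> n"
definition Ts :: "nat \<Rightarrow> real" where "Ts n = theta_star (\<theta> n) (\<rho> n)"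
definition That :: "nat \<times> 'a \<Rightarrow> real" where
  "That z = theta_hat (\<theta> (fst z)) (\<rho> (fst z)) (\<lambda>k. V k (snd z)) (fst z)"
definition Rhat :: "nat \<times> 'a \<Rightarrow> real" where
  "Rhat z = rho_hat (\<theta> (fst z)) (\<rho> (fst z)) (\<lambda>k. V k (snd z)) (fst z)"

abbreviation MX :: "nat \<times> 'a \<Rightarrow> real" where "MX z \<equiv> \<Sum>k<fst z. X z k * V (Suc k) (snd z)"
abbreviation NX :: "nat \<times> 'a \<Rightarrow> real" where "NX z \<equiv> \<Sum>k<fst z. X z (k - 1) * V (Suc k) (snd z)"
abbreviation bX :: "nat \<times> 'a \<Rightarrow> real" where "bX z \<equiv> X z (fst z) * X z (fst z - 1)"
abbreviation cX :: "nat \<times> 'a \<Rightarrow> real" where "cX z \<equiv> (X z (fst z - 1))\<^sup>2"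
abbreviation SN :: "nat \<times> 'a \<Rightarrow> real" where "SN z \<equiv> SX z / (real (fst z) * \<kappa> (fst z))"

lemma X_rec: "X z (Suc n) = (\<theta> (fst z) + \<rho> (fst z)) * X z n - p (fst z) * X z (n - 1) + V (Suc n) (snd z)"
  unfolding p_def by (rule ar_X_recursion)

lemma That_eq: "That z = (\<Sum>k<fst z. X z (Suc k) * X z k) / SX z"
  by (simp only: That_def theta_hat_def sum_atLeast1 diff_Suc_1)

text \<open>The formula also gives the prescribed value 0 at k = 0, since X_0 = 0 and 0 - 1 =
  0.\<close>

lemma eps_hat_eq: "eps_hat (\<theta> (fst z)) (\<rho> (fst z)) (\<lambda>k. V k (snd z)) (fst z) k = X z k - That z * X z (k - 1)"
  by (simp add: eps_hat_def That_def)

lemma Rhat_eq: "Rhat z = (\<Sum>k<fst z. (X z (Suc k) - That z * X z k) * (X z k - That z * X z (k - 1)))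
    / (\<Sum>k<fst z. (X z k - That z * X z (k - 1))\<^sup>2)"
  by (simp only: Rhat_def rho_hat_def eps_hat_eq sum_atLeast1 diff_Suc_1)

lemma p_lim': "p \<longlonglongrightarrow> -1" using p_lim by (simp add: p_def[abs_def])

lemma \<kappa>p_ev: "\<forall>\<^sub>F n in sequentially. 1 + p n > 0"
  using order_tendstoD(1)[OF \<kappa>p_lim g_pos]
  unfolding p_def by eventually_elim (rule zero_less_mult_pos[OF _ \<kappa>_pos])

definition r where "r = (\<gamma>1 - \<gamma>2) / g"

text \<open>The difference (\<gamma>1 + \<gamma>2)^2 - (\<gamma>1 - \<gamma>2)^2 is 4 * \<gamma>1 *
  \<gamma>2 > 0. It keeps 1 - r^2, the limiting normalised residual energy, away from 0.\<close>

lemma r_sq: "1 - r\<^sup>2 > 0"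
proof -
  have "g\<^sup>2 - (\<gamma>1 - \<gamma>2)\<^sup>2 = 4 * (\<gamma>1 * \<gamma>2)" by (simp add: g_def power2_eq_square algebra_simps)
  moreover have "\<gamma>1 * \<gamma>2 > 0" using \<gamma>1 \<gamma>2 by (simp add: mult_neg_neg)
  ultimately have "(\<gamma>1 - \<gamma>2)\<^sup>2 < g\<^sup>2" by linarith
  then show ?thesis using g_pos by (simp add: r_def power_divide)
qed

text \<open>Numerator and denominator of the centring are both of order 1 / kappa; multiplying both
  by kappa gives a quotient of constants.\<close>

lemma Ts_lim: "Ts \<longlonglongrightarrow> r"
proof -
  have e: "Ts n = (\<gamma>1 - \<gamma>2) / (\<kappa> n * (1 + \<theta> n * \<rho> n))" for n
  proof -
    have "\<kappa> n * (\<theta> n + \<rho> n) = \<gamma>1 - \<gamma>2" using \<kappa>_pos[of n] by (simp add: \<theta>_def \<rho>_def field_simps)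
    moreover have "Ts n = (\<kappa> n * (\<theta> n + \<rho> n)) / (\<kappa> n * (1 + \<theta> n * \<rho> n))"
      using \<kappa>_pos[of n] by (simp add: Ts_def theta_star_def)
    ultimately show ?thesis by simp
  qed
  show ?thesis unfolding e[abs_def] r_def by (intro tendsto_divide tendsto_const \<kappa>p_lim) (use g_pos in auto)
qed

lemma L_scale: "n > 0 \<Longrightarrow> L n = real n / scale n"
proof -
  assume "n > 0"
  then have "real n / sqrt (real n * \<kappa> n) = sqrt (real n / \<kappa> n)"
    using \<kappa>_pos[of n] by (simp add: real_sqrt_mult real_sqrt_divide divide_simps)
  then show ?thesis by (simp add: L_def scale_def) (metis divide_divide_eq_left mult.commute)
qed

lemma L_inv: "(\<lambda>n. inverse (L n)) \<longlonglongrightarrow> 0"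
proof (rule tendsto_inverse_0_at_top)
  have e: "L = (\<lambda>n. sqrt (real n / (\<kappa> n * (lam n)\<^sup>2)))"
  proof
    show "L n = sqrt (real n / (\<kappa> n * (lam n)\<^sup>2))" for n
      using lam_pos[of n] by (simp add: L_def real_sqrt_divide real_sqrt_mult)
  qed
  show "filterlim L at_top sequentially"
    unfolding e by (rule filterlim_compose[OF sqrt_at_top n_over_speed])
qed

lemma SN_pos: "\<forall>\<^sub>F z in LF K. SX z > 0 \<and> SN z > 0"
  using order_tendstoD(1)[OF SX_lim s_pos] eventually_index_pos
proof eventually_elim
  case (elim z)
  have "real (fst z) * \<kappa> (fst z) > 0" using elim \<kappa>_pos by simp
  then have "SX z > 0" using elim(1) divide_nonpos_pos[of "SX z"] by (meson not_less)
  then show ?case using elim(1) by simp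
qed

lemma MX_Bfun: "Bfun (\<lambda>z. MX z / scale (fst z)) (LF K)"
  using martingale_Bfun[of "\<lambda>n k \<omega>. X (n, \<omega>) k" K] XX_Fil by simp

lemma NX_Bfun: "Bfun (\<lambda>z. NX z / scale (fst z)) (LF K)"
proof -
  have "(\<lambda>\<omega>. X (n, \<omega>) (k - 1)) \<in> borel_measurable (Fil k)" for n k
    using Fil_mono[OF XX_Fil, of "k - 1" k] by simp
  moreover have "(\<Sum>k<n. (X (n, \<omega>) (k - 1))\<^sup>2) \<le> SX (n, \<omega>)" for n \<omega>
    using sum_shift_prod(2)[of "X (n, \<omega>)" n] by simp
  ultimately show ?thesis using martingale_Bfun[of "\<lambda>n k \<omega>. X (n, \<omega>) (k - 1)" K] by simp
qed

lemma b_lim: "((\<lambda>z. bX z / scale (fst z)) \<longlongrightarrow> 0) (LF K)"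
  by (rule X_end) auto

lemma c_lim: "((\<lambda>z. cX z / scale (fst z)) \<longlongrightarrow> 0) (LF K)"
  unfolding power2_eq_square by (rule X_end) auto

lemma ratio_lim: "((\<lambda>z. inverse (\<kappa> (fst z)) * inverse (SN z)) \<longlongrightarrow> 0) (LF K)"
proof -
  have "((\<lambda>z. inverse (\<kappa> (fst z)) * inverse (SN z)) \<longlongrightarrow> 0 * inverse s) (LF K)"
    by (intro tendsto_mult tendsto_inverse SX_lim tendsto_LF_fst[OF tendsto_inverse_0_at_top[OF \<kappa>_top]]) (use s_pos in auto)
  then show ?thesis by simp
qed

lemma scaled_ratio:
  "\<forall>\<^sub>F z in LF K. \<forall>y. (y / scale (fst z)) * (inverse (\<kappa> (fst z)) * inverse (SN z)) = L (fst z) * (y / SX z)"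
  using SN_pos eventually_index_pos
proof eventually_elim
  case (elim z)
  then show ?case using \<kappa>_pos[of "fst z"] scale_pos[of "fst z"]
    by (auto simp: L_scale field_simps)
qed

text \<open>NX admits the same bound by a multiple of \<open>scale\<close> as MX, yet it is
  negligible: it is divided by SX alone, not by (1 + p) * SX, and so lacks the factor kappa that
  compensates 1 / kappa in \<open>ratio_lim\<close>.\<close>

lemma Lb: "((\<lambda>z. L (fst z) * (bX z / SX z)) \<longlongrightarrow> 0) (LF K)"
  and Lc: "((\<lambda>z. L (fst z) * (cX z / SX z)) \<longlongrightarrow> 0) (LF K)"
  and LN: "((\<lambda>z. L (fst z) * (NX z / SX z)) \<longlongrightarrow> 0) (LF K)"
proof -
  show "((\<lambda>z. L (fst z) * (bX z / SX z)) \<longlongrightarrow> 0) (LF K)"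
    by (rule Lim_transform_eventually[OF tendsto_mult_zero[OF b_lim ratio_lim]])
      (rule eventually_mono[OF scaled_ratio], blast)
  show "((\<lambda>z. L (fst z) * (cX z / SX z)) \<longlongrightarrow> 0) (LF K)"
    by (rule Lim_transform_eventually[OF tendsto_mult_zero[OF c_lim ratio_lim]])
      (rule eventually_mono[OF scaled_ratio], blast)
  show "((\<lambda>z. L (fst z) * (NX z / SX z)) \<longlongrightarrow> 0) (LF K)"
    by (rule Lim_transform_eventually[OF tendsto_Bfun_mult_zero[OF NX_Bfun ratio_lim]])
      (rule eventually_mono[OF scaled_ratio], blast)
qed

definition Zt :: "nat \<times> 'a \<Rightarrow> real" where "Zt z = L (fst z) * (That z - Ts (fst z))"
definition Zr :: "nat \<times> 'a \<Rightarrow> real" where "Zr z = L (fst z) * (Rhat z - p (fst z) * Ts (fst z))"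

definition D :: "nat \<times> 'a \<Rightarrow> real" where "D z = \<kappa> (fst z) * (1 + p (fst z)) * SN z"

lemma D_lim: "(D \<longlongrightarrow> g * s) (LF K)"
  unfolding D_def p_def by (intro tendsto_mult SX_lim tendsto_LF_fst[OF \<kappa>p_lim])

text \<open>The centring \<open>Ts\<close> is exactly the value that removes the multiple of SX from
  the least squares numerator, leaving the martingale and one boundary product.\<close>

lemma Zt_eq: "\<forall>\<^sub>F z in LF K. Zt z = (MX z / scale (fst z) + p (fst z) * (bX z / scale (fst z))) / D z"
  using SN_pos eventually_index_pos eventually_LF_fst[OF \<kappa>p_ev]
proof eventually_elim
  case (elim z)
  have S: "SX z \<noteq> 0" and p1: "1 + p (fst z) \<noteq> 0" and n: "fst z > 0" using elim by auto
  have nz: "real (fst z) \<noteq> 0" "\<kappa> (fst z) \<noteq> 0" "scale (fst z) \<noteq> 0"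
    using n \<kappa>_pos[of "fst z"] scale_pos[OF n] by auto
  have e1: "(1 + p (fst z)) * (That z * SX z) = (\<theta> (fst z) + \<rho> (fst z)) * SX z + MX z + p (fst z) * bX z"
    unfolding That_eq using S theta_numerator[of "X z", OF X_rec, of "fst z"] by simp
  have e2: "(1 + p (fst z)) * Ts (fst z) = \<theta> (fst z) + \<rho> (fst z)"
    using p1 by (simp add: Ts_def theta_star_def p_def)
  have "(1 + p (fst z)) * SX z * (That z - Ts (fst z)) = (1 + p (fst z)) * (That z * SX z) - ((1 + p (fst z)) * Ts (fst z)) * SX z"
    by (simp only: algebra_simps)
  then have key: "(1 + p (fst z)) * SX z * (That z - Ts (fst z)) = MX z + p (fst z) * bX z"
    unfolding e1 e2 by simp
  have q: "(1 + p (fst z)) * SX z \<noteq> 0" using S p1 by simp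
  have e: "That z - Ts (fst z) = (MX z + p (fst z) * bX z) / ((1 + p (fst z)) * SX z)"
    unfolding key[symmetric] by (rule nonzero_mult_div_cancel_left[OF q, symmetric])
  have "y / scale (fst z) / D z = real (fst z) / scale (fst z) * (y / ((1 + p (fst z)) * SX z))" for y
    unfolding D_def using nz S p1 by simp
  from this[of "MX z + p (fst z) * bX z"] show ?case
    unfolding Zt_def e L_scale[OF n] by (simp add: add_divide_distrib)
qed

lemma D_inv: "((\<lambda>z. inverse (D z)) \<longlongrightarrow> inverse (g * s)) (LF K)"
  by (intro tendsto_inverse D_lim) (use g_pos s_pos in auto)

lemma pb_lim: "((\<lambda>z. p (fst z) * (bX z / scale (fst z))) \<longlongrightarrow> 0) (LF K)"
  using tendsto_mult[OF tendsto_LF_fst[OF p_lim'] b_lim] by simp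

text \<open>A martingale bounded at \<open>scale\<close> times a vanishing error of the denominator,
  plus a vanishing boundary term; off a negligible event the stopping in W does nothing.\<close>

lemma Zt_W: "((\<lambda>z. Zt z - W (fst z) (snd z)) \<longlongrightarrow> 0) (LF K)"
proof -
  have "((\<lambda>z. inverse (D z) - inverse (g * s)) \<longlongrightarrow> 0) (LF K)"
    using tendsto_diff[OF D_inv[of K] tendsto_const[of "inverse (g * s)"]] by (simp only: diff_self)
  then have "((\<lambda>z. MX z / scale (fst z) * (inverse (D z) - inverse (g * s)) + p (fst z) * (bX z / scale (fst z)) * inverse (D z))
     \<longlongrightarrow> 0 + 0 * inverse (g * s)) (LF K)"
    by (intro tendsto_add tendsto_Bfun_mult_zero MX_Bfun tendsto_mult pb_lim D_inv)
  then have "((\<lambda>z. MX z / scale (fst z) * (inverse (D z) - inverse (g * s)) + p (fst z) * (bX z / scale (fst z)) * inverse (D z))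
     \<longlongrightarrow> 0) (LF K)" by simp
  then show ?thesis
  proof (rule Lim_transform_eventually)
    show "\<forall>\<^sub>F z in LF K. MX z / scale (fst z) * (inverse (D z) - inverse (g * s)) + p (fst z) * (bX z / scale (fst z)) * inverse (D z)
        = Zt z - W (fst z) (snd z)"
      using Zt_eq SX_le
    proof eventually_elim
      case (elim z)
      have "trunc (fst z) k (snd z) = X z k" if "k < fst z" for k
        using trunc_eq[of "fst z" "snd z" k] elim(2) that by simp
      then have "W (fst z) (snd z) = MX z / (scale (fst z) * (g * s))"
        unfolding W_def by (intro arg_cong2[where f = "(/)"] sum.cong) auto
      then show ?case unfolding elim(1) by (simp add: divide_inverse algebra_simps)
    qed
  qed
qed

lemma Zt_Bfun: "Bfun Zt (LF K)"
proof -
  have "Bfun (\<lambda>z. MX z / scale (fst z) * inverse (D z) + p (fst z) * (bX z / scale (fst z)) * inverse (D z)) (LF K)"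
  proof -
    obtain B where B: "B > 0" "\<forall>\<^sub>F z in LF K. norm (MX z / scale (fst z)) \<le> B" using BfunE[OF MX_Bfun] by blast
    have gs: "g * s > 0" using g_pos s_pos by simp
    have "\<forall>\<^sub>F z in LF K. \<bar>inverse (D z)\<bar> < inverse (g * s) + 1"
      by (rule order_tendstoD(2)[OF tendsto_rabs[OF D_inv]])
        (use positive_imp_inverse_positive[OF gs] in linarith)
    moreover have "((\<lambda>z. p (fst z) * (bX z / scale (fst z)) * inverse (D z)) \<longlongrightarrow> 0 * inverse (g * s)) (LF K)"
      by (intro tendsto_mult pb_lim D_inv)
    then have "\<forall>\<^sub>F z in LF K. \<bar>p (fst z) * (bX z / scale (fst z)) * inverse (D z)\<bar> < 1"
      by (intro order_tendstoD(2)[OF tendsto_rabs]) auto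
    ultimately have "\<forall>\<^sub>F z in LF K. norm (MX z / scale (fst z) * inverse (D z) + p (fst z) * (bX z / scale (fst z)) * inverse (D z)) \<le> B * (inverse (g * s) + 1) + 1"
      using B(2)
    proof eventually_elim
      case (elim z)
      have "\<bar>MX z / scale (fst z)\<bar> * \<bar>inverse (D z)\<bar> \<le> B * (inverse (g * s) + 1)"
        by (rule mult_mono) (use elim B in auto)
      then have "\<bar>MX z / scale (fst z) * inverse (D z)\<bar> \<le> B * (inverse (g * s) + 1)" by (simp only: abs_mult)
      then show ?case using elim(2) unfolding real_norm_def by linarith
    qed
    then show ?thesis by (rule BfunI)
  qed
  then obtain B where B: "B > 0" "\<forall>\<^sub>F z in LF K. norm (MX z / scale (fst z) * inverse (D z) + p (fst z) * (bX z / scale (fst z)) * inverse (D z)) \<le> B"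
    using BfunE by blast
  have "\<forall>\<^sub>F z in LF K. norm (Zt z) \<le> B"
    using Zt_eq B(2) by eventually_elim (simp add: divide_inverse algebra_simps)
  then show ?thesis by (rule BfunI)
qed

lemma L_pos: "n > 0 \<Longrightarrow> L n > 0"
  using \<kappa>_pos[of n] lam_pos[of n] by (simp add: L_def)

lemma unscale:
  assumes "((\<lambda>z. L (fst z) * f z) \<longlongrightarrow> 0) (LF K)" shows "(f \<longlongrightarrow> 0) (LF K)"
proof -
  have "((\<lambda>z. L (fst z) * f z * inverse (L (fst z))) \<longlongrightarrow> 0) (LF K)"
    by (rule tendsto_mult_zero[OF assms tendsto_LF_fst[OF L_inv]])
  then show ?thesis
  proof (rule Lim_transform_eventually)
    show "\<forall>\<^sub>F z in LF K. L (fst z) * f z * inverse (L (fst z)) = f z"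
      using eventually_index_pos
    proof eventually_elim
      case (elim z)
      then have "L (fst z) \<noteq> 0" using L_pos[of "fst z"] by simp
      then show ?case by simp
    qed
  qed
qed

lemma That_lim: "(That \<longlongrightarrow> r) (LF K)"
proof -
  have "((\<lambda>z. Zt z * inverse (L (fst z)) + Ts (fst z)) \<longlongrightarrow> 0 + r) (LF K)"
    by (intro tendsto_add tendsto_Bfun_mult_zero Zt_Bfun tendsto_LF_fst[OF L_inv] tendsto_LF_fst[OF Ts_lim])
  then have "((\<lambda>z. Zt z * inverse (L (fst z)) + Ts (fst z)) \<longlongrightarrow> r) (LF K)" by simp
  then show ?thesis
  proof (rule Lim_transform_eventually)
    show "\<forall>\<^sub>F z in LF K. Zt z * inverse (L (fst z)) + Ts (fst z) = That z"
      using eventually_index_pos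
    proof eventually_elim
      case (elim z)
      then have "L (fst z) \<noteq> 0" using L_pos[of "fst z"] by simp
      then show ?case by (simp add: Zt_def field_simps)
    qed
  qed
qed

text \<open>The error of rho_hat is that of theta_hat times (T^2 + p) / D plus negligible terms. As
  p tends to -1 and D to 1 - r^2, this factor tends to -1; exponential tightness of Zt turns the
  small deviation from -1 into a negligible one.\<close>

lemma Zr_Zt: "((\<lambda>z. Zr z + Zt z) \<longlongrightarrow> 0) (LF K)"
proof -
  have expand: "l * ((T - t) * q - T * y * b - T * w * c - T * N - w * t * (2 * T * b - T\<^sup>2 * c))
      = l * (T - t) * q - (T * y * (l * b) + T * w * (l * c) + T * (l * N) + w * t * (2 * T * (l * b) - T\<^sup>2 * (l * c)))"
    for l T t q y b w c N :: real by (simp add: algebra_simps)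
  have regroup: "(x * q - j) / d + x = x * (q / d + 1) - j / d" for x q j d :: real
    by (simp add: diff_divide_distrib distrib_left)
  let ?n = "\<lambda>z :: nat \<times> 'a. fst z"
  let ?b = "\<lambda>z. bX z / SX z" and ?c = "\<lambda>z. cX z / SX z" and ?N = "\<lambda>z. NX z / SX z"
  let ?D = "\<lambda>z. (1 - (That z)\<^sup>2) + 2 * That z * ?b z - (That z)\<^sup>2 * ?c z"
  let ?a = "\<lambda>z. \<theta> (?n z) + \<rho> (?n z)"
  let ?J = "\<lambda>z. That z * (That z - ?a z) * (L (?n z) * ?b z) + That z * p (?n z) * (L (?n z) * ?c z) + That z * (L (?n z) * ?N z)
       + p (?n z) * Ts (?n z) * (2 * That z * (L (?n z) * ?b z) - (That z)\<^sup>2 * (L (?n z) * ?c z))"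
  note b = unscale[OF Lb] and c = unscale[OF Lc]
  \<comment> \<open>Limits are left unsimplified so that they match the structural limit rules; the
    zeros stand for the vanishing boundary terms.\<close>
  have Dl: "(?D \<longlongrightarrow> (1 - r\<^sup>2) + 2 * r * 0 - r\<^sup>2 * 0) (LF K)"
    by (intro tendsto_intros That_lim b c)
  have r0: "(1 - r\<^sup>2) + 2 * r * 0 - r\<^sup>2 * 0 > 0" using r_sq by simp
  have al: "(?a \<longlongrightarrow> 1 + - 1) (LF K)"
    by (intro tendsto_add tendsto_LF_fst[OF \<theta>_lim] tendsto_LF_fst[OF \<rho>_lim])
  note pl = tendsto_LF_fst[OF p_lim', of K] and tl = tendsto_LF_fst[OF Ts_lim, of K]
  have J: "((\<lambda>z. ?J z / ?D z) \<longlongrightarrow> (r * (r - (1 + - 1)) * 0 + r * (- 1) * 0 + r * 0 + (- 1) * r * (2 * r * 0 - r\<^sup>2 * 0)) / ((1 - r\<^sup>2) + 2 * r * 0 - r\<^sup>2 * 0)) (LF K)"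
    by (intro tendsto_intros That_lim Dl al pl tl Lb Lc LN) (use r0 in auto)
  have "((\<lambda>z. ((That z)\<^sup>2 + p (?n z)) / ?D z + 1) \<longlongrightarrow> (r\<^sup>2 + - 1) / ((1 - r\<^sup>2) + 2 * r * 0 - r\<^sup>2 * 0) + 1) (LF K)"
    by (intro tendsto_intros That_lim Dl pl) (use r0 in auto)
  moreover have "(r\<^sup>2 + - 1) / ((1 - r\<^sup>2) + 2 * r * 0 - r\<^sup>2 * 0) + 1 = 0" using r_sq by (simp add: field_simps)
  ultimately have Q: "((\<lambda>z. ((That z)\<^sup>2 + p (?n z)) / ?D z + 1) \<longlongrightarrow> 0) (LF K)" by simp
  have "((\<lambda>z. Zt z * (((That z)\<^sup>2 + p (?n z)) / ?D z + 1) - ?J z / ?D z) \<longlongrightarrow> 0) (LF K)"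
    using tendsto_diff[OF tendsto_Bfun_mult_zero[OF Zt_Bfun Q] J] by simp
  then show ?thesis
  proof (rule Lim_transform_eventually)
    show "\<forall>\<^sub>F z in LF K. Zt z * (((That z)\<^sup>2 + p (?n z)) / ?D z + 1) - ?J z / ?D z = Zr z + Zt z"
      using order_tendstoD(1)[OF Dl r0] SN_pos eventually_LF_fst[OF \<kappa>p_ev]
    proof eventually_elim
      case (elim z)
      have S: "SX z \<noteq> 0" and Dn: "?D z \<noteq> 0" and p1: "1 + p (?n z) \<noteq> 0" using elim by auto
      have a: "?a z = Ts (?n z) * (1 + p (?n z))" using p1 by (simp add: Ts_def theta_star_def p_def)
      have T: "That z * SX z = (\<Sum>k<?n z. X z (Suc k) * X z k)" unfolding That_eq using S by simp
      have x0: "X z 0 = 0" by simp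
      have "Rhat z - p (?n z) * Ts (?n z) =
        ((That z - Ts (?n z)) * ((That z)\<^sup>2 + p (?n z)) - That z * (That z - ?a z) * ?b z - That z * p (?n z) * ?c z - That z * ?N z
       - p (?n z) * Ts (?n z) * (2 * That z * ?b z - (That z)\<^sup>2 * ?c z)) / ?D z"
        unfolding Rhat_eq rho_sums[of "X z", OF X_rec x0 T refl]
        by (rule rho_error_algebra[OF S Dn a])
      then have "Zr z = L (?n z) * ((That z - Ts (?n z)) * ((That z)\<^sup>2 + p (?n z)) - That z * (That z - ?a z) * ?b z - That z * p (?n z) * ?c z - That z * ?N z
       - p (?n z) * Ts (?n z) * (2 * That z * ?b z - (That z)\<^sup>2 * ?c z)) / ?D z" unfolding Zr_def by simp
      also have "L (?n z) * ((That z - Ts (?n z)) * ((That z)\<^sup>2 + p (?n z)) - That z * (That z - ?a z) * ?b z - That z * p (?n z) * ?c z - That z * ?N z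
       - p (?n z) * Ts (?n z) * (2 * That z * ?b z - (That z)\<^sup>2 * ?c z)) = Zt z * ((That z)\<^sup>2 + p (?n z)) - ?J z"
        unfolding Zt_def by (rule expand)
      finally have "Zr z = (Zt z * ((That z)\<^sup>2 + p (?n z)) - ?J z) / ?D z" .
      then show ?case unfolding regroup[symmetric] by simp
    qed
  qed
qed

lemma hat_measurable: "(\<lambda>\<omega>. Zt (n, \<omega>)) \<in> borel_measurable M" "(\<lambda>\<omega>. Zr (n, \<omega>)) \<in> borel_measurable M"
proof -
  have t [measurable]: "(\<lambda>\<omega>. That (n, \<omega>)) \<in> borel_measurable M"
    unfolding That_eq by (simp del: ar_X.simps)
  have "(\<lambda>\<omega>. Rhat (n, \<omega>)) \<in> borel_measurable M"
    unfolding Rhat_eq by (simp del: ar_X.simps)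
  then show "(\<lambda>\<omega>. Zt (n, \<omega>)) \<in> borel_measurable M" "(\<lambda>\<omega>. Zr (n, \<omega>)) \<in> borel_measurable M"
    unfolding Zt_def Zr_def by simp_all
qed

lemma v_pos: "v > 0" using \<sigma>_pos g_pos s_pos by (simp add: v_def)

text \<open>The noise variance cancels between numerator and denominator of v, leaving v = 8 *
  \<gamma>1 * \<gamma>2 / g^3; the minus sign appears because g = - (\<gamma>1 + \<gamma>2).\<close>

lemma rate_eq: "- ((\<gamma>1 + \<gamma>2)^3 * x\<^sup>2) / (16 * \<gamma>1 * \<gamma>2) = x\<^sup>2 / (2 * v)"
proof -
  have "2 * v * (g ^ 3 / (16 * \<gamma>1 * \<gamma>2)) = 1"
    using \<gamma>1 \<gamma>2 g_pos \<sigma>_pos by (simp add: v_def s_def power2_eq_square eval_nat_numeral)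
  then have "1 / (2 * v) = g ^ 3 / (16 * \<gamma>1 * \<gamma>2)" using v_pos by (simp add: field_simps)
  then have "x\<^sup>2 * (1 / (2 * v)) = x\<^sup>2 * (g ^ 3 / (16 * \<gamma>1 * \<gamma>2))" by (simp only:)
  moreover have "(\<gamma>1 + \<gamma>2)^3 = - (g ^ 3)" by (simp add: g_def flip: minus_add_distrib)
  ultimately show ?thesis by (simp only: mult_minus_left minus_minus times_divide_eq_right mult_1_right mult.commute)
qed

lemma LDP_theta: "LDP M (\<lambda>n \<omega>. Zt (n, \<omega>)) (\<lambda>n. (lam n)\<^sup>2) (\<lambda>x. x\<^sup>2 / (2 * v))"
  by (rule LDP_quadratic[OF W_measurable W_int W_lim v_pos hat_measurable(1)]) (use Zt_W in simp)

text \<open>The proxy is -W, whose log-mgf at u is that of W at -u and so has the same quadratic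
  limit.\<close>

lemma LDP_rho: "LDP M (\<lambda>n \<omega>. Zr (n, \<omega>)) (\<lambda>n. (lam n)\<^sup>2) (\<lambda>x. x\<^sup>2 / (2 * v))"
proof (rule LDP_quadratic[where W = "\<lambda>n \<omega>. - W n \<omega>", OF _ _ _ v_pos hat_measurable(2)])
  fix u K
  show "\<forall>\<^sub>F n in sequentially. integrable M (\<lambda>\<omega>. exp (u * (lam n)\<^sup>2 * - W n \<omega>))"
    using W_int[of "- u"] by simp
  show "(\<lambda>n. ln (expectation (\<lambda>\<omega>. exp (u * (lam n)\<^sup>2 * - W n \<omega>))) / (lam n)\<^sup>2) \<longlonglongrightarrow> v * u\<^sup>2 / 2"
    using W_lim[of "- u"] by simp
  show "((\<lambda>z. Zr (fst z, snd z) - - W (fst z) (snd z)) \<longlongrightarrow> 0) (LF K)"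
    using tendsto_diff[OF Zr_Zt Zt_W, of K] by simp
qed simp

end

theorem theorem2p2:
  fixes M :: "'a measure" and V :: "nat \<Rightarrow> 'a \<Rightarrow> real"
    and \<sigma> t0 \<gamma>1 \<gamma>2 :: real and \<kappa> lam :: "nat \<Rightarrow> real"
  assumes "prob_space M"
    and "prob_space.indep_vars M (\<lambda>_. borel) V {1..}"
    and "\<And>k. k \<ge> 1 \<Longrightarrow> distr M borel (V k) = distr M borel (V 1)"
    and "integrable M (V 1)" and "prob_space.expectation M (V 1) = 0"
    and "integrable M (\<lambda>\<omega>. (V 1 \<omega>)\<^sup>2)"
    and "prob_space.expectation M (\<lambda>\<omega>. (V 1 \<omega>)\<^sup>2) = \<sigma>\<^sup>2" and "\<sigma> > 0"
    and "t0 > 0" and "integrable M (\<lambda>\<omega>. exp (t0 * (V 1 \<omega>)\<^sup>2))"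
    and "\<And>n. \<kappa> n > 0" and "filterlim \<kappa> at_top sequentially"
    and "\<gamma>1 < 0" and "\<gamma>2 < 0"
    \<comment> \<open>(H-II)\<close>
    and "incseq lam" and "\<And>n. lam n > 0" and "filterlim lam at_top sequentially"
    and "filterlim (\<lambda>n. real n / ((lam n)^6 * (\<kappa> n)^6)) at_top sequentially"
    and "filterlim (\<lambda>n. real n / ((lam n)\<^sup>2 * (\<kappa> n)^11)) at_top sequentially"
    and "filterlim (\<lambda>n. real n * (lam n)\<^sup>2 / ((\<kappa> n)^7 * (ln (real n))\<^sup>2)) at_top sequentially"
    \<comment> \<open>(C-L(lambda_n))\<close>
    and "((\<lambda>n. eln (real n * measure M {\<omega> \<in> space M. \<bar>V 1 \<omega>\<bar>^4 > lam n * sqrt (real n)})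
                / ereal ((lam n)\<^sup>2)) \<longlongrightarrow> -\<infinity>) sequentially"
  defines "\<theta> \<equiv> \<lambda>n. 1 + \<gamma>1 / \<kappa> n"
    and "\<rho> \<equiv> \<lambda>n. -1 - \<gamma>2 / \<kappa> n"
    and "J \<equiv> \<lambda>x. - ((\<gamma>1 + \<gamma>2)^3 * x\<^sup>2) / (16 * \<gamma>1 * \<gamma>2)"
  shows "LDP M (\<lambda>n \<omega>. sqrt (real n / \<kappa> n) / lam n *
              (theta_hat (\<theta> n) (\<rho> n) (\<lambda>k. V k \<omega>) n - theta_star (\<theta> n) (\<rho> n)))
           (\<lambda>n. (lam n)\<^sup>2) J
       \<and> LDP M (\<lambda>n \<omega>. sqrt (real n / \<kappa> n) / lam n *
              (rho_hat (\<theta> n) (\<rho> n) (\<lambda>k. V k \<omega>) n - rho_star (\<theta> n) (\<rho> n)))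
           (\<lambda>n. (lam n)\<^sup>2) J"
proof -
  interpret prob_space M by fact
  interpret c: ar_caseII M V \<sigma> t0 lam \<kappa> \<gamma>1 \<gamma>2
    by unfold_locales (fact assms)+
  have tr: "c.\<theta> = \<theta>" "c.\<rho> = \<rho>" by (auto simp: c.\<theta>_def c.\<rho>_def \<theta>_def \<rho>_def)
  have J: "J = (\<lambda>x. x\<^sup>2 / (2 * c.v))" unfolding J_def using c.rate_eq by auto
  show ?thesis
    using c.LDP_theta c.LDP_rho
    unfolding J c.Zt_def c.Zr_def c.That_def c.Rhat_def c.Ts_def c.L_def c.p_def tr rho_star_def fst_conv snd_conv
    by blast
qed

end
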